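(* There are only finitely many imaginary quadratic fields $K$ such that $Cl(K)/Po(K)$ is trivial, i.e. such that $Cl(K)=Po(K)$.
   Context: For a number field $K$ and a positive integer $q$, let $I_K^q$ be the product of all prime ideals of $\mathcal{O}_K$ of absolute norm $q$ (with $I_K^q=\mathcal{O}_K$ if there is none). The Pólya group $Po(K)$ is the subgroup of the ideal class group $Cl(K)$ generated by the classes of the ideals $I_K^q$; for $K/\mathbb{Q}$ Galois it is the subgroup generated by the classes of ambiguous ideals. *)

theory Defs
  imports
    Complex_Main
    "HOL-Computational_Algebra.Polynomial"
    "HOL-Algebra.Algebra"
    "HOL-Algebra.Algebraic_Closure_Type"
begin

abbreviation complex_ring :: "complex ring"
  where "complex_ring \<equiv> ring_of_type_algebra"

text \<open>
  Number fields are taken inside the complex numbers. Nothing is lost by this for quadratic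
  fields: an abstract quadratic field embeds in the complex numbers, and all its embeddings have
  the same image because it is Galois. So isomorphism classes of (imaginary) quadratic fields
  correspond to (imaginary) quadratic subfields of the complex numbers.
\<close>

definition number_field :: "complex set \<Rightarrow> bool"
  where "number_field K \<longleftrightarrow>
    subfield K complex_ring \<and> ring.finite_dimension complex_ring \<rat> K"

definition imaginary_quadratic_field :: "complex set \<Rightarrow> bool"
  where "imaginary_quadratic_field K \<longleftrightarrow>
    number_field K \<and> ring.dimension complex_ring 2 \<rat> K \<and> \<not> K \<subseteq> \<real>"

definition ring_of_integers :: "complex set \<Rightarrow> complex ring"
  where "ring_of_integers K = complex_ring\<lparr>carrier := {x \<in> K. algebraic_int x}\<rparr>"

definition absolute_norm :: "complex set \<Rightarrow> complex set \<Rightarrow> nat"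
  where "absolute_norm K I = Coset.order (ring_of_integers K Quot I)"

definition fractional_ideal :: "complex set \<Rightarrow> complex set \<Rightarrow> bool"
  where "fractional_ideal K J \<longleftrightarrow>
    additive_subgroup J complex_ring \<and> J \<subseteq> K \<and> J \<noteq> {0} \<and>
    (\<forall>a \<in> carrier (ring_of_integers K). \<forall>x \<in> J. a * x \<in> J) \<and>
    (\<exists>d \<in> carrier (ring_of_integers K). d \<noteq> 0 \<and>
       (\<forall>x \<in> J. d * x \<in> carrier (ring_of_integers K)))"

definition fractional_ideal_group :: "complex set \<Rightarrow> complex set monoid"
  where "fractional_ideal_group K =
    \<lparr>carrier = {J. fractional_ideal K J},
     monoid.mult = ideal_prod complex_ring,
     one = carrier (ring_of_integers K)\<rparr>"

definition principal_fractional_ideals :: "complex set \<Rightarrow> complex set set"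
  where "principal_fractional_ideals K =
    {(\<lambda>a. x * a) ` carrier (ring_of_integers K) | x. x \<in> K \<and> x \<noteq> 0}"

definition class_group :: "complex set \<Rightarrow> complex set set monoid"
  where "class_group K = fractional_ideal_group K Mod principal_fractional_ideals K"

definition ideal_class :: "complex set \<Rightarrow> complex set \<Rightarrow> complex set set"
  where "ideal_class K J =
    principal_fractional_ideals K #>\<^bsub>fractional_ideal_group K\<^esub> J"

text \<open>
  The zero ideal, although prime, does not occur in the product below when \<open>q > 0\<close>: its quotient
  is infinite, so its absolute norm is \<open>0\<close>.
\<close>

definition norm_ideal :: "complex set \<Rightarrow> nat \<Rightarrow> complex set"
  where "norm_ideal K q =
    (\<Otimes>\<^bsub>fractional_ideal_group K\<^esub> P \<in> {P. primeideal P (ring_of_integers K) \<and>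
       absolute_norm K P = q}. P)"

definition polya_group :: "complex set \<Rightarrow> complex set set set"
  where "polya_group K =
    generate (class_group K) {ideal_class K (norm_ideal K q) | q. q > 0}"

end

theory Submission
  imports Defs "HOL-Number_Theory.Number_Theory" "HOL-Analysis.Uniform_Limit"
begin

text \<open>
  Let \<open>K\<close> be generated by a square root of \<open>- d\<close>, with \<open>d\<close> squarefree. For every fractional ideal
  \<open>J\<close> the product of \<open>J\<close> and its complex conjugate is principal, and the generators of the Polya group
  are classes of ideals stable under conjugation. So if the Polya group is the whole class group, the
  square of every ideal is principal. An ideal of norm \<open>n\<close> prime to \<open>2 d\<close> and not divisible by any
  integer then gives \<open>4 n\<^sup>2 = u\<^sup>2 + d v\<^sup>2\<close> with \<open>v \<noteq> 0\<close>. Norms of this kind are sparse, and up to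
  \<open>d\<^sup>1\<^sup>2\<close> the sum over ideals of \<open>n\<^sup>-\<^sup>s\<close>, for \<open>s\<close> near \<open>1\<close>, is almost the sum over the squares \<open>n = k\<^sup>2\<close>.

  That this happens for finitely many \<open>d\<close> only is an ineffective argument in the style of Deuring,
  Heilbronn and Siegel. The sum over ideals is also the product of the zeta function and \<open>L(s, \<psi>\<^sub>d)\<close>,
  where \<open>\<psi>\<^sub>d\<close> is the quadratic character. At \<open>s = 199/200\<close> the zeta function is negative, whereas the sum
  over squares is positive. Hence \<open>L(s, \<psi>\<^sub>d) < 0\<close> for large \<open>d\<close>, and \<open>L(\<beta>, \<psi>\<^sub>e) = 0\<close> for some \<open>e\<close> in the set
  and some real \<open>\<beta> \<ge> s\<close>. For \<open>d\<close> much larger than \<open>e\<close>, twisting the sum over ideals by \<open>\<psi>\<^sub>e\<close> gives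
  \<open>L(\<beta>, \<psi>\<^sub>e) L(\<beta>, \<psi>\<^sub>e \<psi>\<^sub>d) = 0\<close>, but the sum over squares is still at least \<open>1\<close>.
\<close>

hide_const (open) Divisibility.prime

section \<open>Dirichlet series with bounded coefficient sums\<close>

text \<open>Everything takes place on the real axis. Bounded coefficient sums give convergence for
  \<open>s > 0\<close>, and the hyperbola method compares a truncated convolution with the product
  of two such series; its error is linear in the two bounds and gains a power of the cutoff. The
  bounds and the sieving of the primes dividing \<open>2 * d\<close> together cost d^2, so a cutoff
  at d^12 leaves d^2 * d^(-12/5) = d^(-2/5). The same cutoff must keep the exceptional norms 4 n^2 =
  u^2 + d v^2 negligible. Each is at least sqrt(d) v / 2, which saves d^(-1/2); summing over v and
  bounding divisor counts costs N^(1/40), that is d^(3/10) at N = d^12. The net saving is d^(-1/5),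
  and this balance is why \<open>s\<close> must lie as close to 1 as 199/200. Of the zero \<beta>
  nothing is used but its existence between 199/200 and 2, and of \<open>e\<close> only that it is
  fixed before \<open>d\<close> is chosen. No size for \<open>e\<close> comes out of the argument,
  which is where effectivity is lost.\<close>

definition bounded_sums :: "(nat \<Rightarrow> real) \<Rightarrow> real \<Rightarrow> bool"
  where "bounded_sums f A \<longleftrightarrow> (\<forall>n. \<bar>\<Sum>k=1..n. f k\<bar> \<le> A)"

text \<open>Summation starts at 0, but \<open>0 powr x\<close> is 0, so the term at 0 vanishes and
  this is the usual Dirichlet series at a real argument.\<close>

definition dseries :: "(nat \<Rightarrow> real) \<Rightarrow> real \<Rightarrow> real"
  where "dseries f s = suminf (\<lambda>n. f n * real n powr - s)"

lemma bounded_sums_nonneg: "bounded_sums f A \<Longrightarrow> 0 \<le> A"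
  unfolding bounded_sums_def by (metis abs_ge_zero order_trans)

text \<open>Partial summation with the coefficient sums rebased at \<open>m\<close>: two of them
  differ by at most 2 A, and the decrements of the weight telescope to \<open>w (Suc m)\<close>.
  Monotonicity is asked for from 1 on because the weight \<open>real k powr - s\<close> jumps from 0
  to 1 between 0 and 1.\<close>

lemma abel_summation_bound:
  fixes f w :: "nat \<Rightarrow> real"
  assumes "bounded_sums f A" "m \<le> n"
    and dec: "\<And>k. k \<ge> 1 \<Longrightarrow> w (Suc k) \<le> w k" and nn: "\<And>k. w k \<ge> 0"
  shows "\<bar>\<Sum>k=Suc m..n. f k * w k\<bar> \<le> 2 * A * w (Suc m)"
proof -
  define S where "S n = (\<Sum>k=1..n. f k)" for n
  have S: "\<bar>S k - S m\<bar> \<le> 2 * A" for k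
  proof -
    have "\<bar>S k\<bar> \<le> A" "\<bar>S m\<bar> \<le> A"
      using assms(1) unfolding bounded_sums_def S_def by auto
    thus ?thesis by linarith
  qed
  have eq: "(\<Sum>k=Suc m..n. f k * w k) =
      (\<Sum>k=Suc m..n. (S k - S m) * (w k - w (Suc k))) + (S n - S m) * w (Suc n)"
    using assms(2)
  proof (induction n rule: dec_induct)
    case base show ?case by simp
  next
    case (step n)
    have "S (Suc n) = S n + f (Suc n)" by (simp add: S_def)
    thus ?case using step by (simp add: algebra_simps)
  qed
  have tel: "(\<Sum>k=Suc m..n. w k - w (Suc k)) = w (Suc m) - w (Suc n)"
    using assms(2) by (induction n rule: dec_induct) auto
  have "\<bar>\<Sum>k=Suc m..n. (S k - S m) * (w k - w (Suc k))\<bar> \<le>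
      (\<Sum>k=Suc m..n. \<bar>(S k - S m) * (w k - w (Suc k))\<bar>)" by (rule sum_abs)
  also have "\<dots> \<le> (\<Sum>k=Suc m..n. 2 * A * (w k - w (Suc k)))"
    using S dec bounded_sums_nonneg[OF assms(1)] by (intro sum_mono) (auto simp: abs_mult intro!: mult_mono)
  also have "\<dots> = 2 * A * (w (Suc m) - w (Suc n))"
    by (simp add: tel flip: sum_distrib_left)
  finally have 1: "\<bar>\<Sum>k=Suc m..n. (S k - S m) * (w k - w (Suc k))\<bar> \<le> 2 * A * (w (Suc m) - w (Suc n))" .
  have "\<bar>(S n - S m) * w (Suc n)\<bar> \<le> 2 * A * w (Suc n)"
    using S[of n] nn[of "Suc n"] by (simp add: abs_mult mult_right_mono)
  thus ?thesis using 1 unfolding eq by (simp add: algebra_simps)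
qed

lemma dseries_partial_bound:
  assumes "bounded_sums f A" "m \<le> n" "s > 0"
  shows "\<bar>\<Sum>k=Suc m..n. f k * real k powr - s\<bar> \<le> 2 * A * real (Suc m) powr - s"
  using assms by (intro abel_summation_bound) (auto intro!: powr_mono2')

lemma powr_neg_Suc_tendsto_0:
  assumes "s > 0" shows "(\<lambda>n. real (Suc n) powr - s) \<longlonglongrightarrow> 0"
proof -
  have "filterlim (\<lambda>n. real (Suc n)) at_top sequentially"
    using filterlim_real_sequentially filterlim_sequentially_Suc by blast
  thus ?thesis using assms by (intro tendsto_neg_powr) auto
qed

lemma dseries_summable:
  assumes "bounded_sums f A" "s > 0"
  shows "summable (\<lambda>n. f n * real n powr - s)"
  unfolding summable_Cauchy
proof (intro allI impI)
  fix e :: real assume "e > 0"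
  have "(\<lambda>n. 2 * A * real (Suc n) powr - s) \<longlonglongrightarrow> 2 * A * 0"
    by (intro tendsto_intros powr_neg_Suc_tendsto_0 assms)
  hence "\<forall>\<^sub>F n in sequentially. 2 * A * real (Suc n) powr - s < e"
    using \<open>e > 0\<close> by (intro order_tendstoD) auto
  then obtain N where N: "\<And>n. n \<ge> N \<Longrightarrow> 2 * A * real (Suc n) powr - s < e"
    unfolding eventually_sequentially by auto
  show "\<exists>N. \<forall>m\<ge>N. \<forall>n. norm (\<Sum>k=m..<n. f k * real k powr - s) < e"
  proof (intro exI allI impI)
    \<comment> \<open>Starting one later keeps \<open>m - 1\<close> at least \<open>N\<close> and
      lets the block be read as one beginning at \<open>Suc (m - 1)\<close>, the shape of the Abel
      bound.\<close>
    fix m n assume m: "Suc N \<le> m"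
    show "norm (\<Sum>k=m..<n. f k * real k powr - s) < e"
    proof (cases "m < n")
      case True
      hence "{m..<n} = {Suc (m-1)..n-1}" using m by auto
      hence "norm (\<Sum>k=m..<n. f k * real k powr - s) \<le> 2 * A * real (Suc (m-1)) powr - s"
        using dseries_partial_bound[OF assms(1) _ assms(2), of "m-1" "n-1"] True m by simp
      also have "\<dots> < e" using N[of "m-1"] m by simp
      finally show ?thesis .
    qed (use \<open>e > 0\<close> in auto)
  qed
qed

lemma dseries_tail:
  assumes "bounded_sums f A" "s > 0"
  shows "\<bar>dseries f s - (\<Sum>k=1..m. f k * real k powr - s)\<bar> \<le> 2 * A * real (Suc m) powr - s"
proof -
  let ?g = "\<lambda>k. f k * real k powr - s"
  have eq: "(\<Sum>k\<le>n. ?g k) = (\<Sum>k=1..n. ?g k)" for n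
    by (simp add: atMost_atLeast0 sum.atLeast_Suc_atMost)
  have lim: "(\<lambda>n. (\<Sum>k=1..n. ?g k)) \<longlonglongrightarrow> dseries f s"
    using summable_LIMSEQ'[OF dseries_summable[OF assms]] unfolding dseries_def eq .
  have "(\<lambda>n. \<bar>(\<Sum>k=1..n. ?g k) - (\<Sum>k=1..m. ?g k)\<bar>) \<longlonglongrightarrow> \<bar>dseries f s - (\<Sum>k=1..m. ?g k)\<bar>"
    by (intro tendsto_intros lim)
  moreover have "\<forall>\<^sub>F n in sequentially. \<bar>(\<Sum>k=1..n. ?g k) - (\<Sum>k=1..m. ?g k)\<bar> \<le> 2 * A * real (Suc m) powr - s"
    using eventually_ge_at_top[of m]
  proof eventually_elim
    case (elim n)
    have "(\<Sum>k=1..n. ?g k) = (\<Sum>k=1..m. ?g k) + (\<Sum>k=Suc m..n. ?g k)"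
      using elim by (induction n rule: dec_induct) auto
    thus ?case using dseries_partial_bound[OF assms(1) elim assms(2)] by simp
  qed
  ultimately show ?thesis by (rule tendsto_upperbound) simp
qed

lemma dseries_bound:
  assumes "bounded_sums f A" "s > 0"
  shows "\<bar>dseries f s\<bar> \<le> 2 * A"
  using dseries_tail[OF assms, of 0] by simp

text \<open>On a ray bounded away from 0 the tail bound is uniform, being largest at the left end.
  Continuity serves the intermediate value theorem, which produces the zero \<beta>.\<close>

lemma dseries_continuous:
  assumes "bounded_sums f A" "a > 0"
  shows "continuous_on {a..} (dseries f)"
proof -
  have "uniform_limit {a..} (\<lambda>n s. \<Sum>k=1..n. f k * real k powr - s) (dseries f) sequentially"
  proof (rule uniform_limitI)
    fix e :: real assume "e > 0"
    have "(\<lambda>n. 2 * A * real (Suc n) powr - a) \<longlonglongrightarrow> 2 * A * 0"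
      by (intro tendsto_intros powr_neg_Suc_tendsto_0 assms)
    hence "\<forall>\<^sub>F n in sequentially. 2 * A * real (Suc n) powr - a < e"
      using \<open>e > 0\<close> by (intro order_tendstoD) auto
    thus "\<forall>\<^sub>F n in sequentially. \<forall>s\<in>{a..}. dist (\<Sum>k=1..n. f k * real k powr - s) (dseries f s) < e"
    proof eventually_elim
      case (elim n)
      show ?case
      proof
        fix s assume "s \<in> {a..}"
        hence s: "s \<ge> a" "s > 0" using assms by auto
        have "dist (\<Sum>k=1..n. f k * real k powr - s) (dseries f s) \<le> 2 * A * real (Suc n) powr - s"
          using dseries_tail[OF assms(1) s(2), of n] by (simp add: dist_real_def abs_minus_commute)
        also have "\<dots> \<le> 2 * A * real (Suc n) powr - a"
          using s bounded_sums_nonneg[OF assms(1)] by (intro mult_left_mono powr_mono) auto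
        also note elim
        finally show "dist (\<Sum>k=1..n. f k * real k powr - s) (dseries f s) < e" .
      qed
    qed
  qed
  thus ?thesis
    by (rule uniform_limit_theorem[rotated])
       (auto intro!: always_eventually continuous_intros)
qed

section \<open>Dirichlet convolution and the hyperbola method\<close>

definition dconv :: "(nat \<Rightarrow> real) \<Rightarrow> (nat \<Rightarrow> real) \<Rightarrow> nat \<Rightarrow> real"
  where "dconv f g n = (\<Sum>b | b dvd n. f (n div b) * g b)"

lemma sum_dconv:
  "(\<Sum>n=1..N. dconv f g n * real n powr - s) =
   (\<Sum>(a,b)\<in>{(a,b). a \<ge> 1 \<and> b \<ge> 1 \<and> a * b \<le> N}. (f a * real a powr - s) * (g b * real b powr - s))"
proof -
  have "(\<Sum>n=1..N. dconv f g n * real n powr - s) =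
        (\<Sum>n=1..N. \<Sum>b | b dvd n. f (n div b) * g b * real n powr - s)"
    by (simp add: dconv_def sum_distrib_right)
  also have "\<dots> = (\<Sum>(n,b)\<in>(SIGMA n:{1..N}. {b. b dvd n}). f (n div b) * g b * real n powr - s)"
    by (rule sum.Sigma) (auto intro!: finite_divisors_nat)
  also have "\<dots> = (\<Sum>(a,b)\<in>{(a,b). a \<ge> 1 \<and> b \<ge> 1 \<and> a * b \<le> N}. (f a * real a powr - s) * (g b * real b powr - s))"
    by (rule sum.reindex_bij_witness[of _ "\<lambda>(a,b). (a*b,b)" "\<lambda>(n,b). (n div b, b)"])
       (auto simp: powr_mult mult.commute elim!: dvdE)
  finally show ?thesis .
qed

text \<open>Lattice points under the hyperbola split at \<open>a = y\<close>: beyond it,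
  \<open>b\<close> is at most \<open>y\<close>. The inner sums over \<open>a\<close> in the second
  part then start after \<open>y\<close>, so Abel summation makes them small.\<close>

lemma hyperbola:
  fixes F G :: "nat \<Rightarrow> real"
  shows "(\<Sum>(a,b)\<in>{(a,b). a \<ge> 1 \<and> b \<ge> 1 \<and> a * b \<le> y^2}. F a * G b) =
    (\<Sum>a=1..y. F a * (\<Sum>b=1..y^2 div a. G b)) + (\<Sum>b=1..y. G b * (\<Sum>a=Suc y..y^2 div b. F a))"
proof -
  have split: "{(a,b). a \<ge> 1 \<and> b \<ge> 1 \<and> a * b \<le> y^2} =
     (SIGMA a:{1..y}. {1..y^2 div a}) \<union> prod.swap ` (SIGMA b:{1..y}. {Suc y..y^2 div b})" (is "?L = ?A \<union> ?B")
  proof (rule equalityI; rule subrelI)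
    fix a b assume "(a, b) \<in> ?L"
    hence *: "1 \<le> a" "1 \<le> b" "a * b \<le> y^2" by auto
    show "(a, b) \<in> ?A \<union> ?B"
    proof (cases "a \<le> y")
      case True
      have "b \<le> y^2 div a" using * by (simp add: less_eq_div_iff_mult_less_eq mult.commute)
      thus ?thesis using * True by auto
    next
      case False
      have "b \<le> y"
      proof (rule ccontr)
        assume "\<not> b \<le> y"
        hence "y * y < a * b" using False by (intro mult_strict_mono) auto
        thus False using * by (simp add: power2_eq_square)
      qed
      moreover have "a \<le> y^2 div b" using * by (simp add: less_eq_div_iff_mult_less_eq)
      ultimately have "(b, a) \<in> (SIGMA b:{1..y}. {Suc y..y^2 div b})" using * False by auto
      thus ?thesis by force
    qed
  next
    fix a b assume "(a, b) \<in> ?A \<union> ?B"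
    thus "(a, b) \<in> ?L"
      by (auto simp: less_eq_div_iff_mult_less_eq mult.commute)
  qed
  have "(\<Sum>(a,b)\<in>?L. F a * G b) = (\<Sum>(a,b)\<in>?A. F a * G b) + (\<Sum>(a,b)\<in>?B. F a * G b)"
    unfolding split by (intro sum.union_disjoint) auto
  also have "(\<Sum>(a,b)\<in>?A. F a * G b) = (\<Sum>a=1..y. F a * (\<Sum>b=1..y^2 div a. G b))"
    by (subst sum.Sigma[symmetric]) (auto simp: sum_distrib_left)
  also have "(\<Sum>(a,b)\<in>?B. F a * G b) = (\<Sum>(b,a)\<in>(SIGMA b:{1..y}. {Suc y..y^2 div b}). G b * F a)"
    by (subst sum.reindex) (auto simp: case_prod_unfold mult.commute)
  also have "\<dots> = (\<Sum>b=1..y. G b * (\<Sum>a=Suc y..y^2 div b. F a))"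
    by (subst sum.Sigma[symmetric]) (auto simp: sum_distrib_left)
  finally show ?thesis .
qed

lemma sum_inverse_sqrt_le: "(\<Sum>b=1..y. real b powr - (1/2)) \<le> 2 * sqrt (real y)"
proof (induction y)
  case (Suc y)
  have "real (Suc y) powr - (1/2) = 1 / sqrt (real (Suc y))"
    using powr_half_sqrt[of "real (Suc y)"] by (simp only: powr_minus divide_inverse)
  also have "1 / sqrt (real (Suc y)) \<le> 2 * (sqrt (real (Suc y)) - sqrt (real y))"
  proof -
    define u v where "u = sqrt (real (Suc y))" and "v = sqrt (real y)"
    have uv: "u > 0" "v \<ge> 0" "u * u = v * v + 1" by (auto simp: u_def v_def)
    \<comment> \<open>As u^2 = v^2 + 1, this square equals 2 (u - v) u - 1.\<close>
    have "0 \<le> (u - v) * (u - v)" by simp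
    hence "1 \<le> 2 * (u - v) * u" using uv(3) by (simp add: algebra_simps)
    thus ?thesis using uv unfolding u_def[symmetric] v_def[symmetric] by (simp add: pos_divide_le_eq)
  qed
  finally have "real (Suc y) powr - (1/2) \<le> 2 * (sqrt (real (Suc y)) - sqrt (real y))" .
  moreover have "(\<Sum>b=1..Suc y. real b powr - (1/2)) = (\<Sum>b=1..y. real b powr - (1/2)) + real (Suc y) powr - (1/2)"
    by (simp only: sum.cl_ivl_Suc) simp
  moreover have "a' \<le> 2 * v" if "p \<le> 2 * (v - u)" "a' = a + p" "a \<le> 2 * u" for a a' p u v :: real
    using that by argo
  ultimately show ?case using Suc by blast
qed auto

text \<open>Three truncations are paid for. Cutting the series of \<open>g\<close> at y^2 / a costs
  6 B y^(-2s) for each of the \<open>y\<close> values of \<open>a\<close>. The part with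
  \<open>a > y\<close> costs 2 A y^(-s) times the sum of b^(-1/2), in all 4 A y^(1/2 - s); this
  exponent, at most -2/5 for s >= 9/10, is the worst one. Cutting the series of \<open>f\<close> at
  \<open>y\<close> costs 4 A B y^(-s). The constants add up to 14.\<close>

lemma dseries_product_approx:
  assumes f: "bounded_sums f A" "A \<ge> 1" "\<And>n. \<bar>f n\<bar> \<le> 3"
    and g: "bounded_sums g B" "B \<ge> 1" "\<And>n. \<bar>g n\<bar> \<le> 1"
    and s: "s \<ge> 9/10" and y: "y \<ge> 1"
  shows "\<bar>(\<Sum>n=1..y^2. dconv f g n * real n powr - s) - dseries f s * dseries g s\<bar>
    \<le> 14 * A * B * real y powr - (2/5)"
proof -
  define F where "F n = f n * real n powr - s" for n
  define G where "G n = g n * real n powr - s" for n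
  have s0: "s > 0" using s by simp
  have yp: "real y powr a \<le> real y powr b" if "a \<le> b" for a b
    using y that by (intro powr_mono) auto
  have e1: "\<bar>(\<Sum>a=1..y. F a * (\<Sum>b=1..y^2 div a. G b)) - (\<Sum>a=1..y. F a) * dseries g s\<bar> \<le> 6 * B * real y powr - (2/5)"
  proof -
    have *: "\<bar>F a * ((\<Sum>b=1..y^2 div a. G b) - dseries g s)\<bar> \<le> 6 * B * real y powr (- 2 * s)"
      if a: "a \<in> {1..y}" for a
    proof -
      have "y^2 < Suc (y^2 div a) * a"
        using dividend_less_div_times[of a "y^2"] a by simp
      hence "real (y^2) < real (Suc (y^2 div a)) * real a"
        unfolding of_nat_mult[symmetric] of_nat_less_iff .
      hence le: "real y ^ 2 / real a \<le> real (Suc (y^2 div a))"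
        using a by (simp add: field_simps)
      have "\<bar>(\<Sum>b=1..y^2 div a. G b) - dseries g s\<bar> \<le> 2 * B * real (Suc (y^2 div a)) powr - s"
        using dseries_tail[OF g(1) s0] unfolding G_def by (simp add: abs_minus_commute)
      also have "\<dots> \<le> 2 * B * (real y ^ 2 / real a) powr - s"
        using le a y g(2) s0 by (intro mult_left_mono powr_mono2') auto
      also have "(real y ^ 2 / real a) powr - s = real y powr (- 2 * s) * real a powr s"
        proof -
        have "real y powr (- 2 * s) = (real y ^ 2) powr - s"
          using y powr_powr[of "real y" 2 "- s"] by simp
        thus ?thesis using y a by (simp add: powr_divide) (simp add: powr_minus divide_inverse)
      qed
      finally have 1: "\<bar>(\<Sum>b=1..y^2 div a. G b) - dseries g s\<bar> \<le> 2 * B * (real y powr (- 2 * s) * real a powr s)" .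
      have "\<bar>F a\<bar> \<le> 3 * real a powr - s" using f(3)[of a] by (simp add: F_def abs_mult mult_right_mono)
      hence "\<bar>F a * ((\<Sum>b=1..y^2 div a. G b) - dseries g s)\<bar> \<le>
         (3 * real a powr - s) * (2 * B * (real y powr (- 2 * s) * real a powr s))"
        unfolding abs_mult using 1 by (intro mult_mono) auto
      also have "\<dots> = 6 * B * real y powr (- 2 * s)"
        proof -
        have "real a powr - s * real a powr s = 1" using a powr_add[of "real a" "- s" s] by simp
        thus ?thesis by (simp add: algebra_simps)
      qed
      finally show ?thesis .
    qed
    have "(\<Sum>a=1..y. F a * (\<Sum>b=1..y^2 div a. G b)) - (\<Sum>a=1..y. F a) * dseries g s =
      (\<Sum>a=1..y. F a * ((\<Sum>b=1..y^2 div a. G b) - dseries g s))"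
      by (simp add: sum_distrib_right right_diff_distrib sum_subtractf)
    also have "\<bar>\<dots>\<bar> \<le> (\<Sum>a=1..y. 6 * B * real y powr (- 2 * s))"
      by (rule order_trans[OF sum_abs]) (intro sum_mono *)
    also have "\<dots> = 6 * B * real y powr (1 - 2 * s)"
      proof -
      have "real y powr (1 - 2 * s) = real y * real y powr (- 2 * s)"
        using y powr_add[of "real y" 1 "- 2 * s"] by simp
      thus ?thesis by simp
    qed
    also have "\<dots> \<le> 6 * B * real y powr - (2/5)"
      using s g(2) by (intro mult_left_mono yp) auto
    finally show ?thesis .
  qed
  have e2: "\<bar>\<Sum>b=1..y. G b * (\<Sum>a=Suc y..y^2 div b. F a)\<bar> \<le> 4 * A * real y powr - (2/5)"
  proof -
    have *: "\<bar>G b * (\<Sum>a=Suc y..y^2 div b. F a)\<bar> \<le> real b powr - (1/2) * (2 * A * real y powr - s)"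
      if b: "b \<in> {1..y}" for b
    proof -
      have "\<bar>G b\<bar> \<le> 1 * real b powr - s" using g(3)[of b] unfolding G_def abs_mult by (intro mult_mono) auto
      also have "\<dots> \<le> real b powr - (1/2)" using b s by (auto intro!: powr_mono)
      finally have 1: "\<bar>G b\<bar> \<le> real b powr - (1/2)" .
      have "y * b \<le> y ^ 2" using b by (simp add: power2_eq_square)
      hence "y \<le> y^2 div b" using b by (simp add: less_eq_div_iff_mult_less_eq)
      hence "\<bar>\<Sum>a=Suc y..y^2 div b. F a\<bar> \<le> 2 * A * real (Suc y) powr - s"
        using dseries_partial_bound[OF f(1) _ s0] unfolding F_def by blast
      also have "\<dots> \<le> 2 * A * real y powr - s"
        using y f(2) s0 by (intro mult_left_mono powr_mono2') auto
      finally show ?thesis using 1 unfolding abs_mult by (intro mult_mono) auto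
    qed
    have "\<bar>\<Sum>b=1..y. G b * (\<Sum>a=Suc y..y^2 div b. F a)\<bar> \<le> (\<Sum>b=1..y. real b powr - (1/2) * (2 * A * real y powr - s))"
      by (rule order_trans[OF sum_abs]) (intro sum_mono *)
    also have "\<dots> \<le> (2 * sqrt (real y)) * (2 * A * real y powr - s)"
      unfolding sum_distrib_right[symmetric] using f(2) by (intro mult_right_mono sum_inverse_sqrt_le) auto
    also have "\<dots> = 4 * A * real y powr (1/2 - s)"
      proof -
      have "real y powr (1/2 - s) = sqrt (real y) * real y powr - s"
        using powr_add[of "real y" "1/2" "- s"] by (simp add: powr_half_sqrt)
      thus ?thesis by simp
    qed
    also have "\<dots> \<le> 4 * A * real y powr - (2/5)"
      using s f(2) by (intro mult_left_mono yp) auto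
    finally show ?thesis .
  qed
  have e3: "\<bar>(\<Sum>a=1..y. F a) * dseries g s - dseries f s * dseries g s\<bar> \<le> 4 * A * B * real y powr - (2/5)"
  proof -
    have "\<bar>(\<Sum>a=1..y. F a) - dseries f s\<bar> \<le> 2 * A * real (Suc y) powr - s"
      using dseries_tail[OF f(1) s0] unfolding F_def by (simp add: abs_minus_commute)
    also have "\<dots> \<le> 2 * A * real y powr - s"
      using y f(2) s0 by (intro mult_left_mono powr_mono2') auto
    also have "\<dots> \<le> 2 * A * real y powr - (2/5)"
      using s f(2) by (intro mult_left_mono yp) auto
    finally have "\<bar>(\<Sum>a=1..y. F a) - dseries f s\<bar> * \<bar>dseries g s\<bar> \<le> (2 * A * real y powr - (2/5)) * (2 * B)"
      using dseries_bound[OF g(1) s0] f(2) by (intro mult_mono) auto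
    thus ?thesis by (simp add: algebra_simps flip: abs_mult)
  qed
  have 4: "6 * B * real y powr - (2/5) \<le> 6 * A * B * real y powr - (2/5)"
    "4 * A * real y powr - (2/5) \<le> 4 * A * B * real y powr - (2/5)"
    using f(2) g(2) mult_right_mono[of 1 A "B * real y powr - (2/5)"] mult_right_mono[of 1 B "A * real y powr - (2/5)"]
    by (auto simp: mult_ac)
  have "(\<Sum>n=1..y^2. dconv f g n * real n powr - s) =
     (\<Sum>a=1..y. F a * (\<Sum>b=1..y^2 div a. G b)) + (\<Sum>b=1..y. G b * (\<Sum>a=Suc y..y^2 div b. F a))"
    unfolding sum_dconv hyperbola[symmetric] F_def G_def by simp
  thus ?thesis using e1 e2 e3 4 by linarith
qed

section \<open>Sieving and Dirichlet convolution\<close>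

text \<open>Coefficients of p^(-s) times the series of \<open>f\<close>; multiplication by an Euler
  factor becomes subtraction of a multiple of \<open>dilate\<close>.\<close>

definition dilate :: "nat \<Rightarrow> (nat \<Rightarrow> real) \<Rightarrow> nat \<Rightarrow> real"
  where "dilate p f n = (if p dvd n then f (n div p) else 0)"

definition sieve :: "nat set \<Rightarrow> (nat \<Rightarrow> real) \<Rightarrow> nat \<Rightarrow> real"
  where "sieve P f n = (if \<exists>p\<in>P. p dvd n then 0 else f n)"

text \<open>A real Dirichlet character stripped of its modulus, so that the constant 1, the
  quadratic characters and their products are treated alike.\<close>

definition sign_character :: "(nat \<Rightarrow> real) \<Rightarrow> bool"
  where "sign_character f \<longleftrightarrow> f 1 = 1 \<and> (\<forall>m n. f (m * n) = f m * f n) \<and> (\<forall>n. f n \<in> {-1, 0, 1})"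

lemma sign_character_one: "sign_character f \<Longrightarrow> f (Suc 0) = 1"
  by (simp add: sign_character_def)

lemma sign_character_mult: "sign_character f \<Longrightarrow> f (m * n) = f m * f n"
  by (simp add: sign_character_def)

lemma sign_character_power: "sign_character f \<Longrightarrow> f (m ^ n) = f m ^ n"
  by (induction n) (auto simp: sign_character_def)

lemma sign_character_cases: "sign_character f \<Longrightarrow> f n = -1 \<or> f n = 0 \<or> f n = 1"
  by (auto simp: sign_character_def)

lemma sign_character_abs: "sign_character f \<Longrightarrow> \<bar>f n\<bar> \<le> 1"
  using sign_character_cases[of f n] by auto

lemma sum_dilate:
  assumes "p > 0"
  shows "(\<Sum>n=1..N. dilate p u n * w n) = (\<Sum>m=1..N div p. u m * w (p * m))"
proof -
  have "(\<Sum>n=1..N. dilate p u n * w n) = (\<Sum>n\<in>{n\<in>{1..N}. p dvd n}. u (n div p) * w n)"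
    by (rule sum.mono_neutral_cong_right) (auto simp: dilate_def)
  also have "\<dots> = (\<Sum>m=1..N div p. u m * w (p * m))"
    by (rule sum.reindex_bij_witness[of _ "\<lambda>m. p * m" "\<lambda>n. n div p"])
       (use assms in \<open>auto elim!: dvdE simp: less_eq_div_iff_mult_less_eq mult.commute\<close>)
  finally show ?thesis .
qed

text \<open>A sum of the dilated function is a sum of the function itself up to
  \<open>n div p\<close>, so an Euler factor at most doubles the bound.\<close>

lemma bounded_sums_diff_dilate:
  assumes "bounded_sums f A" "p > 0" "\<bar>a\<bar> \<le> 1"
  shows "bounded_sums (\<lambda>n. f n - a * dilate p f n) (2 * A)"
  unfolding bounded_sums_def
proof
  fix n
  have "(\<Sum>k=1..n. f k - a * dilate p f k) = (\<Sum>k=1..n. f k) - a * (\<Sum>k=1..n. dilate p f k * 1)"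
    by (simp add: sum_subtractf sum_distrib_left)
  also have "(\<Sum>k=1..n. dilate p f k * 1) = (\<Sum>k=1..n div p. f k)"
    unfolding sum_dilate[OF assms(2)] by simp
  also have "\<bar>(\<Sum>k=1..n. f k) - a * \<dots>\<bar> \<le> \<bar>\<Sum>k=1..n. f k\<bar> + \<bar>a\<bar> * \<bar>\<Sum>k=1..n div p. f k\<bar>"
    unfolding abs_mult[symmetric] by (rule abs_triangle_ineq4)
  also have "\<dots> \<le> A + 1 * A"
    using assms bounded_sums_nonneg[OF assms(1)] unfolding bounded_sums_def by (intro add_mono mult_mono) auto
  finally show "\<bar>\<Sum>k=1..n. f k - a * dilate p f k\<bar> \<le> 2 * A" by simp
qed

lemma dseries_diff_dilate:
  assumes "bounded_sums f A" "p > 0" "s > 0"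
  shows "dseries (\<lambda>n. f n - a * dilate p f n) s = (1 - a * real p powr - s) * dseries f s"
proof -
  have f: "(\<lambda>n. f n * real n powr - s) sums dseries f s"
    using dseries_summable[OF assms(1,3)] unfolding dseries_def by (rule summable_sums)
  hence "(\<lambda>n. real p powr - s * (f n * real n powr - s)) sums (real p powr - s * dseries f s)"
    by (rule sums_mult)
  also have "(\<lambda>n. real p powr - s * (f n * real n powr - s)) =
      (\<lambda>n. dilate p f (p * n) * real (p * n) powr - s)"
    using assms(2) by (auto simp: dilate_def powr_mult)
  \<comment> \<open>The dilated coefficients live on the multiples of \<open>p\<close>; inserting
    zeros in between does not change the sum.\<close>
  finally have "(\<lambda>n. dilate p f n * real n powr - s) sums (real p powr - s * dseries f s)"
    by (subst (asm) sums_mono_reindex)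
       (use assms(2) in \<open>auto simp: strict_mono_def dilate_def elim!: dvdE\<close>)
  from sums_diff[OF f sums_mult[OF this, of a]]
  have "(\<lambda>n. (f n - a * dilate p f n) * real n powr - s) sums (dseries f s - a * (real p powr - s * dseries f s))"
    by (simp add: algebra_simps)
  thus ?thesis unfolding dseries_def by (subst sums_unique[symmetric]) (auto simp: algebra_simps)
qed

lemma dilate_dilate_commute: "dilate p (dilate q f) = dilate q (dilate p f)"
proof (cases "p = 0 \<or> q = 0")
  case True thus ?thesis by (auto simp: dilate_def fun_eq_iff)
next
  case False
  have "dilate p (dilate q f) n = (if p * q dvd n then f (n div (p * q)) else 0)" if "p > 0" "q > 0" for p q n
    using that by (auto simp: dilate_def div_mult2_eq dvd_div_iff_mult mult.commute dest: dvd_mult_left)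
  thus ?thesis using False by (auto simp: fun_eq_iff mult.commute)
qed

lemma sieve_insert:
  assumes "sign_character f" "prime p" "p \<notin> P" "\<And>q. q \<in> P \<Longrightarrow> prime q"
  shows "sieve (insert p P) f n = sieve P f n - f p * dilate p (sieve P f) n"
proof (cases "p dvd n")
  case True
  then obtain m where m: "n = p * m" by blast
  have "(\<exists>q\<in>P. q dvd n) \<longleftrightarrow> (\<exists>q\<in>P. q dvd m)"
    using assms m by (metis dvd_mult prime_dvd_mult_iff primes_dvd_imp_eq)
  thus ?thesis using m prime_gt_0_nat[OF assms(2)] assms(1)
    by (auto simp: sieve_def dilate_def sign_character_mult)
qed (auto simp: sieve_def dilate_def)

text \<open>The constant function 1 has unbounded sums, so the factor 1 - c 2^(-s) must stay
  attached while primes are sieved out. Dilations commute, hence each further prime multiplies the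
  combined series by its Euler factor and doubles the bound.\<close>

lemma sieve_dseries:
  assumes ch: "sign_character f" and "finite P" "\<And>q. q \<in> P \<Longrightarrow> prime q"
    and bd: "bounded_sums (\<lambda>n. f n - c * dilate 2 f n) A" and "s > 0"
  shows "bounded_sums (\<lambda>n. sieve P f n - c * dilate 2 (sieve P f) n) (2 ^ card P * A) \<and>
    dseries (\<lambda>n. sieve P f n - c * dilate 2 (sieve P f) n) s =
    (\<Prod>p\<in>P. 1 - f p * real p powr - s) * dseries (\<lambda>n. f n - c * dilate 2 f n) s"
  using assms(2,3)
proof (induction P rule: finite_induct)
  case empty
  have "sieve {} f = f" by (auto simp: sieve_def)
  thus ?case using bd by simp
next
  case (insert p P)
  define h where "h n = sieve P f n - c * dilate 2 (sieve P f) n" for n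
  have p: "prime p" "p > 0" using insert prime_gt_0_nat by auto
  have ins: "sieve (insert p P) f = (\<lambda>n. sieve P f n - f p * dilate p (sieve P f) n)"
    using sieve_insert[OF ch p(1)] insert by auto
  have lin: "dilate q (\<lambda>n. u n - a * v n) = (\<lambda>n. dilate q u n - a * dilate q v n)" for q u v a
    by (auto simp: dilate_def)
  have eq: "(\<lambda>n. sieve (insert p P) f n - c * dilate 2 (sieve (insert p P) f) n) =
      (\<lambda>n. h n - f p * dilate p h n)"
    unfolding ins h_def lin by (subst dilate_dilate_commute) (simp add: algebra_simps)
  have IH: "bounded_sums h (2 ^ card P * A)"
    "dseries h s = (\<Prod>p\<in>P. 1 - f p * real p powr - s) * dseries (\<lambda>n. f n - c * dilate 2 f n) s"
    using insert unfolding h_def by auto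
  show ?case unfolding eq
    using bounded_sums_diff_dilate[OF IH(1) p(2) sign_character_abs[OF ch]]
      dseries_diff_dilate[OF IH(1) p(2) assms(5)] IH(2) insert
    by (simp add: algebra_simps)
qed

text \<open>Number of ideals of norm \<open>n\<close>, for \<open>n\<close> prime to the conductor, when \<open>x\<close> is the
  character of a quadratic field.\<close>

definition ideal_count :: "nat set \<Rightarrow> (nat \<Rightarrow> real) \<Rightarrow> nat \<Rightarrow> real"
  where "ideal_count P x = dconv (sieve P (\<lambda>_. 1)) x"

text \<open>A completely multiplicative twist passes through the convolution, so the twisted ideal
  count is again a convolution to which the product approximation applies.\<close>

lemma dconv_sieve:
  assumes "sign_character f" "n > 0"
  shows "dconv (sieve P f) (\<lambda>n. f n * x n) n = f n * ideal_count P x n"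
  unfolding dconv_def ideal_count_def sum_distrib_left
proof (rule sum.cong)
  fix b assume "b \<in> {b. b dvd n}"
  hence "n = n div b * b" by simp
  hence "f n = f (n div b) * f b" using sign_character_mult[OF assms(1)] by metis
  thus "sieve P f (n div b) * (f b * x b) = f n * (sieve P (\<lambda>_. 1) (n div b) * x b)"
    by (auto simp: sieve_def)
qed simp

text \<open>Dilating one factor dilates the whole convolution. In this way 1 - c 2^(-s) turns into a
  comparison of the sum over norms up to N with the one up to N / 2.\<close>

lemma dconv_diff_dilate:
  assumes "n > 0"
  shows "dconv (\<lambda>n. h n - c * dilate 2 h n) g n = dconv h g n - c * dilate 2 (dconv h g) n"
proof -
  have "dconv (dilate 2 h) g n = dilate 2 (dconv h g) n"
  proof (cases "even n")
    case True
    have "dconv (dilate 2 h) g n = (\<Sum>b | b dvd n div 2. h (n div 2 div b) * g b)"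
      unfolding dconv_def
    proof (rule sum.mono_neutral_cong_right)
      show "finite {b. b dvd n}" using assms by (simp add: finite_divisors_nat)
      show "{b. b dvd n div 2} \<subseteq> {b. b dvd n}" using True by (auto elim!: evenE)
      show "\<forall>i\<in>{b. b dvd n} - {b. b dvd n div 2}. dilate 2 h (n div i) * g i = 0"
        using assms True by (auto simp: dilate_def elim!: dvdE)
      show "dilate 2 h (n div x) * g x = h (n div 2 div x) * g x" if "x \<in> {b. b dvd n div 2}" for x
        using that True assms by (auto simp: dilate_def elim!: dvdE)
    qed
    thus ?thesis using True by (simp add: dilate_def dconv_def)
  next
    case False
    hence "odd (n div b)" if "b dvd n" for b using that by (metis div_dvd_iff_mult dvd_div_mult_self dvd_mult2)
    thus ?thesis using False by (auto simp: dilate_def dconv_def intro!: sum.neutral)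
  qed
  moreover have "dconv (\<lambda>n. h n - c * dilate 2 h n) g n = dconv h g n - c * dconv (dilate 2 h) g n"
    by (simp add: dconv_def sum_subtractf sum_distrib_left algebra_simps)
  ultimately show ?thesis by simp
qed

text \<open>A divisor of p^e m is uniquely p^i c with c dividing m. Constant \<open>h\<close> yields
  the divisor count, a character yields the ideal count.\<close>

lemma sum_over_divisors_prime_power_mult:
  fixes h :: "nat \<Rightarrow> real"
  assumes mult: "\<And>m n. h (m * n) = h m * h n" and one: "h 1 = 1" and p: "prime p" "\<not> p dvd m" "m > 0"
  shows "(\<Sum>b | b dvd p ^ e * m. h b) = (\<Sum>i\<le>e. h p ^ i) * (\<Sum>b | b dvd m. h b)"
proof -
  have pw: "h (p ^ i) = h p ^ i" for i using one by (induction i) (auto simp: mult)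
  have p0: "p > 0" using p prime_gt_0_nat by auto
  have inj: "inj_on (\<lambda>(i,c). p ^ i * c) ({..e} \<times> {c. c dvd m})"
  proof (rule inj_onI, clarsimp)
    fix i c j c' assume *: "i \<le> e" "c dvd m" "j \<le> e" "c' dvd m" "p ^ i * c = p ^ j * c'"
    have nz: "c \<noteq> 0" "c' \<noteq> 0" using * p by auto
    have mu: "multiplicity p (p ^ i * c) = i" if "c dvd m" "c \<noteq> 0" for i c
    proof -
      have "\<not> p dvd c" using that p dvd_trans by blast
      thus ?thesis using that p p0 by (simp add: prime_elem_multiplicity_mult_distrib not_dvd_imp_multiplicity_0)
    qed
    have "i = j" using mu[of c i] mu[of c' j] * nz by simp
    thus "i = j \<and> c = c'" using * p0 by simp
  qed
  have im: "(\<lambda>(i,c). p ^ i * c) ` ({..e} \<times> {c. c dvd m}) = {b. b dvd p ^ e * m}"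
  proof (intro equalityI subsetI)
    fix b assume "b \<in> {b. b dvd p ^ e * m}"
    then obtain x c where xc: "b = x * c" "x dvd p ^ e" "c dvd m" using division_decomp by blast
    then obtain i where "i \<le> e" "x = p ^ i" using p by (auto simp: divides_primepow_nat)
    thus "b \<in> (\<lambda>(i,c). p ^ i * c) ` ({..e} \<times> {c. c dvd m})" using xc by force
  qed (auto intro!: mult_dvd_mono le_imp_power_dvd)
  have "(\<Sum>b | b dvd p ^ e * m. h b) = (\<Sum>(i,c)\<in>{..e} \<times> {c. c dvd m}. h (p ^ i * c))"
    unfolding im[symmetric] by (subst sum.reindex[OF inj]) (simp add: case_prod_unfold o_def)
  also have "\<dots> = (\<Sum>i\<le>e. \<Sum>c | c dvd m. h p ^ i * h c)"
    by (simp add: sum.cartesian_product mult pw)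
  also have "\<dots> = (\<Sum>i\<le>e. h p ^ i) * (\<Sum>b | b dvd m. h b)"
    by (simp add: sum_product)
  finally show ?thesis .
qed

section \<open>Divisor sums\<close>

text \<open>The induction step for the divisor bound and for character sums over divisors: the full
  power of one prime is split off.\<close>

lemma prime_power_factor_nat:
  fixes n :: nat assumes "n > 1"
  obtains p e m where "prime p" "e \<ge> 1" "\<not> p dvd m" "n = p ^ e * m" "m > 0" "m < n"
proof -
  obtain p where p: "prime p" "p dvd n" using assms prime_factor_nat by (metis less_numeral_extra(4))
  obtain m where m: "n = p ^ multiplicity p n * m" "\<not> p dvd m"
    using multiplicity_decompose'[of n p] p assms not_prime_unit by (metis less_nat_zero_code)
  have e: "multiplicity p n \<ge> 1" using p assms
    using multiplicity_eq_zero_iff[of n p] prime_gt_1_nat[OF p(1)] by (simp add: Suc_le_eq)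
  have "m > 0" using m assms by (cases m) auto
  moreover have "m < p ^ multiplicity p n * m"
    using \<open>m > 0\<close> one_less_power[OF prime_gt_1_nat[OF p(1)], of "multiplicity p n"] e by auto
  hence "m < n" using m by simp
  ultimately show ?thesis using that p(1) e m by blast
qed

lemma card_divisors_prime_power_mult:
  fixes p m :: nat
  assumes "prime p" "\<not> p dvd m" "m > 0"
  shows "real (card {b. b dvd p ^ e * m}) = real (Suc e) * real (card {b. b dvd m})"
  using sum_over_divisors_prime_power_mult[of "\<lambda>_. 1" p m e] assms by simp

text \<open>A prime power p^e contributes e + 1 to the count, against (p^\<epsilon>)^e. From
  2^(1/\<epsilon>) on, p^\<epsilon> is at least 2 and wins without a constant; each smaller prime
  costs one factor \<open>C0\<close>, and there are at most \<open>N0\<close> of those.\<close>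

lemma divisor_bound:
  fixes \<epsilon> :: real assumes "\<epsilon> > 0"
  obtains C where "C \<ge> 1" "\<And>n. n \<ge> 1 \<Longrightarrow> real (card {b. b dvd n}) \<le> C * real n powr \<epsilon>"
proof -
  \<comment> \<open>The second summand times \<epsilon> e ln 2 is exactly e, so \<open>C0\<close>
    times the linear lower bound 1 + \<epsilon> e ln 2 for (p^\<epsilon>)^e exceeds 1 + e.\<close>
  define C0 where "C0 = 1 + 1 / (\<epsilon> * ln 2)"
  define N0 where "N0 = nat \<lceil>2 powr (1/\<epsilon>)\<rceil>"
  have C0: "C0 \<ge> 1" using assms by (simp add: C0_def)
  have small: "real (Suc e) \<le> C0 * (real p powr \<epsilon>) ^ e" if "p \<ge> 2" for e p
  proof -
    have "(real p powr \<epsilon>) ^ e = exp (\<epsilon> * real e * ln (real p))"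
      using that by (simp add: powr_def exp_of_nat_mult[symmetric] algebra_simps)
    also have "\<dots> \<ge> 1 + \<epsilon> * real e * ln (real p)" by (rule exp_ge_add_one_self)
    finally have "1 + \<epsilon> * real e * ln (real p) \<le> (real p powr \<epsilon>) ^ e" .
    moreover have "\<epsilon> * real e * ln 2 \<le> \<epsilon> * real e * ln (real p)"
      using that assms by (intro mult_left_mono) auto
    ultimately have "1 + \<epsilon> * real e * ln 2 \<le> (real p powr \<epsilon>) ^ e" by linarith
    hence "C0 * (1 + \<epsilon> * real e * ln 2) \<le> C0 * (real p powr \<epsilon>) ^ e" using C0 by simp
    moreover have "C0 * (1 + \<epsilon> * real e * ln 2) = 1 + 1 / (\<epsilon> * ln 2) + \<epsilon> * real e * ln 2 + real e"
      using assms by (simp add: C0_def field_simps)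
    moreover have "0 \<le> 1 / (\<epsilon> * ln 2) + \<epsilon> * real e * ln 2" using assms by simp
    ultimately show ?thesis by simp
  qed
  have large: "real (Suc e) \<le> (real p powr \<epsilon>) ^ e" if "p \<ge> N0" for e p
  proof -
    have "2 powr (1/\<epsilon>) \<le> real p" using that unfolding N0_def by linarith
    hence "(2 powr (1/\<epsilon>)) powr \<epsilon> \<le> real p powr \<epsilon>" using assms by (intro powr_mono2) auto
    hence "2 \<le> real p powr \<epsilon>" using assms by (simp add: powr_powr)
    hence "2 ^ e \<le> (real p powr \<epsilon>) ^ e" by (intro power_mono) auto
    moreover have "real (Suc e) \<le> 2 ^ e"
      by (induction e) auto
    ultimately show ?thesis by linarith
  qed
  define S where "S n = {p. prime p \<and> p dvd n \<and> p < N0}" for n :: nat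
  have finS: "finite (S n)" for n by (rule finite_subset[of _ "{..<N0}"]) (auto simp: S_def)
  have main: "real (card {b. b dvd n}) \<le> C0 ^ card (S n) * real n powr \<epsilon>" if "n \<ge> 1" for n
    using that
  proof (induction n rule: less_induct)
    case (less n)
    show ?case
    proof (cases "n = 1")
      case True
      have "S 1 = {}" by (auto simp: S_def)
      thus ?thesis using True by simp
    next
      case False
      hence "n > 1" using less.prems(1) by simp
      then obtain p e m where pem: "prime p" "e \<ge> 1" "\<not> p dvd m" "n = p ^ e * m" "m > 0" "m < n"
        by (rule prime_power_factor_nat)
      have p2: "p \<ge> 2" using pem prime_ge_2_nat by auto
      have "q dvd n \<longleftrightarrow> q = p \<or> q dvd m" if "prime q" for q
      proof
        assume "q dvd n"
        hence "q dvd p ^ e \<or> q dvd m" using that pem by (simp add: prime_dvd_mult_iff)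
        thus "q = p \<or> q dvd m"
          using that pem(1) prime_dvd_power[of q p e] primes_dvd_imp_eq[of q p] by blast
      next
        have "p dvd p ^ e" using pem by (intro dvd_power) auto
        thus "q = p \<or> q dvd m \<Longrightarrow> q dvd n" using pem by auto
      qed
      hence Sn: "S n = S m \<union> (if p < N0 then {p} else {})"
        using pem(1) by (auto simp: S_def)
      have pS: "p \<notin> S m" using pem by (auto simp: S_def)
      have np: "real n powr \<epsilon> = (real p powr \<epsilon>) ^ e * real m powr \<epsilon>"
      proof -
        have "real n powr \<epsilon> = (real p ^ e) powr \<epsilon> * real m powr \<epsilon>"
          unfolding pem(4) of_nat_mult of_nat_power by (rule powr_mult)
        also have "(real p ^ e) powr \<epsilon> = (real p powr \<epsilon>) ^ e"
          using p2 by (simp add: powr_powr mult.commute flip: powr_realpow)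
        finally show ?thesis .
      qed
      have IH: "real (card {b. b dvd m}) \<le> C0 ^ card (S m) * real m powr \<epsilon>"
        using less.IH[of m] pem by simp
      have "real (Suc e) * real (card {b. b dvd m}) \<le> (C0 ^ (if p < N0 then 1 else 0) * (real p powr \<epsilon>) ^ e) * (C0 ^ card (S m) * real m powr \<epsilon>)"
        using small[OF p2, of e] large[of p e] C0 IH by (intro mult_mono) auto
      also have "\<dots> = C0 ^ card (S n) * real n powr \<epsilon>"
        unfolding Sn np using pS finS[of m] by (simp add: algebra_simps)
      finally show ?thesis unfolding pem(4) card_divisors_prime_power_mult[OF pem(1,3,5)] .
    qed
  qed
  have "card (S n) \<le> N0" for n
    using card_mono[of "{..<N0}" "S n"] by (auto simp: S_def)
  hence "C0 ^ card (S n) \<le> C0 ^ N0" for n using C0 by (intro power_increasing) auto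
  hence "real (card {b. b dvd n}) \<le> C0 ^ N0 * real n powr \<epsilon>" if "n \<ge> 1" for n
    using main[OF that] by (meson mult_right_mono order_trans powr_ge_zero)
  thus ?thesis using that[of "C0 ^ N0"] C0 by auto
qed

section \<open>Primes dividing the modulus and character sums over divisors\<close>

definition prime_divs :: "nat \<Rightarrow> nat set"
  where "prime_divs m = {p. prime p \<and> p dvd m}"

lemma finite_prime_divs: "m > 0 \<Longrightarrow> finite (prime_divs m)"
  by (rule finite_subset[of _ "{..m}"]) (auto simp: prime_divs_def dvd_imp_le)

lemma prod_coprime_dvd:
  fixes f :: "'b \<Rightarrow> nat"
  assumes "finite A" "\<And>p. p \<in> A \<Longrightarrow> f p dvd m" "\<And>p q. p \<in> A \<Longrightarrow> q \<in> A \<Longrightarrow> p \<noteq> q \<Longrightarrow> coprime (f p) (f q)"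
  shows "(\<Prod>p\<in>A. f p) dvd m"
  using assms
proof (induction A rule: finite_induct)
  case (insert p A)
  have "coprime (f p) (\<Prod>p\<in>A. f p)" using insert by (intro prod_coprime_right) auto
  thus ?case using insert by (simp add: divides_mult)
qed simp

text \<open>The product of the distinct primes divides \<open>m\<close> and each is at least 2. Thus
  the doubling per sieved prime costs no more than a factor linear in the modulus.\<close>

lemma two_power_card_prime_divs_le:
  assumes "m > 0" shows "2 ^ card (prime_divs m) \<le> m"
proof -
  have "(\<Prod>p\<in>prime_divs m. 2::nat) \<le> (\<Prod>p\<in>prime_divs m. p)"
    by (intro prod_mono) (auto simp: prime_divs_def prime_ge_2_nat)
  also have "\<dots> dvd m"
    by (rule prod_coprime_dvd) (use assms finite_prime_divs in \<open>auto simp: prime_divs_def primes_coprime\<close>)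
  hence "(\<Prod>p\<in>prime_divs m. p) \<le> m" using assms by (rule dvd_imp_le)
  finally show ?thesis by simp
qed

lemma sieve_prime_divs: "n > 0 \<Longrightarrow> sieve (prime_divs m) f n = (if coprime n m then f n else 0)"
proof -
  assume "n > 0"
  have "(\<exists>p\<in>prime_divs m. p dvd n) \<longleftrightarrow> \<not> coprime n m"
  proof
    assume "\<exists>p\<in>prime_divs m. p dvd n"
    then obtain p where "prime p" "p dvd m" "p dvd n" by (auto simp: prime_divs_def)
    thus "\<not> coprime n m" using not_coprimeI[of p n m] prime_gt_1_nat[of p] by auto
  next
    assume "\<not> coprime n m"
    hence "gcd n m \<noteq> 1" by (simp only: coprime_iff_gcd_eq_1 not_False_eq_True)
    then obtain p where "prime p" "p dvd gcd n m" using prime_factor_nat by blast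
    thus "\<exists>p\<in>prime_divs m. p dvd n" by (auto simp: prime_divs_def)
  qed
  thus ?thesis by (simp add: sieve_def)
qed

lemma ideal_count_coprime:
  assumes "coprime n m" "n > 0"
  shows "ideal_count (prime_divs m) x n = (\<Sum>b | b dvd n. x b)"
  unfolding ideal_count_def dconv_def
proof (rule sum.cong)
  fix b assume b: "b \<in> {b. b dvd n}"
  have "n div b dvd n" using b by (metis dvd_div_mult_self dvd_triv_left mem_Collect_eq)
  hence "coprime (n div b) m" "n div b > 0"
    using assms by (metis coprime_divisors dvd_refl, metis dvd_pos_nat)
  thus "sieve (prime_divs m) (\<lambda>_. 1) (n div b) * x b = x b" by (simp add: sieve_prime_divs)
qed simp

text \<open>Of two complementary divisors one shares a factor with \<open>m\<close>: if it is
  \<open>b\<close>, then \<open>x\<close> vanishes there, otherwise the sieve removes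
  \<open>n div b\<close>.\<close>

lemma ideal_count_not_coprime:
  assumes "\<not> coprime n m" "n > 0" "\<And>b. \<not> coprime b m \<Longrightarrow> x b = 0"
  shows "ideal_count (prime_divs m) x n = 0"
  unfolding ideal_count_def dconv_def
proof (rule sum.neutral, clarify)
  fix b assume b: "b dvd n"
  hence n: "n = n div b * b" "n div b > 0" using assms by (auto elim!: dvdE)
  show "sieve (prime_divs m) (\<lambda>_. 1) (n div b) * x b = 0"
  proof (cases "coprime b m")
    case True
    hence "\<not> coprime (n div b) m" using n(1) assms(1) by (metis coprime_mult_left_iff)
    thus ?thesis using n by (simp add: sieve_prime_divs)
  qed (use assms in auto)
qed

lemma abs_sum_divisors_le:
  assumes "sign_character x" "n > 0"
  shows "\<bar>\<Sum>b | b dvd n. x b\<bar> \<le> real (card {b. b dvd n})"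
proof -
  have "\<bar>\<Sum>b | b dvd n. x b\<bar> \<le> (\<Sum>b | b dvd n. \<bar>x b\<bar>)" by (rule sum_abs)
  also have "\<dots> \<le> (\<Sum>b | b dvd n. 1)" using sign_character_abs[OF assms(1)] by (intro sum_mono)
  finally show ?thesis by simp
qed

text \<open>The divisor sum counts ideals of norm \<open>n\<close> in the quadratic field with
  character \<open>x\<close>. An inert prime, with \<open>x p = -1\<close>, gives the factor 0 for
  an odd exponent and 1 for an even one, and in the latter case goes into \<open>k\<close>. The
  split primes are collected in \<open>n1\<close>.\<close>

lemma sum_divisors_cases:
  assumes ch: "sign_character x" and "n > 0" "\<And>p. prime p \<Longrightarrow> p dvd n \<Longrightarrow> x p \<noteq> 0"
  shows "(\<Sum>b | b dvd n. x b) = 0 \<or>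
    (\<exists>n1 k. n = n1 * k^2 \<and> (\<forall>p. prime p \<longrightarrow> p dvd n1 \<longrightarrow> x p = 1) \<and> (n1 = 1 \<longrightarrow> (\<Sum>b | b dvd n. x b) = 1))"
  using assms(2,3)
proof (induction n rule: less_induct)
  case (less n)
  show ?case
  proof (cases "n = 1")
    case True
    have "{b. b dvd Suc 0} = {1}" by auto
    hence "(\<Sum>b | b dvd n. x b) = 1" using True sign_character_one[OF ch] by simp
    moreover have "n = 1 * 1^2" "\<forall>p. prime p \<longrightarrow> p dvd (1::nat) \<longrightarrow> x p = 1" using True by auto
    ultimately show ?thesis by blast
  next
    case False
    hence "n > 1" using less.prems(1) by simp
    then obtain p e m where pem: "prime p" "e \<ge> 1" "\<not> p dvd m" "n = p ^ e * m" "m > 0" "m < n"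
      by (rule prime_power_factor_nat)
    have R: "(\<Sum>b | b dvd n. x b) = (\<Sum>i\<le>e. x p ^ i) * (\<Sum>b | b dvd m. x b)"
      unfolding pem(4) using sign_character_mult[OF ch] sign_character_one[OF ch]
      by (intro sum_over_divisors_prime_power_mult pem) (simp_all only: One_nat_def)
    have "x p \<noteq> 0" using less.prems(2)[of p] pem(1,2,4) by auto
    then consider "x p = 1" | "x p = -1" using sign_character_cases[OF ch, of p] by auto
    note xp = this
    have "(\<Sum>b | b dvd m. x b) = 0 \<or> (\<exists>n1 k. m = n1 * k^2 \<and>
      (\<forall>p. prime p \<longrightarrow> p dvd n1 \<longrightarrow> x p = 1) \<and> (n1 = 1 \<longrightarrow> (\<Sum>b | b dvd m. x b) = 1))"
    proof (rule less.IH[OF pem(6,5)])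
      fix q assume "prime q" "q dvd m"
      moreover from this have "q dvd n" unfolding pem(4) by (intro dvd_mult)
      ultimately show "x q \<noteq> 0" using less.prems(2) by blast
    qed
    thus ?thesis
    proof (elim disjE exE conjE)
      assume "(\<Sum>b | b dvd m. x b) = 0" thus ?thesis using R by simp
    next
      fix n1 k assume IH: "m = n1 * k^2" "\<forall>p. prime p \<longrightarrow> p dvd n1 \<longrightarrow> x p = 1" "n1 = 1 \<longrightarrow> (\<Sum>b | b dvd m. x b) = 1"
      show ?thesis using xp
      proof cases
        case 1
        have "x q = 1" if "prime q" "q dvd p ^ e * n1" for q
        proof -
          have "q dvd p ^ e \<or> q dvd n1" using that by (simp add: prime_dvd_mult_iff)
          thus ?thesis
            using that IH(2) 1 pem(1) prime_dvd_power[of q p e] primes_dvd_imp_eq[of q p] by auto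
        qed
        moreover have "p ^ e * n1 \<noteq> 1"
          using pem(1,2) one_less_power[OF prime_gt_1_nat[OF pem(1)], of e] by (intro notI) simp
        moreover have "n = (p ^ e * n1) * k^2" unfolding pem(4) IH(1) by simp
        ultimately show ?thesis by blast
      next
        case 2
        have alt: "(\<Sum>i\<le>e. (-1::real) ^ i) = (if even e then 1 else 0)" by (induction e) auto
        show ?thesis
        proof (cases "even e")
          case True
          then obtain j where j: "e = 2 * j" by blast
          have "n = n1 * (p ^ j * k)^2" unfolding pem(4) IH(1) j
            by (simp add: power_mult_distrib power_even_eq)
          moreover have "(\<Sum>b | b dvd n. x b) = (\<Sum>b | b dvd m. x b)" using R 2 alt True by simp
          ultimately have "n = n1 * (p ^ j * k)^2 \<and> (\<forall>p. prime p \<longrightarrow> p dvd n1 \<longrightarrow> x p = 1) \<and>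
              (n1 = 1 \<longrightarrow> (\<Sum>b | b dvd n. x b) = 1)" using IH(2,3) by metis
          thus ?thesis by (intro disjI2 exI)
        next
          case False
          thus ?thesis using R 2 alt by simp
        qed
      qed
    qed
  qed
qed

text \<open>One prime is added at a time: by the Chinese remainder theorem if it is new, by Hensel
  lifting if it already divides the modulus. Lifting inverts 2 b modulo p, hence the exclusion of
  primes dividing \<open>2 * d\<close>.\<close>

lemma square_root_mod_exists:
  fixes d :: int and n :: nat
  assumes "n > 0" "\<And>p. prime p \<Longrightarrow> p dvd n \<Longrightarrow> \<not> int p dvd 2 * d \<and> (\<exists>b. int p dvd b^2 + d)"
  shows "\<exists>b. int n dvd b^2 + d"
  using assms
proof (induction n rule: less_induct)
  case (less n)
  show ?case
  proof (cases "n = 1")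
    case True thus ?thesis by simp
  next
    case False
    then obtain p where p: "prime p" "p dvd n" using prime_factor_nat by blast
    then obtain m where m: "n = p * m" by blast
    have m0: "m > 0" "m < n" using m less.prems(1) prime_gt_1_nat[OF p(1)] by (auto intro!: gr0I)
    have "\<exists>b. int m dvd b^2 + d"
    proof (rule less.IH[OF m0(2,1)])
      fix q assume "prime q" "q dvd m"
      thus "\<not> int q dvd 2 * d \<and> (\<exists>b. int q dvd b^2 + d)"
        using less.prems(2)[of q] m by simp
    qed
    then obtain b where b: "int m dvd b^2 + d" by blast
    obtain a where a: "int p dvd a^2 + d" "\<not> int p dvd 2 * d" using less.prems(2)[OF p] by blast
    have pp: "prime (int p)" using p by simp
    show ?thesis
    proof (cases "p dvd m")
      case True
      obtain c where c: "b^2 + d = int m * c" using b by blast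
      have "\<not> int p dvd 2 * b"
      proof
        assume *: "int p dvd 2 * b"
        have "\<not> int p dvd 2" using a(2) dvd_mult2 by blast
        hence "int p dvd b" using * prime_dvd_multD[OF pp *] by blast
        moreover have "int p dvd b^2 + d" using dvd_trans[OF _ b, of "int p"] True by simp
        ultimately have "int p dvd d"
          by (simp add: power2_eq_square dvd_add_right_iff)
        thus False using a(2) dvd_mult by blast
      qed
      hence "coprime (2 * b) (int p)" using prime_imp_coprime[OF pp] coprime_commute by blast
      then obtain z where z: "[2 * b * z = 1] (mod int p)" using cong_solve_coprime_int[of "2 * b" "int p"] by auto
      \<comment> \<open>Since p divides m, the quotient ((b + t m)^2 + d) / m is c + 2 b t modulo p;
        this \<open>t\<close> is its root, \<open>z\<close> being inverse to 2 b.\<close>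
      define t where "t = - c * z"
      have "int p dvd 2 * b * z - 1" using z by (simp only: cong_iff_dvd_diff)
      hence "int p dvd (2 * b * z - 1) * (- c)" by (rule dvd_mult2)
      also have "(2 * b * z - 1) * (- c) = c + 2 * b * t" by (simp add: t_def algebra_simps)
      finally have "int p dvd c + 2 * b * t" .
      moreover have "int p dvd t^2 * int m" using True by (intro dvd_mult) simp
      ultimately have "int p dvd c + 2 * b * t + t^2 * int m" by (rule dvd_add)
      moreover have "(b + t * int m)^2 + d = int m * (c + 2 * b * t + t^2 * int m)"
        using c by (simp add: power2_eq_square algebra_simps)
      ultimately have "int m * int p dvd (b + t * int m)^2 + d"
        by (simp only: mult_dvd_mono dvd_refl)
      thus ?thesis using m by (metis mult.commute of_nat_mult)
    next
      case False
      have cop: "coprime (int p) (int m)" using False p by (simp add: prime_imp_coprime)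
      then obtain y where y: "[y = a] (mod int p)" "[y = b] (mod int m)"
        using binary_chinese_remainder_int[OF cop] by blast
      have "[y^2 + d = a^2 + d] (mod int p)" "[y^2 + d = b^2 + d] (mod int m)"
        by (intro cong_add cong_pow cong_refl y)+
      hence "int p dvd y^2 + d" "int m dvd y^2 + d" using a(1) b cong_dvd_iff by blast+
      hence "int p * int m dvd y^2 + d" using cop by (rule divides_mult)
      thus ?thesis using m by (metis of_nat_mult)
    qed
  qed
qed

section \<open>Quadratic characters\<close>

lemma Legendre_cases: "Legendre a p = -1 \<or> Legendre a p = 0 \<or> Legendre a p = 1"
  by (simp add: Legendre_def)

lemma Legendre_eq_0_iff: "Legendre a p = 0 \<longleftrightarrow> p dvd a"
  by (simp add: Legendre_def cong_0_iff)

lemma Legendre_cong: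
  assumes "[a = b] (mod p)" shows "Legendre a p = Legendre b p"
proof -
  have "[a = 0] (mod p) \<longleftrightarrow> [b = 0] (mod p)"
    using assms cong_trans cong_sym by metis
  moreover have "[y^2 = a] (mod p) \<longleftrightarrow> [y^2 = b] (mod p)" for y
    using assms cong_trans cong_sym by metis
  hence "QuadRes p a \<longleftrightarrow> QuadRes p b" by (simp add: QuadRes_def)
  ultimately show ?thesis by (simp add: Legendre_def)
qed

text \<open>Euler's criterion is only a congruence; for p > 2 the values -1, 0, 1 are distinct
  modulo p, so congruences between Legendre symbols become equalities.\<close>

lemma sign_eq_if_cong:
  fixes a b :: int and p :: nat
  assumes "[a = b] (mod int p)" "p > 2" "a \<in> {-1,0,1}" "b \<in> {-1,0,1}"
  shows "a = b"
proof -
  have "int p dvd a - b" using assms(1) by (simp only: cong_iff_dvd_diff)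
  moreover have "\<bar>a - b\<bar> < int p" using assms(2-4) by auto
  ultimately have "a - b = 0" using dvd_imp_le_int[of "a - b" "int p"] by linarith
  thus ?thesis by simp
qed

lemma Legendre_mult:
  assumes "prime p" "p > 2"
  shows "Legendre (a * b) (int p) = Legendre a (int p) * Legendre b (int p)"
proof (rule sign_eq_if_cong[OF _ assms(2)])
  have "[Legendre (a * b) (int p) = (a * b) ^ ((p - 1) div 2)] (mod int p)"
    by (rule euler_criterion[OF assms])
  moreover have "[Legendre a (int p) * Legendre b (int p) = a ^ ((p - 1) div 2) * b ^ ((p - 1) div 2)] (mod int p)"
    by (intro cong_mult euler_criterion assms)
  ultimately show "[Legendre (a * b) (int p) = Legendre a (int p) * Legendre b (int p)] (mod int p)"
    unfolding power_mult_distrib using cong_trans cong_sym by blast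
qed (use Legendre_cases[of a "int p"] Legendre_cases[of b "int p"] Legendre_cases[of "a * b" "int p"] in auto)

lemma Legendre_one: "p > 1 \<Longrightarrow> Legendre 1 (int p) = 1"
  unfolding Legendre_def QuadRes_def by (auto simp: cong_def intro!: exI[of _ 1])

lemma Legendre_prod:
  assumes "prime p" "p > 2"
  shows "Legendre (\<Prod>x\<in>A. f x) (int p) = (\<Prod>x\<in>A. Legendre (f x) (int p))"
  using assms by (induction A rule: infinite_finite_induct) (auto simp: Legendre_mult Legendre_one)

lemma Legendre_minus_one:
  assumes "prime p" "p > 2"
  shows "Legendre (- 1) (int p) = (-1) ^ ((p - 1) div 2)"
proof (rule sign_eq_if_cong[OF euler_criterion[OF assms] assms(2)])
  show "(-1::int) ^ ((p - 1) div 2) \<in> {-1,0,1}" using neg_one_even_power neg_one_odd_power by blast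
qed (use Legendre_cases[of "-1" "int p"] in auto)

text \<open>Gauss's lemma: with h = (p - 1) / 2, the doubles of 1, ..., h that exceed h come from
  the upper h - h div 2 numbers. The exponent is kept in this form and matched with
  \<open>chi8\<close> by residues modulo 8.\<close>

lemma Legendre_two:
  assumes "prime p" "p > 2"
  shows "Legendre 2 (int p) = (-1) ^ ((p - 1) div 2 - (p - 1) div 2 div 2)"
proof -
  interpret GAUSS p 2
    using assms by unfold_locales (auto simp: cong_0_iff dest: zdvd_imp_le)
  define h where "h = (int p - 1) div 2"
  have ph: "int p = 2 * h + 1" using p_eq2 h_def by simp
  have "E = (\<lambda>x. 2 * x) ` {h div 2 <.. h}"
  proof -
    have "C = (\<lambda>x. 2 * x) ` {0<..h}"
      unfolding C_def B_def A_def h_def[symmetric] image_image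
      by (rule image_cong) (auto simp: ph)
    thus ?thesis unfolding E_def h_def[symmetric] by auto
  qed
  hence "card E = card {h div 2 <.. h}" by (simp add: card_image inj_on_def)
  also have "\<dots> = nat (h - h div 2)" by simp
  also have "nat (h - h div 2) = (p - 1) div 2 - (p - 1) div 2 div 2"
  proof -
    define k where "k = (p - 1) div 2"
    have "h = int k" unfolding k_def using ph assms by auto
    hence "h - h div 2 = int (k - k div 2)" by (simp add: of_nat_diff zdiv_int)
    thus ?thesis unfolding k_def by (simp only: nat_int)
  qed
  finally show ?thesis using gauss_lemma by simp
qed

text \<open>A primitive root has order p - 1, so its power (p - 1) / 2 is not 1, and Euler's
  criterion makes it a nonresidue.\<close>

lemma nonresidue_exists:
  assumes "prime p" "p > 2"
  obtains g :: nat where "Legendre (int g) (int p) = -1"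
proof -
  obtain g where g: "residue_primroot p g" using prime_primitive_root_exists assms
    by (metis prime_gt_1_nat)
  have cop: "coprime p g" "ord p g = p - 1"
    using g assms by (auto simp: residue_primroot_def totient_prime)
  have "Legendre (int g) (int p) \<noteq> 0"
    using cop(1) assms unfolding Legendre_eq_0_iff int_dvd_int_iff
    by (metis coprime_absorb_left not_prime_unit)
  moreover have "Legendre (int g) (int p) \<noteq> 1"
  proof
    assume "Legendre (int g) (int p) = 1"
    hence "[1 = int g ^ ((p - 1) div 2)] (mod int p)" using euler_criterion[OF assms, of "int g"] by simp
    hence "[int (g ^ ((p - 1) div 2)) = int 1] (mod int p)" by (simp add: cong_sym)
    hence "[g ^ ((p - 1) div 2) = 1] (mod p)" by (simp only: cong_int_iff)
    hence "p - 1 dvd (p - 1) div 2" using ord_divides[of g "(p - 1) div 2" p] cop(2) by simp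
    hence "p - 1 \<le> (p - 1) div 2" using assms by (intro dvd_imp_le) auto
    thus False using assms by simp
  qed
  ultimately show ?thesis using that Legendre_cases by blast
qed

text \<open>\<open>chi4\<close> and \<open>chi8\<close> are the quadratic characters attached to the
  square roots of -1 and of 2.\<close>

definition chi4 :: "nat \<Rightarrow> int"
  where "chi4 n = (if n mod 4 = 1 then 1 else if n mod 4 = 3 then -1 else 0)"

definition chi8 :: "nat \<Rightarrow> int"
  where "chi8 n = (if n mod 8 \<in> {1, 7} then 1 else if n mod 8 \<in> {3, 5} then -1 else 0)"

lemma chi4_mult: "chi4 (m * n) = chi4 m * chi4 n"
proof -
  have "k mod 4 \<in> {0,1,2,3}" for k :: nat
    using mod_less_divisor[of 4 k] by (simp only: insert_iff empty_iff) linarith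
  from this[of m] this[of n] show ?thesis unfolding chi4_def mod_mult_eq[of m 4 n, symmetric]
    by (elim insertE emptyE) simp_all
qed

lemma chi8_mult: "chi8 (m * n) = chi8 m * chi8 n"
proof -
  have "k mod 8 \<in> {0,1,2,3,4,5,6,7}" for k :: nat
    using mod_less_divisor[of 8 k] by (simp only: insert_iff empty_iff) linarith
  from this[of m] this[of n] show ?thesis unfolding chi8_def mod_mult_eq[of m 8 n, symmetric]
    by (elim insertE emptyE) simp_all
qed

lemma chi4_odd_prime: "odd p \<Longrightarrow> chi4 p = (-1) ^ ((p - 1) div 2)"
proof -
  assume "odd p"
  then obtain k where k: "p = 2 * k + 1" by (elim oddE)
  have "(2 * k + 1) mod 4 = 1 \<longleftrightarrow> even k" "(2 * k + 1) mod 4 = 3 \<longleftrightarrow> odd k" by presburger+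
  thus ?thesis unfolding k chi4_def by auto
qed

lemma chi8_odd_prime: "odd p \<Longrightarrow> chi8 p = (-1) ^ ((p - 1) div 2 - (p - 1) div 2 div 2)"
proof -
  assume "odd p"
  then obtain k where k: "p = 2 * k + 1" by (elim oddE)
  define j where "j = k div 4"
  have "k = 4 * j + k mod 4" by (simp add: j_def)
  moreover have "k mod 4 < 4" by simp
  ultimately consider "k = 4 * j" | "k = 4 * j + 1" | "k = 4 * j + 2" | "k = 4 * j + 3" by linarith
  thus ?thesis
  proof cases
    case 1
    have p: "p = 8 * j + 1" using k 1 by simp
    have "p mod 8 = 1" unfolding p by (simp only: mod_mult_self4) simp
    moreover have "(p - 1) div 2 = 4 * j" unfolding p by simp
    hence "(p - 1) div 2 - (p - 1) div 2 div 2 = 2 * j" by simp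
    ultimately show ?thesis by (simp add: chi8_def)
  next
    case 2
    have p: "p = 8 * j + 3" using k 2 by simp
    have "p mod 8 = 3" unfolding p by (simp only: mod_mult_self4) simp
    moreover have "(p - 1) div 2 = 4 * j + 1" unfolding p by simp
    hence "(p - 1) div 2 - (p - 1) div 2 div 2 = 2 * j + 1" by simp
    ultimately show ?thesis by (simp add: chi8_def)
  next
    case 3
    have p: "p = 8 * j + 5" using k 3 by simp
    have "p mod 8 = 5" unfolding p by (simp only: mod_mult_self4) simp
    moreover have "(p - 1) div 2 = 4 * j + 2" unfolding p by simp
    hence "(p - 1) div 2 - (p - 1) div 2 div 2 = 2 * j + 1" by simp
    ultimately show ?thesis by (simp add: chi8_def)
  next
    case 4
    have p: "p = 8 * j + 7" using k 4 by simp
    have "p mod 8 = 7" unfolding p by (simp only: mod_mult_self4) simp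
    moreover have "(p - 1) div 2 = 4 * j + 3" unfolding p by simp
    hence "(p - 1) div 2 - (p - 1) div 2 div 2 = 2 * (j + 1)" by simp
    ultimately show ?thesis by (simp add: chi8_def)
  qed
qed

section \<open>The quadratic character of a squarefree number\<close>

definition odd_primes :: "nat \<Rightarrow> nat set"
  where "odd_primes d = {q. prime q \<and> q dvd d \<and> q \<noteq> 2}"

lemma finite_odd_primes: "d > 0 \<Longrightarrow> finite (odd_primes d)"
  by (rule finite_subset[of _ "{..d}"]) (auto simp: odd_primes_def dvd_imp_le)

lemma odd_primes_gt_2: "q \<in> odd_primes d \<Longrightarrow> prime q \<and> q > 2"
  using prime_ge_2_nat[of q] by (auto simp: odd_primes_def)

lemma odd_primes_odd: "q \<in> odd_primes d \<Longrightarrow> odd q"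
  using odd_primes_gt_2 prime_odd_nat by blast

lemma squarefree_eq_prod_odd_primes:
  assumes "squarefree d"
  shows "d = (if even d then 2 else 1) * \<Prod>(odd_primes d)"
proof -
  have d0: "d > 0" using assms by (auto intro!: gr0I)
  have "d = (\<Prod>p\<in>prime_factors d. p ^ multiplicity p d)"
    using d0 by (simp add: prime_factorization_nat)
  also have "\<dots> = \<Prod>(prime_factors d)"
  proof (rule prod.cong)
    fix p assume p: "p \<in> prime_factors d"
    have "multiplicity p d = 1"
      using p assms d0 squarefree_factorial_semiring'[of d] by auto
    thus "p ^ multiplicity p d = p" by simp
  qed simp
  also have "prime_factors d = (if even d then {2} else {}) \<union> odd_primes d"
    using d0 by (auto simp: prime_factors_dvd odd_primes_def)
  also have "\<Prod>\<dots> = (if even d then 2 else 1) * \<Prod>(odd_primes d)"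
    using finite_odd_primes[OF d0] by (auto simp: odd_primes_def)
  finally show ?thesis .
qed

lemma squarefree_dvd_if_primes_dvd:
  assumes "squarefree d" "\<And>q. prime q \<Longrightarrow> q dvd d \<Longrightarrow> q dvd m"
  shows "d dvd (m :: nat)"
proof -
  have d0: "d > 0" using assms by (auto intro!: gr0I)
  have o: "\<Prod>(odd_primes d) dvd m"
    by (rule prod_coprime_dvd) (use finite_odd_primes[OF d0] assms(2) in \<open>auto simp: odd_primes_def primes_coprime\<close>)
  show ?thesis
  proof (cases "even d")
    case True
    have "coprime 2 (\<Prod>(odd_primes d))"
      by (intro prod_coprime_right) (auto dest: odd_primes_odd)
    moreover have "2 dvd m" using assms(2)[of 2] True by simp
    ultimately have "2 * \<Prod>(odd_primes d) dvd m" using o by (intro divides_mult)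
    thus ?thesis using squarefree_eq_prod_odd_primes[OF assms(1)] True by simp
  next
    case False
    thus ?thesis using squarefree_eq_prod_odd_primes[OF assms(1)] o by simp
  qed
qed

text \<open>The Kronecker character of the field generated by a square root of \<open>- d\<close>, made imprimitive at
  \<open>2\<close>. It is given by its values on residue classes, so that periodicity is clear; reciprocity is only
  needed for primes, to relate it to squares modulo primes.\<close>

definition quad_char :: "nat \<Rightarrow> nat \<Rightarrow> real"
  where "quad_char d n = real_of_int (chi4 n ^ Suc (card {q \<in> odd_primes d. q mod 4 = 3}) *
    (if even d then chi8 n else 1) * (\<Prod>q\<in>odd_primes d. Legendre (int n) (int q)))"

lemma sign_character_quad_char: "sign_character (quad_char d)"
proof -
  have L1: "(\<Prod>q\<in>odd_primes d. Legendre 1 (int q)) = 1"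
    using odd_primes_gt_2 by (intro prod.neutral ballI Legendre_one) fastforce
  have L: "(\<Prod>q\<in>odd_primes d. Legendre (int m * int n) (int q)) =
     (\<Prod>q\<in>odd_primes d. Legendre (int m) (int q)) * (\<Prod>q\<in>odd_primes d. Legendre (int n) (int q))" for m n
    unfolding prod.distrib[symmetric] using odd_primes_gt_2 by (intro prod.cong Legendre_mult) auto
  have sgn: "(\<Prod>q\<in>odd_primes d. Legendre (int n) (int q)) \<in> {-1,0,1}" for n
  proof (induction "odd_primes d" rule: infinite_finite_induct)
    case (insert q Q)
    have "(\<Prod>q\<in>A. Legendre (int n) (int q)) \<in> {-1,0,1}" for A
    proof (induction A rule: infinite_finite_induct)
      case (insert q A)
      thus ?case using Legendre_cases[of "int n" "int q"] by auto
    qed auto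
    thus ?case .
  qed auto
  have c4: "chi4 n \<in> {-1,0,1}" for n by (auto simp: chi4_def)
  have c4p: "chi4 n ^ k \<in> {-1,0,1}" for n k
    by (induction k) (use c4[of n] in auto)
  have c8: "(if even d then chi8 n else 1) \<in> {-1,0,1}" for n by (auto simp: chi8_def)
  have m3: "a * b * c \<in> {-1,0,1}" if "a \<in> {-1,0,1}" "b \<in> {-1,0,1}" "c \<in> {-1,0,1}" for a b c :: int
    using that by auto
  have "quad_char d n \<in> {-1,0,1}" for n
  proof -
    have "real_of_int a \<in> {-1,0,1}" if "a \<in> {-1,0,1}" for a using that by auto
    from this[OF m3[OF c4p c8 sgn]] show ?thesis unfolding quad_char_def .
  qed
  moreover have "quad_char d 1 = 1" unfolding quad_char_def
    using L1 by (simp add: chi4_def chi8_def)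
  moreover have "quad_char d (m * n) = quad_char d m * quad_char d n" for m n
    unfolding quad_char_def of_int_mult[symmetric] of_int_eq_iff chi4_mult chi8_mult of_nat_mult L
    by (simp add: power_mult_distrib)
  ultimately show ?thesis by (auto simp: sign_character_def)
qed

lemma quad_char_periodic: "quad_char d (n + 8 * d * k) = quad_char d n"
proof -
  have "n + 8 * d * k = n + 4 * (2 * d * k)" "n + 8 * d * k = n + 8 * (d * k)" by auto
  hence m: "(n + 8 * d * k) mod 4 = n mod 4" "(n + 8 * d * k) mod 8 = n mod 8"
    by (metis mod_mult_self2, metis mod_mult_self2)
  have "Legendre (int (n + 8 * d * k)) (int q) = Legendre (int n) (int q)" if "q \<in> odd_primes d" for q
  proof (rule Legendre_cong)
    have "q dvd 8 * d * k" using that by (simp add: odd_primes_def)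
    hence "int q dvd int (n + 8 * d * k) - int n"
      by (simp only: of_nat_add add_diff_cancel_left' int_dvd_int_iff)
    thus "[int (n + 8 * d * k) = int n] (mod int q)" by (simp only: cong_iff_dvd_diff)
  qed
  hence "(\<Prod>q\<in>odd_primes d. Legendre (int (n + 8 * d * k)) (int q)) = (\<Prod>q\<in>odd_primes d. Legendre (int n) (int q))"
    by (rule prod.cong[OF refl])
  thus ?thesis unfolding quad_char_def chi4_def chi8_def m by simp
qed

text \<open>\<open>chi4\<close> enters with a successor as exponent, so even arguments give 0 for
  odd \<open>d\<close> as well; the other zeros come from the odd primes of
  \<open>d\<close>.\<close>

lemma quad_char_eq_0_iff:
  assumes "d > 0" shows "quad_char d n = 0 \<longleftrightarrow> \<not> coprime n (2 * d)"
proof -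
  have c4: "chi4 n = 0 \<longleftrightarrow> even n" unfolding chi4_def by presburger
  have c8: "chi8 n = 0 \<longleftrightarrow> even n" unfolding chi8_def insert_iff empty_iff by presburger
  have "quad_char d n = 0 \<longleftrightarrow> even n \<or> (\<exists>q\<in>odd_primes d. q dvd n)"
    unfolding quad_char_def using finite_odd_primes[OF assms]
    by (auto simp: c4 c8 Legendre_eq_0_iff prod_zero_iff)
  also have "\<dots> \<longleftrightarrow> (\<exists>q\<in>prime_divs (2 * d). q dvd n)"
  proof -
    have "prime_divs (2 * d) = insert 2 (odd_primes d)"
      using primes_dvd_imp_eq[OF _ two_is_prime_nat]
      by (auto simp: prime_divs_def odd_primes_def prime_dvd_mult_iff)
    thus ?thesis by simp
  qed
  also have "\<dots> \<longleftrightarrow> \<not> coprime n (2 * d)"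
  proof (cases "n = 0")
    case False
    thus ?thesis using sieve_prime_divs[of n "2 * d" "\<lambda>_. 1"] by (auto simp: sieve_def split: if_splits)
  next
    case True
    have "2 \<in> prime_divs (2 * d)" by (simp add: prime_divs_def)
    thus ?thesis using True assms by auto
  qed
  finally show ?thesis .
qed

text \<open>The symbol of -d splits into those of -1, possibly of 2, and of the odd primes q of d.
  Reciprocity exchanges q and p at the price of \<open>chi4 p\<close> when q is 3 modulo 4. The
  exponent of \<open>chi4\<close> in \<open>quad_char\<close> counts these q, plus one for the
  symbol of -1.\<close>

lemma quad_char_prime:
  assumes "squarefree d" "prime p" "\<not> p dvd 2 * d"
  shows "quad_char d p = real_of_int (Legendre (- int d) (int p))"
proof -
  have d0: "d > 0" using assms by (auto intro!: gr0I)
  have p: "p > 2" "odd p"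
  proof -
    have "p \<noteq> 2" using assms(3) by auto
    thus "p > 2" using prime_ge_2_nat[OF assms(2)] by simp
    thus "odd p" using prime_odd_nat assms(2) by blast
  qed
  have c: "chi4 p = 1 \<or> chi4 p = -1" using p(2) unfolding chi4_def by presburger
  have rec: "Legendre (int p) (int q) = Legendre (int q) (int p) * (if q mod 4 = 3 then chi4 p else 1)"
    if q: "q \<in> odd_primes d" for q
  proof -
    have q': "prime q" "q > 2" "p \<noteq> q" "odd q" "q dvd d" using q odd_primes_gt_2[OF q] assms(3)
      by (auto simp: odd_primes_def prime_odd_nat)
    have "Legendre (int q) (int p) \<noteq> 0"
      unfolding Legendre_eq_0_iff int_dvd_int_iff using q' assms primes_dvd_imp_eq by blast
    hence sq: "Legendre (int q) (int p) * Legendre (int q) (int p) = 1"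
      using Legendre_cases[of "int q" "int p"] by auto
    have "Legendre (int p) (int q) * Legendre (int q) (int p) = ((-1) ^ ((p - 1) div 2)) ^ ((q - 1) div 2)"
      unfolding power_mult[symmetric] using assms(2) p(1) q' by (intro Quadratic_Reciprocity)
    also have "\<dots> = chi4 p ^ ((q - 1) div 2)" using chi4_odd_prime[OF p(2)] by simp
    also have "\<dots> = (if q mod 4 = 3 then chi4 p else 1)"
    proof -
      have "odd ((q - 1) div 2) \<longleftrightarrow> q mod 4 = 3" using q'(4) by presburger
      thus ?thesis using c by auto
    qed
    finally have "Legendre (int p) (int q) * (Legendre (int q) (int p) * Legendre (int q) (int p)) =
        Legendre (int q) (int p) * (if q mod 4 = 3 then chi4 p else 1)"
      by (simp only: mult.assoc[symmetric] mult.commute)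
    thus ?thesis using sq by simp
  qed
  have "(\<Prod>q\<in>odd_primes d. Legendre (int p) (int q)) =
      (\<Prod>q\<in>odd_primes d. Legendre (int q) (int p)) * (\<Prod>q\<in>odd_primes d. if q mod 4 = 3 then chi4 p else 1)"
    using rec by (simp add: prod.distrib)
  also have "(\<Prod>q\<in>odd_primes d. if q mod 4 = 3 then chi4 p else 1) = chi4 p ^ card {q \<in> odd_primes d. q mod 4 = 3}"
    using finite_odd_primes[OF d0] by (subst prod.If_cases) (auto simp: Int_def)
  finally have P: "(\<Prod>q\<in>odd_primes d. Legendre (int p) (int q)) =
      Legendre (int (\<Prod>(odd_primes d))) (int p) * chi4 p ^ card {q \<in> odd_primes d. q mod 4 = 3}"
    using Legendre_prod[OF assms(2) p(1), of int "odd_primes d"] by (simp only: of_nat_prod)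
  have "int d = (if even d then 2 else 1) * int (\<Prod>(odd_primes d))"
    using arg_cong[OF squarefree_eq_prod_odd_primes[OF assms(1)], of int] by (auto split: if_splits)
  hence "- int d = (- 1) * (if even d then 2 else 1) * int (\<Prod>(odd_primes d))" by simp
  hence "Legendre (- int d) (int p) = Legendre (- 1) (int p) * Legendre (if even d then 2 else 1) (int p) *
      Legendre (int (\<Prod>(odd_primes d))) (int p)"
    by (simp only: Legendre_mult[OF assms(2) p(1)])
  also have "Legendre (- 1) (int p) = chi4 p"
    using Legendre_minus_one[OF assms(2) p(1)] chi4_odd_prime[OF p(2)] by simp
  also have "Legendre (if even d then 2 else 1) (int p) = (if even d then chi8 p else 1)"
    using Legendre_two[OF assms(2) p(1)] chi8_odd_prime[OF p(2)] Legendre_one p(1) by simp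
  finally have L: "Legendre (- int d) (int p) = chi4 p * (if even d then chi8 p else 1) *
      Legendre (int (\<Prod>(odd_primes d))) (int p)" .
  have "chi4 p ^ k * chi4 p ^ k = 1" for k using c by (auto simp flip: power_mult_distrib)
  hence "chi4 p ^ Suc k * x * (y * chi4 p ^ k) = chi4 p * x * y" for k x y
    by (simp add: algebra_simps)
  thus ?thesis unfolding quad_char_def P L of_int_eq_iff by blast
qed

lemma quad_char_prime_eq_1:
  assumes "squarefree d" "prime p" "quad_char d p = 1"
  shows "\<not> int p dvd 2 * int d \<and> (\<exists>b. int p dvd b^2 + int d)"
proof -
  have d0: "d > 0" using assms by (auto intro!: gr0I)
  have "coprime p (2 * d)" using quad_char_eq_0_iff[OF d0, of p] assms(3) by auto
  hence nd: "\<not> p dvd 2 * d" using assms(2) by (metis coprime_absorb_left not_prime_unit)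
  have "Legendre (- int d) (int p) = 1" using quad_char_prime[OF assms(1,2) nd] assms(3) by simp
  then obtain y where "[y^2 = - int d] (mod int p)"
    unfolding Legendre_def QuadRes_def by (auto split: if_splits)
  hence "int p dvd y^2 + int d" by (simp add: cong_iff_dvd_diff)
  moreover have "\<not> int p dvd 2 * int d" using nd by (metis int_dvd_int_iff of_nat_mult of_nat_numeral)
  ultimately show ?thesis by blast
qed

text \<open>Some prime q divides \<open>d\<close> but not \<open>2 * m\<close>. By the Chinese
  remainder theorem \<open>n\<close> can be 1 modulo \<open>8 * m\<close> and modulo the other odd
  primes of \<open>d\<close>, yet a nonresidue modulo q, so exactly one factor of the character is
  -1. With \<open>m = 1\<close> the character is seen to be nontrivial; with \<open>m\<close>
  another parameter, so is the product of the two characters.\<close>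

lemma quad_char_minus_one_exists:
  assumes "squarefree d" "\<not> d dvd 2 * m" "m > 0"
  obtains n where "[n = 1] (mod 8 * m)" "quad_char d n = -1"
proof -
  have d0: "d > 0" using assms by (auto intro!: gr0I)
  obtain q where q: "prime q" "q dvd d" "\<not> q dvd 2 * m"
    using squarefree_dvd_if_primes_dvd[OF assms(1), of "2 * m"] assms(2) by blast
  have q2: "q \<noteq> 2" using q by auto
  have qo: "q \<in> odd_primes d" using q q2 by (simp add: odd_primes_def)
  obtain g where g: "Legendre (int g) (int q) = -1"
    using nonresidue_exists q odd_primes_gt_2[OF qo] by blast
  define M where "M = 8 * m * \<Prod>(odd_primes d - {q})"
  have "coprime q (\<Prod>(odd_primes d - {q}))"
    using q by (intro prod_coprime_right primes_coprime) (auto simp: odd_primes_def)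
  moreover have "coprime q (2 * m)" using q prime_imp_coprime by blast
  hence "coprime q (2 ^ 3 * m)" by (simp only: coprime_mult_right_iff coprime_power_right_iff) simp
  hence "coprime q (8 * m)" by simp
  ultimately have "coprime M q" unfolding M_def by (simp add: coprime_commute coprime_mult_right_iff)
  then obtain n where n: "[n = 1] (mod M)" "[n = g] (mod q)"
    using binary_chinese_remainder_nat by blast
  have n8m: "[n = 1] (mod 8 * m)" using n(1) unfolding M_def by (rule cong_dvd_modulus_nat) simp
  have n8: "[n = 1] (mod 8)" using n8m by (rule cong_dvd_modulus_nat) simp
  hence m8: "n mod 8 = 1" by (simp add: cong_def)
  hence m4: "n mod 4 = 1" by presburger
  have other: "Legendre (int n) (int q') = 1" if "q' \<in> odd_primes d - {q}" for q'
  proof -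
    have "q' dvd M" unfolding M_def using that finite_odd_primes[OF d0] by (intro dvd_mult dvd_prodI) auto
    hence "[n = 1] (mod q')" using n(1) cong_dvd_modulus_nat by blast
    hence "[int n = int 1] (mod int q')" by (simp only: cong_int_iff)
    hence "Legendre (int n) (int q') = Legendre (int 1) (int q')" by (rule Legendre_cong)
    also have "\<dots> = 1" using Legendre_one[of q'] odd_primes_gt_2[of q' d] that by simp
    finally show ?thesis .
  qed
  have "[int n = int g] (mod int q)" using n(2) by (simp only: cong_int_iff)
  hence "Legendre (int n) (int q) = -1" using Legendre_cong g by metis
  moreover have "(\<Prod>q\<in>odd_primes d. Legendre (int n) (int q)) =
      Legendre (int n) (int q) * (\<Prod>q'\<in>odd_primes d - {q}. Legendre (int n) (int q'))"
    using qo finite_odd_primes[OF d0] by (rule prod.remove[rotated])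
  ultimately have "(\<Prod>q\<in>odd_primes d. Legendre (int n) (int q)) = -1" using other by simp
  hence "quad_char d n = -1" using m4 m8 by (simp add: quad_char_def chi4_def chi8_def)
  thus ?thesis using that n8m by blast
qed

text \<open>Multiplication by \<open>c\<close> permutes the residues and flips the sign of
  \<open>f\<close>, so the sum over a period is its own negative. Only an incomplete period is
  left.\<close>

lemma bounded_sums_periodic_sign_character:
  assumes ch: "sign_character f" and N: "N > 0" and per: "\<And>n k. f (n + N * k) = f n"
    and c: "coprime c N" "f c = -1"
  shows "bounded_sums f (real N)"
proof -
  have fmod: "f (n mod N) = f n" for n
    using per[of "n mod N" "n div N"] by simp
  have bij: "bij_betw (\<lambda>n. (c * n) mod N) {..<N} {..<N}"
  proof -
    have "inj_on (\<lambda>n. (c * n) mod N) {..<N}"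
    proof (rule inj_onI)
      fix a b assume ab: "a \<in> {..<N}" "b \<in> {..<N}" "(c * a) mod N = (c * b) mod N"
      hence "[c * a = c * b] (mod N)" by (simp add: cong_def)
      hence "[a = b] (mod N)" using c(1) by (simp add: cong_mult_lcancel_nat)
      thus "a = b" using ab by (simp add: cong_def)
    qed
    moreover have "(\<lambda>n. (c * n) mod N) ` {..<N} \<subseteq> {..<N}" using N by auto
    ultimately show ?thesis unfolding bij_betw_def by (simp add: endo_inj_surj)
  qed
  have "(\<Sum>n<N. f n) = (\<Sum>n<N. f ((c * n) mod N))"
    using sum.reindex_bij_betw[OF bij, of f] by simp
  also have "\<dots> = - (\<Sum>n<N. f n)"
    unfolding fmod sign_character_mult[OF ch] c(2) by (simp add: sum_negf)
  finally have z: "(\<Sum>n<N. f n) = 0" by simp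
  have sm: "(\<Sum>k<n. f k) = (\<Sum>k<n mod N. f k)" for n
  proof (induction n rule: less_induct)
    case (less n)
    show ?case
    proof (cases "n < N")
      case False
      have "(\<Sum>k<n. f k) = (\<Sum>k<N. f k) + (\<Sum>k=N..<n. f k)"
        using False by (simp add: lessThan_atLeast0 sum.atLeastLessThan_concat)
      also have "(\<Sum>k=N..<n. f k) = (\<Sum>k<n - N. f (k + N * 1))"
        using False by (intro sum.reindex_bij_witness[of _ "\<lambda>k. k + N" "\<lambda>k. k - N"]) auto
      also have "\<dots> = (\<Sum>k<n - N. f k)" unfolding per ..
      also have "\<dots> = (\<Sum>k<(n - N) mod N. f k)" using less.IH[of "n - N"] False N by simp
      also have "(n - N) mod N = n mod N" using False by (simp add: le_mod_geq)
      finally show ?thesis using z by simp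
    qed simp
  qed
  \<comment> \<open>From f 0 = f 0 * f c = - f 0. Sums from 1 and sums from 0 therefore
    agree.\<close>
  have f0': "f 0 = 0" using sign_character_mult[OF ch, of 0 c] c by simp
  show ?thesis unfolding bounded_sums_def
  proof
    fix n
    have "(\<Sum>k=1..n. f k) = (\<Sum>k<Suc n. f k)"
      using f0' by (simp add: lessThan_Suc_atMost atMost_atLeast0 sum.atLeast_Suc_atMost del: sum.lessThan_Suc)
    also have "\<bar>\<dots>\<bar> \<le> (\<Sum>k<Suc n mod N. \<bar>f k\<bar>)" unfolding sm[of "Suc n"] by (rule sum_abs)
    also have "\<dots> \<le> (\<Sum>k<Suc n mod N. 1)" using sign_character_abs[OF ch] by (intro sum_mono)
    also have "\<dots> \<le> real N" using mod_less_divisor[OF N, of "Suc n"] by simp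
    finally show "\<bar>\<Sum>k=1..n. f k\<bar> \<le> real N" .
  qed
qed

section \<open>Sums over norms of ideals\<close>

text \<open>If the square of the ideal generated by \<open>n\<close> and \<open>b\<close> plus a square root of \<open>- d\<close> is principal, a
  generator is half of \<open>u\<close> plus \<open>v\<close> times that root, with \<open>u\<close> and \<open>v\<close> as in this definition.\<close>

definition squares_represented :: "nat \<Rightarrow> bool"
  where "squares_represented d \<longleftrightarrow> (\<forall>n>1. coprime n (2 * d) \<longrightarrow> (\<exists>b. int n dvd b^2 + int d) \<longrightarrow>
    (\<exists>u v :: int. v \<noteq> 0 \<and> 4 * (int n)^2 = u^2 + int d * v^2))"

text \<open>The condition \<open>v \<ge> 1\<close> excludes 4 n^2 = (2 n)^2, which would let every
  \<open>n\<close> in.\<close>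

definition exceptional_norms :: "nat \<Rightarrow> nat \<Rightarrow> nat set"
  where "exceptional_norms d N = {n \<in> {1..N}. \<exists>u v :: nat. v \<ge> 1 \<and> 4 * n^2 = u^2 + d * v^2}"

abbreviation norm_count :: "nat \<Rightarrow> nat \<Rightarrow> real"
  where "norm_count d \<equiv> ideal_count (prime_divs (2 * d)) (quad_char d)"

text \<open>Norms of ideals generated by an integer \<open>k\<close> with inert primes only: a split
  prime in \<open>k\<close> would raise the count above 1. Removing \<open>exceptional_norms\<close>
  makes the two sets disjoint, so a sum over norms splits.\<close>

definition square_norms :: "nat \<Rightarrow> nat \<Rightarrow> nat set"
  where "square_norms d N = {n \<in> {1..N} - exceptional_norms d N. norm_count d n = 1 \<and> (\<exists>k. n = k^2)}"

text \<open>A norm that occurs is n1 k^2 with n1 made of split primes. If n1 > 1, then -d is a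
  square modulo n1, the hypothesis represents 4 n1^2, and scaling \<open>u\<close> and
  \<open>v\<close> by k^2 makes \<open>n\<close> exceptional. If n1 = 1, then \<open>n\<close> is a
  square with count 1.\<close>

lemma norm_count_cases:
  assumes "squarefree d" "squares_represented d" "n \<in> {1..N}" "n \<notin> exceptional_norms d N"
  shows "norm_count d n = 0 \<or> n \<in> square_norms d N"
proof (cases "coprime n (2 * d)")
  case False
  have "d > 0" using assms by (auto intro!: gr0I)
  hence "norm_count d n = 0"
    using assms(3) False by (intro ideal_count_not_coprime) (auto simp: quad_char_eq_0_iff)
  thus ?thesis ..
next
  case True
  have d0: "d > 0" using assms by (auto intro!: gr0I)
  have n0: "n > 0" using assms by auto
  have nc: "norm_count d n = (\<Sum>b | b dvd n. quad_char d b)"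
    by (rule ideal_count_coprime[OF True n0])
  have nz: "quad_char d p \<noteq> 0" if "p dvd n" for p
  proof -
    have "coprime p (2 * d)" using that True coprime_divisors[of p n "2 * d" "2 * d"] by simp
    thus ?thesis using quad_char_eq_0_iff[OF d0, of p] by simp
  qed
  consider "norm_count d n = 0" | n1 k where "n = n1 * k^2" "\<forall>p. prime p \<longrightarrow> p dvd n1 \<longrightarrow> quad_char d p = 1"
     "n1 = 1 \<longrightarrow> norm_count d n = 1"
    using sum_divisors_cases[OF sign_character_quad_char n0, of d] nz unfolding nc by metis
  thus ?thesis
  proof cases
    case 1 thus ?thesis ..
  next
    case 2
    show ?thesis
    proof (cases "n1 = 1")
      case True
      hence "n = k^2" "norm_count d n = 1" using 2 by auto
      thus ?thesis using assms(3,4) by (auto simp: square_norms_def)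
    next
      case False
      have n1: "n1 > 0" "k > 0" using n0 2(1) by (auto intro!: gr0I)
      have "\<exists>b. int n1 dvd b^2 + int d"
        by (rule square_root_mod_exists[OF n1(1)]) (use 2(2) quad_char_prime_eq_1[OF assms(1)] in blast)
      moreover have "coprime n1 (2 * d)"
        using True 2(1) coprime_divisors[of n1 n "2 * d" "2 * d"] by simp
      moreover have "n1 > 1" using n1 False by simp
      ultimately obtain u v :: int where uv: "v \<noteq> 0" "4 * (int n1)^2 = u^2 + int d * v^2"
        using assms(2) unfolding squares_represented_def by blast
      define a b where "a = nat \<bar>u\<bar> * k^2" and "b = nat \<bar>v\<bar> * k^2"
      have "int (4 * n^2) = (4 * (int n1)^2) * (int k^2)^2"
        unfolding 2(1) by (simp add: power_mult_distrib)
      also have "\<dots> = (\<bar>u\<bar> * int k^2)^2 + int d * (\<bar>v\<bar> * int k^2)^2"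
        unfolding uv(2) by (simp add: algebra_simps power_mult_distrib)
      also have "\<dots> = int (a^2 + d * b^2)" by (simp add: a_def b_def)
      finally have "4 * n^2 = a^2 + d * b^2" by (simp only: of_nat_eq_iff)
      moreover have "b \<ge> 1" using uv(1) n1(2) by (simp add: b_def Suc_le_eq)
      ultimately have "n \<in> exceptional_norms d N" using assms(3) by (auto simp: exceptional_norms_def)
      thus ?thesis using assms(4) by simp
    qed
  qed
qed

lemma abs_norm_count_le:
  assumes "d > 0" "n > 0" shows "\<bar>norm_count d n\<bar> \<le> real (card {b. b dvd n})"
proof (cases "coprime n (2 * d)")
  case True
  thus ?thesis using ideal_count_coprime[OF True assms(2)] abs_sum_divisors_le[OF sign_character_quad_char assms(2)]
    by simp
next
  case False
  hence "norm_count d n = 0"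
    using assms by (intro ideal_count_not_coprime) (auto simp: quad_char_eq_0_iff)
  thus ?thesis by simp
qed

text \<open>Factor \<open>4 n\<^sup>2 - u\<^sup>2 = d v\<^sup>2\<close>: the divisor \<open>2 n - u\<close> of \<open>d v\<^sup>2\<close> determines \<open>n\<close>.\<close>

lemma card_norms_with_fixed_v:
  fixes d v N :: nat
  assumes "d > 0" "v > 0"
  shows "card {n \<in> {1..N}. \<exists>u. 4 * n^2 = u^2 + d * v^2} \<le> card {t. t dvd d * v^2}"
proof -
  \<comment> \<open>The divisor complementary to 2 n - u is 2 n + u, and the two add up to 4
    n.\<close>
  let ?f = "\<lambda>t. (t + d * v^2 div t) div 4"
  have fin: "finite {t. t dvd d * v^2}" using assms by (intro finite_divisors_nat) simp
  have "{n \<in> {1..N}. \<exists>u. 4 * n^2 = u^2 + d * v^2} \<subseteq> ?f ` {t. t dvd d * v^2}"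
  proof clarify
    fix n u assume n: "n \<in> {1..N}" and eq: "4 * n^2 = u^2 + d * v^2"
    have "u^2 < (2 * n)^2" using eq assms by (simp add: power_mult_distrib)
    hence lt: "u < 2 * n" using power_less_imp_less_base by blast
    define t where "t = 2 * n - u"
    have t: "2 * n = u + t" "t > 0" using lt by (auto simp: t_def)
    have "4 * n^2 = (u + t)^2" unfolding t(1)[symmetric] by (simp add: power_mult_distrib)
    hence dv: "d * v^2 = t * (t + 2 * u)" using eq by (simp add: power2_eq_square algebra_simps)
    hence "d * v^2 div t = t + 2 * u" using t by simp
    moreover have "t + (t + 2 * u) = 4 * n" using t by simp
    ultimately have "n = ?f t" by simp
    moreover have "t \<in> {t. t dvd d * v^2}" using dv by simp
    ultimately show "n \<in> ?f ` {t. t dvd d * v^2}" by (rule image_eqI)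
  qed
  hence "card {n \<in> {1..N}. \<exists>u. 4 * n^2 = u^2 + d * v^2} \<le> card (?f ` {t. t dvd d * v^2})"
    using fin by (intro card_mono) auto
  also have "\<dots> \<le> card {t. t dvd d * v^2}" using fin by (rule card_image_le)
  finally show ?thesis .
qed

text \<open>Fix \<open>v\<close>. As n >= sqrt(d) v / 2, giving away N^(1/100) bounds n^(-s) by 4
  N^(1/100) d^(-1/2) v^(-201/200), which can be summed over \<open>v\<close>. The divisor bound with
  exponent 1/200 is used twice: for the weight, at the cost N^(1/200), and for the number of
  \<open>n\<close> belonging to \<open>v\<close>, at the cost N^(1/100) since d v^2 <= 4 N^2. The
  total N^(1/40) d^(-1/2) is at most d^(-1/5) when N <= d^12.\<close>

lemma exceptional_norms_sum_bound:
  obtains K where "K \<ge> 0" "\<And>d N s. d > 0 \<Longrightarrow> N \<ge> 1 \<Longrightarrow> N \<le> d^12 \<Longrightarrow> s \<ge> 199/200 \<Longrightarrow>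
    (\<Sum>n\<in>exceptional_norms d N. real (card {b. b dvd n}) * real n powr - s) \<le> K * real d powr - (1/5)"
proof -
  obtain C where C: "C \<ge> 1" "\<And>n. n \<ge> 1 \<Longrightarrow> real (card {b. b dvd n}) \<le> C * real n powr (1/200)"
    using divisor_bound[of "1/200"] by auto
  define Z where "Z = suminf (\<lambda>v. real v powr - (201/200))"
  have summ: "summable (\<lambda>v. real v powr - (201/200))" by (subst summable_real_powr_iff) simp
  have Z0: "Z \<ge> 0" unfolding Z_def by (rule suminf_nonneg[OF summ]) simp
  define K where "K = 16 * C^2 * Z"
  have "(\<Sum>n\<in>exceptional_norms d N. real (card {b. b dvd n}) * real n powr - s) \<le> K * real d powr - (1/5)"
    if d: "d > 0" and N: "N \<ge> 1" "N \<le> d^12" and s: "s \<ge> 199/200" for d N s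
  proof -
    define A where "A v = {n \<in> {1..N}. \<exists>u. 4 * n^2 = u^2 + d * v^2}" for v
    define h where "h n = real (card {b. b dvd n}) * real n powr - s" for n
    define M where "M v = C * real N powr (3/200) * (4 * real d powr - (1/2) * real v powr - (201/200))" for v
    have finA: "finite (A v)" for v by (simp add: A_def)
    have v_le: "real d * real v^2 \<le> 4 * real N^2" and n_ge: "sqrt (real d) * real v / 2 \<le> real n"
      if n: "n \<in> A v" for n v
    proof -
      from n obtain u where "4 * n^2 = u^2 + d * v^2" "n \<le> N" by (auto simp: A_def)
      hence "d * v^2 \<le> 4 * n^2" by simp
      hence "real (d * v^2) \<le> real (4 * n^2)" by (simp only: of_nat_le_iff)
      hence le: "real d * real v^2 \<le> 4 * real n^2" by simp
      have "real n^2 \<le> real N^2" using \<open>n \<le> N\<close> by (intro power_mono) auto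
      thus "real d * real v^2 \<le> 4 * real N^2" using le by linarith
      have "(sqrt (real d) * real v / 2)^2 \<le> real n^2" using le by (simp add: power_mult_distrib power_divide)
      thus "sqrt (real d) * real v / 2 \<le> real n" by (rule power2_le_imp_le) simp
    qed
    have hM: "h n \<le> M v" if n: "n \<in> A v" and v: "v \<ge> 1" for n v
    proof -
      have nN: "1 \<le> real n" "real n \<le> real N" "n \<ge> 1" using n by (auto simp: A_def)
      have "real n powr - s \<le> real n powr - (199/200)" using nN s by (intro powr_mono) auto
      also have "\<dots> = real n powr (2/200) * real n powr - (201/200)" by (simp flip: powr_add)
      also have "\<dots> \<le> real N powr (2/200) * (sqrt (real d) * real v / 2) powr - (201/200)"
        using nN n_ge[OF n] d v by (intro mult_mono powr_mono2 powr_mono2') auto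
      also have "(sqrt (real d) * real v / 2) powr - (201/200) =
          2 powr (201/200) * sqrt (real d) powr - (201/200) * real v powr - (201/200)"
        by (simp add: powr_mult powr_divide powr_minus divide_simps)
      also have "\<dots> \<le> 4 * real d powr - (1/2) * real v powr - (201/200)"
      proof -
        have "2 powr (201/200) \<le> (2::real) powr 2" by (intro powr_mono) auto
        moreover have "sqrt (real d) powr - (201/200) \<le> sqrt (real d) powr - 1"
          using d by (intro powr_mono) auto
        moreover have "sqrt (real d) powr - 1 = real d powr - (1/2)"
          using d by (simp add: powr_minus powr_half_sqrt)
        ultimately show ?thesis by (intro mult_right_mono mult_mono) auto
      qed
      finally have 1: "real n powr - s \<le> real N powr (2/200) * (4 * real d powr - (1/2) * real v powr - (201/200))"
        by (simp add: mult_left_mono)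
      have "real (card {b. b dvd n}) \<le> C * real n powr (1/200)" using C(2) nN by blast
      also have "\<dots> \<le> C * real N powr (1/200)" using nN C(1) by (intro mult_left_mono powr_mono2) auto
      finally have "h n \<le> (C * real N powr (1/200)) * (real N powr (2/200) * (4 * real d powr - (1/2) * real v powr - (201/200)))"
        unfolding h_def using 1 C(1) by (intro mult_mono) auto
      also have "\<dots> = C * (real N powr (1/200) * real N powr (2/200)) * (4 * real d powr - (1/2) * real v powr - (201/200))"
        by simp
      also have "real N powr (1/200) * real N powr (2/200) = real N powr (3/200)" by (simp flip: powr_add)
      finally show ?thesis unfolding M_def .
    qed
    have M0: "M v \<ge> 0" for v using C(1) by (simp add: M_def)
    have cardA: "real (card (A v)) \<le> 4 * C * real N powr (1/100)" if v: "v \<ge> 1" for v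
    proof (cases "A v = {}")
      case True thus ?thesis using C(1) by simp
    next
      case False
      then obtain n where n: "n \<in> A v" by blast
      have "real (card (A v)) \<le> real (card {t. t dvd d * v^2})"
        unfolding A_def using card_norms_with_fixed_v[OF d] v by simp
      also have "\<dots> \<le> C * real (d * v^2) powr (1/200)" using d v by (intro C(2)) (simp add: Suc_le_eq)
      also have "\<dots> \<le> C * (4 * real N^2) powr (1/200)"
        using v_le[OF n] C(1) by (intro mult_left_mono powr_mono2) auto
      also have "(4 * real N^2) powr (1/200) = 4 powr (1/200) * (real N powr 2) powr (1/200)"
        using N by (simp add: powr_mult)
      also have "\<dots> = 4 powr (1/200) * real N powr (1/100)" unfolding powr_powr by simp
      also have "\<dots> \<le> 4 powr 1 * real N powr (1/100)"
        by (intro mult_right_mono powr_mono) auto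
      finally show ?thesis using C(1) by (simp add: mult.assoc mult.left_commute)
    qed
    have "(\<Sum>n\<in>exceptional_norms d N. h n) \<le> (\<Sum>(v,n)\<in>(SIGMA v:{1..2*N}. A v). h n)"
    proof (rule sum_le_included[where i = snd])
      show "\<forall>n\<in>exceptional_norms d N. \<exists>y\<in>(SIGMA v:{1..2*N}. A v). snd y = n \<and> h n \<le> (case y of (v, n) \<Rightarrow> h n)"
      proof
        fix n assume n: "n \<in> exceptional_norms d N"
        then obtain u v where uv: "v \<ge> 1" "4 * n^2 = u^2 + d * v^2" "n \<in> {1..N}"
          by (auto simp: exceptional_norms_def)
        have nA: "n \<in> A v" using uv by (auto simp: A_def)
        have "v^2 \<le> d * v^2" using d by simp
        also have "\<dots> \<le> 4 * n^2" using uv by simp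
        also have "\<dots> = (2 * n)^2" by (simp add: power_mult_distrib)
        also have "\<dots> \<le> (2 * N)^2" using uv(3) by (intro power_mono) auto
        finally have "v \<le> 2 * N" using power2_nat_le_eq_le by blast
        thus "\<exists>y\<in>(SIGMA v:{1..2*N}. A v). snd y = n \<and> h n \<le> (case y of (v, n) \<Rightarrow> h n)"
          using nA uv(1) by (intro bexI[of _ "(v, n)"]) auto
      qed
    qed (auto simp: finA exceptional_norms_def h_def)
    also have "\<dots> = (\<Sum>v=1..2*N. \<Sum>n\<in>A v. h n)" by (rule sum.Sigma[symmetric]) (auto simp: finA)
    also have "\<dots> \<le> (\<Sum>v=1..2*N. (4 * C * real N powr (1/100)) * M v)"
    proof (rule sum_mono)
      fix v assume v: "v \<in> {1..2*N}"
      have "(\<Sum>n\<in>A v. h n) \<le> (\<Sum>n\<in>A v. M v)" using hM v by (intro sum_mono) auto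
      also have "\<dots> = real (card (A v)) * M v" by simp
      also have "\<dots> \<le> (4 * C * real N powr (1/100)) * M v"
        using cardA[of v] v M0 by (intro mult_right_mono) auto
      finally show "(\<Sum>n\<in>A v. h n) \<le> (4 * C * real N powr (1/100)) * M v" .
    qed
    also have "\<dots> = 16 * C^2 * (real N powr (1/100) * real N powr (3/200)) * real d powr - (1/2) *
        (\<Sum>v=1..2*N. real v powr - (201/200))"
      unfolding M_def by (simp add: sum_distrib_left power2_eq_square mult_ac)
    also have "real N powr (1/100) * real N powr (3/200) = real N powr (1/40)" by (simp flip: powr_add)
    also have "16 * C^2 * real N powr (1/40) * real d powr - (1/2) * (\<Sum>v=1..2*N. real v powr - (201/200)) \<le>
        16 * C^2 * real d powr (3/10) * real d powr - (1/2) * Z"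
    proof (intro mult_mono)
      have "real N \<le> real (d^12)" using N(2) by (simp only: of_nat_le_iff)
      hence "real N powr (1/40) \<le> (real d ^ 12) powr (1/40)" using N by (intro powr_mono2) auto
      also have "real d ^ 12 = real d powr 12" using d by simp
      also have "(real d powr 12) powr (1/40) = real d powr (3/10)" unfolding powr_powr by simp
      finally show "real N powr (1/40) \<le> real d powr (3/10)" .
      show "(\<Sum>v=1..2*N. real v powr - (201/200)) \<le> Z"
        unfolding Z_def by (rule sum_le_suminf[OF summ]) auto
    qed (auto simp: sum_nonneg)
    also have "\<dots> = K * (real d powr (3/10) * real d powr - (1/2))" by (simp add: K_def)
    also have "real d powr (3/10) * real d powr - (1/2) = real d powr - (1/5)" by (simp flip: powr_add)
    finally show ?thesis unfolding h_def .
  qed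
  moreover have "K \<ge> 0" using Z0 by (simp add: K_def)
  ultimately show ?thesis using that by blast
qed

section \<open>Twisted sums over norms, compared with squares and with products of series\<close>

definition norm_sum :: "nat \<Rightarrow> (nat \<Rightarrow> real) \<Rightarrow> nat \<Rightarrow> real \<Rightarrow> real"
  where "norm_sum d f N s = (\<Sum>n=1..N. f n * norm_count d n * real n powr - s)"

lemma norm_sum_approx:
  assumes "squarefree d" "squares_represented d" "sign_character f"
  shows "\<bar>norm_sum d f N s - (\<Sum>n\<in>square_norms d N. f n * real n powr - s)\<bar> \<le>
    (\<Sum>n\<in>exceptional_norms d N. real (card {b. b dvd n}) * real n powr - s)"
proof -
  have d0: "d > 0" using assms by (auto intro!: gr0I)
  let ?t = "\<lambda>n. f n * norm_count d n * real n powr - s"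
  have sub: "exceptional_norms d N \<subseteq> {1..N}" "square_norms d N \<subseteq> {1..N}"
    by (auto simp: exceptional_norms_def square_norms_def)
  have fin: "finite (exceptional_norms d N)" "finite (square_norms d N)"
    using sub finite_subset by blast+
  have "norm_sum d f N s = sum ?t (exceptional_norms d N \<union> square_norms d N)"
    unfolding norm_sum_def
  proof (rule sum.mono_neutral_right)
    show "\<forall>i\<in>{1..N} - (exceptional_norms d N \<union> square_norms d N). ?t i = 0"
    proof
      fix i assume "i \<in> {1..N} - (exceptional_norms d N \<union> square_norms d N)"
      hence "norm_count d i = 0" using norm_count_cases[OF assms(1,2), of i N] by blast
      thus "?t i = 0" by simp
    qed
  qed (use sub in auto)
  also have "\<dots> = sum ?t (exceptional_norms d N) + sum ?t (square_norms d N)"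
    using fin by (intro sum.union_disjoint) (auto simp: square_norms_def)
  also have "sum ?t (square_norms d N) = (\<Sum>n\<in>square_norms d N. f n * real n powr - s)"
    by (rule sum.cong) (auto simp: square_norms_def)
  finally have "norm_sum d f N s - (\<Sum>n\<in>square_norms d N. f n * real n powr - s) = sum ?t (exceptional_norms d N)"
    by simp
  also have "\<bar>\<dots>\<bar> \<le> (\<Sum>n\<in>exceptional_norms d N. \<bar>?t n\<bar>)" by (rule sum_abs)
  also have "\<dots> \<le> (\<Sum>n\<in>exceptional_norms d N. real (card {b. b dvd n}) * real n powr - s)"
  proof (rule sum_mono)
    fix n assume "n \<in> exceptional_norms d N"
    hence "n > 0" by (simp add: exceptional_norms_def)
    hence "\<bar>f n\<bar> * \<bar>norm_count d n\<bar> \<le> 1 * real (card {b. b dvd n})"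
      using sign_character_abs[OF assms(3)] abs_norm_count_le[OF d0] by (intro mult_mono) auto
    thus "\<bar>?t n\<bar> \<le> real (card {b. b dvd n}) * real n powr - s"
      by (simp add: abs_mult mult_right_mono)
  qed
  finally show ?thesis .
qed

text \<open>A sign character is nonnegative on squares, whatever the twist, and the unit ideal
  contributes 1. The bound \<open>d > 4\<close> keeps 1 out of the exceptional norms: 4 = u^2 + d
  v^2 has no solution with v >= 1.\<close>

lemma square_norms_sum_ge_1:
  assumes "squarefree d" "d > 4" "N \<ge> 1" "sign_character f"
  shows "(\<Sum>n\<in>square_norms d N. f n * real n powr - s) \<ge> 1"
proof -
  have "1 \<notin> exceptional_norms d N"
  proof
    assume "1 \<in> exceptional_norms d N"
    then obtain u v :: nat where uv: "v \<ge> 1" "4 = u^2 + d * v^2" by (auto simp: exceptional_norms_def)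
    have "d * 1 \<le> d * v^2" using uv by (intro mult_left_mono) (auto simp: Suc_le_eq)
    thus False using uv assms(2) by linarith
  qed
  moreover have "norm_count d 1 = 1"
  proof -
    have "{b. b dvd (1::nat)} = {1}" by auto
    thus ?thesis using ideal_count_coprime[of 1 "2 * d" "quad_char d"] sign_character_one[OF sign_character_quad_char]
      by simp
  qed
  moreover have "\<exists>k. (1::nat) = k^2" by (rule exI[of _ 1]) simp
  ultimately have 1: "1 \<in> square_norms d N" using assms(3) by (simp add: square_norms_def)
  have fin: "finite (square_norms d N)" by (rule finite_subset[of _ "{1..N}"]) (auto simp: square_norms_def)
  have "f n \<ge> 0" if "n \<in> square_norms d N" for n
    using that by (auto simp: square_norms_def sign_character_power[OF assms(4)])
  hence "(\<Sum>n\<in>{1}. f n * real n powr - s) \<le> (\<Sum>n\<in>square_norms d N. f n * real n powr - s)"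
    using 1 fin by (intro sum_mono2) auto
  thus ?thesis using sign_character_one[OF assms(4)] by simp
qed

text \<open>What is gained are squares between y^2 / 2 and y^2: at most \<open>y\<close> of them,
  each of weight at most 2 y^(-2s). The comparison is called for because the alternating zeta series
  couples the cutoffs y^2 and y^2 / 2.\<close>

lemma square_norms_sum_half:
  assumes "y \<ge> 1" "s \<ge> 9/10" "s \<le> 1"
  shows "(\<Sum>n\<in>square_norms d (y^2). real n powr - s) \<le>
    (\<Sum>n\<in>square_norms d (y^2 div 2). real n powr - s) + 2 * real y powr - (2/5)"
proof -
  define N where "N = y^2"
  define D where "D = square_norms d N - square_norms d (N div 2)"
  have fin: "finite (square_norms d m)" for m by (rule finite_subset[of _ "{1..m}"]) (auto simp: square_norms_def)
  have sub: "square_norms d (N div 2) \<subseteq> square_norms d N"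
    by (auto simp: square_norms_def exceptional_norms_def)
  have D: "\<exists>k\<in>{1..y}. n = k^2" "N div 2 < n" if "n \<in> D" for n
  proof -
    from that obtain k where k: "n = k^2" "1 \<le> n" "n \<le> N" by (auto simp: D_def square_norms_def)
    have "k \<le> y" using k unfolding N_def by (simp add: power2_nat_le_eq_le)
    moreover have "k \<ge> 1" using k by (auto simp: Suc_le_eq intro!: gr0I)
    ultimately show "\<exists>k\<in>{1..y}. n = k^2" using k by auto
    show "N div 2 < n" using that by (auto simp: D_def square_norms_def exceptional_norms_def)
  qed
  have "(\<Sum>n\<in>square_norms d N. real n powr - s) =
      (\<Sum>n\<in>square_norms d (N div 2). real n powr - s) + (\<Sum>n\<in>D. real n powr - s)"
    unfolding D_def by (subst sum.subset_diff[OF sub fin]) simp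
  moreover have "(\<Sum>n\<in>D. real n powr - s) \<le> 2 * real y powr - (2/5)"
  proof -
    have "real n powr - s \<le> 2 * real y powr (- 2 * s)" if "n \<in> D" for n
    proof -
      have "N < 2 * n" using D(2)[OF that] by linarith
      hence "real N < 2 * real n" by linarith
      hence "real n powr - s \<le> (real N / 2) powr - s"
        using assms by (intro powr_mono2') (auto simp: N_def)
      also have "\<dots> = 2 powr s * (real y ^ 2) powr - s"
        by (simp add: powr_divide powr_minus divide_simps N_def)
      also have "(real y ^ 2) powr - s = real y powr (- 2 * s)"
        using assms(1) powr_powr[of "real y" 2 "- s"] by simp
      also have "2 powr s * real y powr (- 2 * s) \<le> 2 * real y powr (- 2 * s)"
        using assms(3) powr_mono[of s 1 "2::real"] by (intro mult_right_mono) auto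
      finally show ?thesis .
    qed
    hence "(\<Sum>n\<in>D. real n powr - s) \<le> real (card D) * (2 * real y powr (- 2 * s))"
      by (rule sum_bounded_above)
    also have "card D \<le> y"
    proof -
      have "D \<subseteq> (\<lambda>k. k^2) ` {1..y}" using D(1) by blast
      hence "card D \<le> card ((\<lambda>k. k^2) ` {1..y})" by (intro card_mono) auto
      also have "\<dots> \<le> y" using card_image_le[of "{1..y}" "\<lambda>k. k^2"] by simp
      finally show ?thesis .
    qed
    hence "real (card D) * (2 * real y powr (- 2 * s)) \<le> real y * (2 * real y powr (- 2 * s))"
      by (intro mult_right_mono) auto
    also have "\<dots> = 2 * (real y powr 1 * real y powr (- 2 * s))" by simp
    also have "\<dots> = 2 * real y powr (1 - 2 * s)" unfolding powr_add[symmetric] by simp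
    also have "\<dots> \<le> 2 * real y powr - (2/5)" using assms by (intro mult_left_mono powr_mono) auto
    finally show ?thesis by simp
  qed
  ultimately show ?thesis unfolding N_def by linarith
qed

text \<open>The parameter \<open>c\<close> is \<open>2\<close> for the trivial character, to cancel the pole of the zeta function, and \<open>0\<close> otherwise.\<close>

lemma norm_sum_dseries:
  assumes d: "d > 0" and f: "sign_character f" and c: "0 \<le> c" "c \<le> 2"
    and A: "bounded_sums (\<lambda>n. f n - c * dilate 2 f n) A" "A \<ge> 1"
    and B: "bounded_sums (\<lambda>n. f n * quad_char d n) B" "B \<ge> 1"
    and s: "s \<ge> 9/10" and y: "y \<ge> 1"
  shows "\<bar>norm_sum d f (y^2) s - c * 2 powr - s * norm_sum d f (y^2 div 2) s -
     (\<Prod>p\<in>prime_divs (2 * d). 1 - f p * real p powr - s) *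
     dseries (\<lambda>n. f n - c * dilate 2 f n) s * dseries (\<lambda>n. f n * quad_char d n) s\<bar>
    \<le> 28 * real d * A * B * real y powr - (2/5)"
proof -
  define P where "P = prime_divs (2 * d)"
  define g where "g n = f n * quad_char d n" for n
  define h where "h n = sieve P f n - c * dilate 2 (sieve P f) n" for n
  have P: "finite P" "\<And>q. q \<in> P \<Longrightarrow> prime q" "2 ^ card P \<le> 2 * d"
    using finite_prime_divs[of "2 * d"] two_power_card_prime_divs_le[of "2 * d"] d
    by (auto simp: P_def prime_divs_def)
  have s0: "s > 0" using s by simp
  note sv = sieve_dseries[OF f P(1,2) A(1) s0]
  have hb: "bounded_sums h (2 ^ card P * A)" using sv unfolding h_def by blast
  have "1 * 1 \<le> 2 ^ card P * A" using A(2) by (intro mult_mono) auto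
  hence A1: "2 ^ card P * A \<ge> 1" by simp
  have sb: "\<bar>sieve P f n\<bar> \<le> 1" for n using sign_character_abs[OF f, of n] by (simp add: sieve_def)
  have db: "\<bar>dilate 2 (sieve P f) n\<bar> \<le> 1" for n using sb[of "n div 2"] by (simp add: dilate_def)
  \<comment> \<open>This 1 + 2, with \<open>c \<le> 2\<close>, is the origin of the bound 3 in
    \<open>dseries_product_approx\<close>.\<close>
  have h3: "\<bar>h n\<bar> \<le> 3" for n
  proof -
    have "\<bar>c * dilate 2 (sieve P f) n\<bar> \<le> 2 * 1"
      unfolding abs_mult using c db by (intro mult_mono) auto
    thus ?thesis using sb[of n] unfolding h_def by linarith
  qed
  have g1: "\<bar>g n\<bar> \<le> 1" for n
    using sign_character_abs[OF f, of n] sign_character_abs[OF sign_character_quad_char, of d n]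
    unfolding g_def abs_mult by (simp add: mult_le_one)
  have B': "bounded_sums g B" using B(1) unfolding g_def .
  have approx: "\<bar>(\<Sum>n=1..y^2. dconv h g n * real n powr - s) - dseries h s * dseries g s\<bar>
    \<le> 14 * (2 ^ card P * A) * B * real y powr - (2/5)"
    by (rule dseries_product_approx[OF hb A1 h3 B' B(2) g1 s y])
  have "dconv h g n = f n * norm_count d n - c * dilate 2 (\<lambda>n. f n * norm_count d n) n" if "n > 0" for n
  proof -
    have eq: "dconv (sieve P f) g m = f m * norm_count d m" if "m > 0" for m
      using dconv_sieve[OF f that, of P "quad_char d"] unfolding g_def P_def .
    have "dilate 2 (dconv (sieve P f) g) n = dilate 2 (\<lambda>n. f n * norm_count d n) n"
      using that eq[of "n div 2"] by (auto simp: dilate_def elim!: evenE)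
    thus ?thesis using dconv_diff_dilate[OF that, of "sieve P f" c g] eq[OF that] unfolding h_def by simp
  qed
  hence "(\<Sum>n=1..y^2. dconv h g n * real n powr - s) =
    (\<Sum>n=1..y^2. f n * norm_count d n * real n powr - s - c * (dilate 2 (\<lambda>n. f n * norm_count d n) n * real n powr - s))"
    by (intro sum.cong) (simp_all add: left_diff_distrib mult.assoc)
  also have "\<dots> = norm_sum d f (y^2) s - c * (\<Sum>n=1..y^2. dilate 2 (\<lambda>n. f n * norm_count d n) n * real n powr - s)"
    by (simp add: norm_sum_def sum_subtractf sum_distrib_left)
  also have "(\<Sum>n=1..y^2. dilate 2 (\<lambda>n. f n * norm_count d n) n * real n powr - s) =
      (\<Sum>m=1..y^2 div 2. f m * norm_count d m * real (2 * m) powr - s)"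
    by (rule sum_dilate) simp
  also have "\<dots> = 2 powr - s * norm_sum d f (y^2 div 2) s"
    by (simp add: norm_sum_def sum_distrib_left powr_mult mult_ac)
  finally have S: "(\<Sum>n=1..y^2. dconv h g n * real n powr - s) =
     norm_sum d f (y^2) s - c * 2 powr - s * norm_sum d f (y^2 div 2) s" by simp
  have Hs: "dseries h s = (\<Prod>p\<in>P. 1 - f p * real p powr - s) * dseries (\<lambda>n. f n - c * dilate 2 f n) s"
    using sv unfolding h_def by blast
  \<comment> \<open>Here the doublings from sieving become \<open>2 * d\<close>, and 14 becomes 28
    d.\<close>
  have "real (2 ^ card P) \<le> real (2 * d)" using P(3) by (simp only: of_nat_le_iff)
  hence "2 ^ card P \<le> 2 * real d" by simp
  hence "2 ^ card P * (14 * A * B * real y powr - (2/5)) \<le> 2 * real d * (14 * A * B * real y powr - (2/5))"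
    using A B by (intro mult_right_mono) auto
  hence "14 * (2 ^ card P * A) * B * real y powr - (2/5) \<le> 28 * real d * A * B * real y powr - (2/5)"
    by (simp add: mult_ac)
  from order_trans[OF approx this] show ?thesis unfolding S Hs g_def P_def .
qed

lemma bounded_sums_alternating: "bounded_sums (\<lambda>n. 1 - 2 * dilate 2 (\<lambda>_. 1) n) 1"
  unfolding bounded_sums_def
proof
  fix n
  have "(\<Sum>k=1..n. 1 - 2 * dilate 2 (\<lambda>_. 1) k) = (if even n then 0 else 1 :: real)"
    by (induction n) (auto simp: dilate_def)
  thus "\<bar>\<Sum>k=1..n. 1 - 2 * dilate 2 (\<lambda>_. 1) k\<bar> \<le> 1" by simp
qed

text \<open>Consecutive terms pair up to nonnegative numbers and the first pair is 1 - 2^(-s), so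
  partial sums at even cutoffs stay above it; the tail bound carries this to the limit.\<close>

lemma dseries_alternating_pos:
  assumes "s > 0" shows "dseries (\<lambda>n. 1 - 2 * dilate 2 (\<lambda>_. 1) n) s > 0"
proof -
  let ?e = "\<lambda>n. 1 - 2 * dilate 2 (\<lambda>_. 1) n :: real"
  have ge: "(\<Sum>k=1..2 * Suc m. ?e k * real k powr - s) \<ge> 1 - 2 powr - s" for m
  proof (induction m)
    case 0
    have "{1..2 * Suc 0} = {1, 2}" by auto
    thus ?case by (simp add: dilate_def)
  next
    case (Suc m)
    have "real (2 * Suc m + 2) powr - s \<le> real (2 * Suc m + 1) powr - s"
      using assms by (intro powr_mono2') auto
    moreover have "(\<Sum>k=1..2 * Suc (Suc m). ?e k * real k powr - s) = (\<Sum>k=1..2 * Suc m. ?e k * real k powr - s)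
       + ?e (2 * Suc m + 1) * real (2 * Suc m + 1) powr - s + ?e (2 * Suc m + 2) * real (2 * Suc m + 2) powr - s"
      by (simp add: sum.cl_ivl_Suc)
    moreover have "?e (2 * Suc m + 1) = 1" "?e (2 * Suc m + 2) = -1" by (auto simp: dilate_def)
    ultimately show ?case using Suc by simp
  qed
  have lim: "(\<lambda>m. 2 * 1 * real (Suc (2 * Suc m)) powr - s) \<longlonglongrightarrow> 2 * 1 * 0"
  proof (intro tendsto_mult tendsto_const)
    have "filterlim (\<lambda>m. 2 * Suc m) sequentially sequentially"
      by (rule filterlim_subseq) (simp add: strict_mono_def)
    thus "(\<lambda>m. real (Suc (2 * Suc m)) powr - s) \<longlonglongrightarrow> 0"
      using filterlim_compose[OF powr_neg_Suc_tendsto_0[OF assms]] by blast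
  qed
  have "1 - 2 powr - s - 2 * 1 * real (Suc (2 * Suc m)) powr - s \<le> dseries ?e s" for m
    using dseries_tail[OF bounded_sums_alternating assms, of "2 * Suc m"] ge[of m] by linarith
  moreover have "(\<lambda>m. 1 - 2 powr - s - 2 * 1 * real (Suc (2 * Suc m)) powr - s) \<longlonglongrightarrow> 1 - 2 powr - s - 2 * 1 * 0"
    by (intro tendsto_diff tendsto_const lim)
  ultimately have "1 - 2 powr - s - 2 * 1 * 0 \<le> dseries ?e s"
    by (intro LIMSEQ_le_const2) auto
  moreover have "2 powr - s < 2 powr (0::real)" using assms by (intro powr_less_mono) auto
  ultimately show ?thesis by simp
qed

lemma quad_char_bounded_sums:
  assumes "squarefree d" "d > 2" shows "bounded_sums (quad_char d) (8 * real d)"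
proof -
  have "\<not> d dvd 2 * 1" using assms by (auto dest: dvd_imp_le)
  then obtain n where n: "quad_char d n = -1"
    using quad_char_minus_one_exists[OF assms(1), of 1] by auto
  have "coprime n (2 * d)" using quad_char_eq_0_iff[of d n] assms n by simp
  hence "coprime n (2 ^ 3 * d)" by (simp only: coprime_mult_right_iff coprime_power_right_iff) simp
  hence "coprime n (8 * d)" by simp
  thus ?thesis using bounded_sums_periodic_sign_character[OF sign_character_quad_char, of "8 * d" d n]
      quad_char_periodic assms n by simp
qed

lemma sign_character_times:
  assumes "sign_character f" "sign_character g"
  shows "sign_character (\<lambda>n. f n * g n)"
  unfolding sign_character_def
proof (intro conjI allI)
  show "f n * g n \<in> {-1, 0, 1}" for n
    using sign_character_cases[OF assms(1), of n] sign_character_cases[OF assms(2), of n] by auto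
qed (use assms in \<open>auto simp: sign_character_def\<close>)

text \<open>As \<open>d' > 2 * d\<close>, the number d' does not divide 2 d. Some \<open>n\<close>
  congruent to 1 modulo 8 d then has value 1 under the first character and -1 under the second, so
  the product is nontrivial; 64 d d' is a common period.\<close>

lemma quad_char_prod_bounded_sums:
  assumes "squarefree d" "squarefree d'" "d > 2" "d' > 2 * d"
  shows "bounded_sums (\<lambda>n. quad_char d n * quad_char d' n) (64 * real d * real d')"
proof -
  have d0: "d > 0" "d' > 0" using assms by auto
  have "\<not> d' dvd 2 * d" using assms by (auto dest: dvd_imp_le)
  then obtain n where n: "[n = 1] (mod 8 * d)" "quad_char d' n = -1"
    using quad_char_minus_one_exists[OF assms(2) _ d0(1)] by blast
  have "coprime n (8 * d)" using n(1) by (metis cong_imp_coprime cong_sym coprime_1_left)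
  hence c1: "coprime n 8" "coprime n d" by (simp_all add: coprime_mult_right_iff)
  have "coprime n (2 * d')" using quad_char_eq_0_iff[OF d0(2), of n] n by simp
  hence c2: "coprime n d'" by simp
  have cop: "coprime n (8 * d * (8 * d'))" using c1 c2 by (simp only: coprime_mult_right_iff)
  have "n = 1 + 8 * d * ((n - 1) div (8 * d))"
  proof -
    have "n \<ge> 1" using c1(1) by (auto intro!: gr0I simp: Suc_le_eq)
    hence "8 * d dvd n - 1" using n(1) by (simp add: cong_altdef_nat cong_sym_eq)
    thus ?thesis using \<open>n \<ge> 1\<close> by simp
  qed
  hence "quad_char d n = quad_char d 1"
    using quad_char_periodic[of d 1 "(n - 1) div (8 * d)"] by simp
  hence "quad_char d n = 1" using sign_character_one[OF sign_character_quad_char, of d] by simp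
  hence m1: "quad_char d n * quad_char d' n = -1" using n by simp
  have "sign_character (\<lambda>n. quad_char d n * quad_char d' n)"
    by (intro sign_character_times sign_character_quad_char)
  moreover have "quad_char d (m + 8 * d * (8 * d') * k) * quad_char d' (m + 8 * d * (8 * d') * k) =
      quad_char d m * quad_char d' m" for m k
    using quad_char_periodic[of d m "8 * d' * k"] quad_char_periodic[of d' m "8 * d * k"]
    by (simp add: mult_ac)
  ultimately have "bounded_sums (\<lambda>n. quad_char d n * quad_char d' n) (real (8 * d * (8 * d')))"
    using bounded_sums_periodic_sign_character[of "\<lambda>n. quad_char d n * quad_char d' n" "8 * d * (8 * d')" n]
      cop m1 d0 by simp
  thus ?thesis by (simp add: mult.assoc)
qed

section \<open>Finiteness\<close>

text \<open>Convolving with the alternating series removes the pole of the zeta function. It turns the sum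
  over squares into at most \<open>1 - 2\<^bsup>1 - s\<^esup> < 0\<close>, up to a small error.\<close>

lemma dseries_neg_if_squares_represented:
  obtains D where "\<And>d. d \<ge> D \<Longrightarrow> squarefree d \<Longrightarrow> squares_represented d \<Longrightarrow> dseries (quad_char d) (199/200) < 0"
proof -
  define s :: real where "s = 199/200"
  obtain K where K: "K \<ge> 0" "\<And>d N s. d > 0 \<Longrightarrow> N \<ge> 1 \<Longrightarrow> N \<le> d^12 \<Longrightarrow> s \<ge> 199/200 \<Longrightarrow>
    (\<Sum>n\<in>exceptional_norms d N. real (card {b. b dvd n}) * real n powr - s) \<le> K * real d powr - (1/5)"
    using exceptional_norms_sum_bound by blast
  have gap: "2 powr (1 - s) > 1" unfolding s_def by (rule gr_one_powr) auto
  \<comment> \<open>The error budget: exceptional norms enter with weight 1 at the cutoff y^2 and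
    2^(1-s) <= 2 at half of it, hence 3 K. The 226 is 28 * 8 from the product approximation plus 2
    from the squares between the cutoffs.\<close>
  have "((\<lambda>x. 3 * K * x powr - (1/5) + 226 * x powr - (2/5)) \<longlongrightarrow> 3 * K * 0 + 226 * 0) at_top"
    by (intro tendsto_intros tendsto_neg_powr filterlim_ident) auto
  hence "\<forall>\<^sub>F x in at_top. 3 * K * x powr - (1/5) + 226 * x powr - (2/5) < 2 powr (1 - s) - 1"
    using gap by (intro order_tendstoD) auto
  then obtain x0 :: real where x0: "\<And>x. x \<ge> x0 \<Longrightarrow> 3 * K * x powr - (1/5) + 226 * x powr - (2/5) < 2 powr (1 - s) - 1"
    by (auto simp: eventually_at_top_linorder)
  define D where "D = max 5 (nat \<lceil>x0\<rceil>)"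
  have "dseries (quad_char d) s < 0" if dD: "d \<ge> D" and sf: "squarefree d" and sr: "squares_represented d" for d
  proof -
    have d: "d \<ge> 5" "real d \<ge> x0" "d > 0" using dD unfolding D_def by linarith+
    \<comment> \<open>Then y^2 = d^12 is the largest cutoff at which exceptional norms are
      controlled, and y^(-2/5) = d^(-12/5) beats the d^2 from the modulus and the sieve.\<close>
    define y where "y = d ^ 6"
    define f :: "nat \<Rightarrow> real" where "f = (\<lambda>_. 1)"
    have f: "sign_character f" by (simp add: sign_character_def f_def)
    have y: "y \<ge> 1" "y^2 \<le> d^12" "y^2 \<ge> 1" "y \<ge> d"
      using d self_le_power[of d 6] by (auto simp: y_def Suc_le_eq simp flip: power_mult)
    have "2 * 1 \<le> y * y" using y(4) d(1) by (intro mult_mono) auto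
    hence N2: "y^2 div 2 \<ge> 1" by (simp add: power2_eq_square)
    define Q where "Q N = (\<Sum>n\<in>square_norms d N. f n * real n powr - s)" for N
    have err: "\<bar>norm_sum d f N s - Q N\<bar> \<le> K * real d powr - (1/5)" if "N \<ge> 1" "N \<le> y^2" for N
      using norm_sum_approx[OF sf sr f, of N s] K(2)[OF d(3) that(1), of s] that(2) y(2)
      unfolding Q_def s_def by linarith
    have Q1: "Q (y^2 div 2) \<ge> 1" unfolding Q_def
      by (rule square_norms_sum_ge_1[OF sf _ N2 f]) (use d in simp)
    have Qd: "Q (y^2) \<le> Q (y^2 div 2) + 2 * real y powr - (2/5)"
      using square_norms_sum_half[OF y(1), of s d] unfolding Q_def f_def s_def by simp
    have bA: "bounded_sums (\<lambda>n. f n - 2 * dilate 2 f n) 1"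
      using bounded_sums_alternating unfolding f_def .
    have bB: "bounded_sums (\<lambda>n. f n * quad_char d n) (8 * real d)"
      using quad_char_bounded_sums[OF sf] d unfolding f_def by simp
    define F where "F = (\<Prod>p\<in>prime_divs (2 * d). 1 - f p * real p powr - s) * dseries (\<lambda>n. f n - 2 * dilate 2 f n) s"
    have y25: "real y powr - (2/5) = real d powr - (12/5)"
      using d powr_powr[of "real d" 6 "- (2/5)"] by (simp add: y_def)
    have "\<bar>norm_sum d f (y^2) s - 2 * 2 powr - s * norm_sum d f (y^2 div 2) s - F * dseries (quad_char d) s\<bar>
      \<le> 28 * real d * 1 * (8 * real d) * real y powr - (2/5)"
      using norm_sum_dseries[OF d(3) f _ _ bA _ bB _ _ y(1), of s] d unfolding F_def s_def
      by (simp add: f_def)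
    also have "\<dots> = 224 * (real d powr 2 * real d powr - (12/5))"
      using d unfolding y25 by (simp add: power2_eq_square)
    also have "real d powr 2 * real d powr - (12/5) = real d powr - (2/5)" by (simp only: powr_add[symmetric]) simp
    finally have FG: "F * dseries (quad_char d) s \<le> norm_sum d f (y^2) s - 2 * 2 powr - s * norm_sum d f (y^2 div 2) s
        + 224 * real d powr - (2/5)" by linarith
    have p2: "2 * 2 powr - s = 2 powr (1 - s)" using powr_add[of 2 1 "- s"] by simp
    have p2': "2 powr (1 - s) \<le> 2" using powr_mono[of "1 - s" 1 "2::real"] by (simp add: s_def)
    define k where "k = K * real d powr - (1/5)"
    have k0: "k \<ge> 0" using K(1) by (simp add: k_def)
    have e1: "norm_sum d f (y^2) s \<le> Q (y^2) + k" using err[of "y^2"] y(3) unfolding k_def by linarith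
    have "Q (y^2 div 2) - k \<le> norm_sum d f (y^2 div 2) s" using err[of "y^2 div 2"] N2 unfolding k_def by linarith
    hence e2: "2 powr (1 - s) * (Q (y^2 div 2) - k) \<le> 2 powr (1 - s) * norm_sum d f (y^2 div 2) s"
      by (intro mult_left_mono) auto
    have e3: "2 powr (1 - s) * k \<le> 2 * k" using p2' k0 by (intro mult_right_mono)
    have e4: "(2 powr (1 - s) - 1) * 1 \<le> (2 powr (1 - s) - 1) * Q (y^2 div 2)"
      using gap Q1 by (intro mult_left_mono) auto
    have yd: "real y powr - (2/5) \<le> real d powr - (2/5)" unfolding y25 using d by (intro powr_mono) auto
    have "F * dseries (quad_char d) s \<le> - (2 powr (1 - s) - 1) + (3 * k + 226 * real d powr - (2/5))"
      using FG e1 e2 e3 e4 Qd yd unfolding p2 by (simp add: algebra_simps)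
    also have "\<dots> < 0" using x0[OF d(2)] unfolding k_def by simp
    finally have neg: "F * dseries (quad_char d) s < 0" .
    have "F > 0" unfolding F_def
    proof (rule mult_pos_pos)
      show "(\<Prod>p\<in>prime_divs (2 * d). 1 - f p * real p powr - s) > 0"
      proof (rule prod_pos)
        fix p assume "p \<in> prime_divs (2 * d)"
        hence "real p > 1" using prime_gt_1_nat by (auto simp: prime_divs_def)
        hence "real p powr - s < real p powr 0" by (intro powr_less_mono) (auto simp: s_def)
        thus "1 - f p * real p powr - s > 0" using \<open>real p > 1\<close> by (simp add: f_def)
      qed
      show "dseries (\<lambda>n. f n - 2 * dilate 2 f n) s > 0"
        using dseries_alternating_pos[of s] unfolding f_def s_def by simp
    qed
    thus ?thesis using neg by (simp add: mult_less_0_iff)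
  qed
  thus ?thesis using that unfolding s_def by blast
qed

lemma sum_inverse_squares_le: "(\<Sum>k=2..n. real k powr - 2) \<le> 1"
proof -
  have "(\<Sum>k=2..n. real k powr - 2) \<le> 1 - 1 / real n" if "n \<ge> 1" for n
    using that
  proof (induction n rule: dec_induct)
    case (step n)
    have "real (Suc n) powr - 2 = 1 / (real (Suc n))^2" by (simp add: powr_minus divide_inverse)
    also have "\<dots> \<le> 1 / (real n * real (Suc n))"
      using step by (intro divide_left_mono) (auto simp: power2_eq_square)
    also have "\<dots> = 1 / real n - 1 / real (Suc n)" using step by (simp add: field_simps)
    finally show ?case using step by (simp add: sum.cl_ivl_Suc)
  qed simp
  from this[of n] show ?thesis
  proof (cases "n \<ge> 1")
    case True
    have "1 - 1 / real n \<le> 1" by simp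
    thus ?thesis using True \<open>n \<ge> 1 \<Longrightarrow> _\<close> by linarith
  qed simp
qed

text \<open>The leading term 1 outweighs the others, because the sum of k^(-2) over k >= 2 is at
  most 1. This supplies the right end of the interval on which the series changes sign.\<close>

lemma dseries_at_2_nonneg:
  assumes "sign_character f" "bounded_sums f A" shows "dseries f 2 \<ge> 0"
proof -
  have ge: "(\<Sum>k=1..n. f k * real k powr - 2) \<ge> 0" if "n \<ge> 1" for n
  proof -
    have "(\<Sum>k=1..n. f k * real k powr - 2) = 1 + (\<Sum>k=2..n. f k * real k powr - 2)"
      using that sign_character_one[OF assms(1)] by (simp add: sum.atLeast_Suc_atMost numeral_2_eq_2)
    moreover have "\<bar>\<Sum>k=2..n. f k * real k powr - 2\<bar> \<le> (\<Sum>k=2..n. \<bar>f k * real k powr - 2\<bar>)" by (rule sum_abs)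
    moreover have "(\<Sum>k=2..n. \<bar>f k * real k powr - 2\<bar>) \<le> (\<Sum>k=2..n. 1 * real k powr - 2)"
      unfolding abs_mult using sign_character_abs[OF assms(1)] by (intro sum_mono mult_mono) auto
    ultimately show ?thesis using sum_inverse_squares_le[of n] unfolding mult_1 by linarith
  qed
  have lim: "(\<lambda>n. - (2 * A * real (Suc n) powr - 2)) \<longlonglongrightarrow> - (2 * A * 0)"
    by (intro tendsto_intros powr_neg_Suc_tendsto_0) simp
  have "- (2 * A * real (Suc n) powr - 2) \<le> dseries f 2" if "n \<ge> 1" for n
    using dseries_tail[OF assms(2), of 2 n] ge[OF that] by linarith
  hence "- (2 * A * 0) \<le> dseries f 2" using LIMSEQ_le_const2[OF lim] by blast
  thus ?thesis by simp
qed

theorem finite_squares_represented: "finite {d. squarefree d \<and> squares_represented d}"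
proof (rule ccontr)
  assume inf: "infinite {d. squarefree d \<and> squares_represented d}"
  have ex: "\<exists>d\<ge>m. squarefree d \<and> squares_represented d" for m
    using inf unfolding infinite_nat_iff_unbounded_le by auto
  obtain D where D: "\<And>d. d \<ge> D \<Longrightarrow> squarefree d \<Longrightarrow> squares_represented d \<Longrightarrow> dseries (quad_char d) (199/200) < 0"
    using dseries_neg_if_squares_represented by blast
  \<comment> \<open>\<open>e\<close> and its zero are fixed first; \<open>L\<close>, the threshold
    \<open>x0\<close> and hence \<open>d\<close> depend on \<open>e\<close>.\<close>
  obtain e where e: "e \<ge> max D 5" "squarefree e" "squares_represented e" using ex by blast
  have e5: "e \<ge> 5" "e > 2" "e > 0" using e by auto
  define f where "f = quad_char e"
  have f: "sign_character f" unfolding f_def by (rule sign_character_quad_char)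
  have fb: "bounded_sums f (8 * real e)" unfolding f_def by (rule quad_char_bounded_sums[OF e(2) e5(2)])
  have neg: "dseries f (199/200) < 0" using D e unfolding f_def by auto
  have "continuous_on {199/200..2} (dseries f)"
    by (rule continuous_on_subset[OF dseries_continuous[OF fb, of "199/200"]]) auto
  then obtain \<beta> where \<beta>: "199/200 \<le> \<beta>" "\<beta> \<le> 2" "dseries f \<beta> = 0"
    using IVT'[of "dseries f" "199/200" 0 2] neg dseries_at_2_nonneg[OF f fb] by auto
  obtain K where K: "K \<ge> 0" "\<And>d N s. d > 0 \<Longrightarrow> N \<ge> 1 \<Longrightarrow> N \<le> d^12 \<Longrightarrow> s \<ge> 199/200 \<Longrightarrow>
    (\<Sum>n\<in>exceptional_norms d N. real (card {b. b dvd n}) * real n powr - s) \<le> K * real d powr - (1/5)"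
    using exceptional_norms_sum_bound by blast
  \<comment> \<open>The product approximation has the bounds A = 8 e and B = 64 e d; the factors
    depending on \<open>d\<close> are left out of \<open>L\<close>.\<close>
  define L where "L = 28 * (8 * real e) * (64 * real e)"
  have "((\<lambda>x. K * x powr - (1/5) + L * x powr - (2/5)) \<longlongrightarrow> K * 0 + L * 0) at_top"
    by (intro tendsto_intros tendsto_neg_powr filterlim_ident) auto
  hence "\<forall>\<^sub>F x in at_top. K * x powr - (1/5) + L * x powr - (2/5) < 1"
    by (intro order_tendstoD) auto
  then obtain x0 :: real where x0: "\<And>x. x \<ge> x0 \<Longrightarrow> K * x powr - (1/5) + L * x powr - (2/5) < 1"
    by (auto simp: eventually_at_top_linorder)
  obtain d where d: "d \<ge> max (2 * e + 1) (nat \<lceil>x0\<rceil>)" "squarefree d" "squares_represented d" using ex by blast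
  have d': "real d \<ge> x0" "d > 2 * e" "d > 4" "d > 0" using d(1) e5 by linarith+
  define y where "y = d ^ 6"
  have y: "y \<ge> 1" "y^2 \<le> d^12" "y^2 \<ge> 1" using d' by (auto simp: y_def Suc_le_eq simp flip: power_mult)
  have y25: "real y powr - (2/5) = real d powr - (12/5)"
    using d' powr_powr[of "real d" 6 "- (2/5)"] by (simp add: y_def)
  \<comment> \<open>The nontrivial character \<open>f\<close> has bounded sums by itself, so the
    parameter \<open>c\<close> is 0 and no second cutoff arises.\<close>
  have bA: "bounded_sums (\<lambda>n. f n - 0 * dilate 2 f n) (8 * real e)" using fb by simp
  have bB: "bounded_sums (\<lambda>n. f n * quad_char d n) (64 * real e * real d)"
    unfolding f_def by (rule quad_char_prod_bounded_sums[OF e(2) d(2) e5(2) d'(2)])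
  have B1: "64 * real e * real d \<ge> 1"
  proof -
    have "1 * 1 \<le> (64 * real e) * real d" using e5 d' by (intro mult_mono) auto
    thus ?thesis by simp
  qed
  \<comment> \<open>The zero annihilates the product of the two series whatever the second one is;
    only the hyperbola error remains of the twisted sum.\<close>
  have "dseries (\<lambda>n. f n - 0 * dilate 2 f n) \<beta> = 0" using \<beta>(3) by simp
  hence "\<bar>norm_sum d f (y^2) \<beta>\<bar> \<le> 28 * real d * (8 * real e) * (64 * real e * real d) * real y powr - (2/5)"
    using norm_sum_dseries[OF d'(4) f _ _ bA _ bB B1 _ y(1), of \<beta>] e5 \<beta>(1) by simp
  also have "\<dots> = L * (real d powr 2 * real d powr - (12/5))"
    using d' unfolding y25 L_def by (simp add: power2_eq_square)
  also have "real d powr 2 * real d powr - (12/5) = real d powr - (2/5)" by (simp only: powr_add[symmetric]) simp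
  finally have upper: "\<bar>norm_sum d f (y^2) \<beta>\<bar> \<le> L * real d powr - (2/5)" .
  have "\<bar>norm_sum d f (y^2) \<beta> - (\<Sum>n\<in>square_norms d (y^2). f n * real n powr - \<beta>)\<bar> \<le> K * real d powr - (1/5)"
    using norm_sum_approx[OF d(2,3) f, of "y^2" \<beta>] K(2)[OF d'(4) y(3,2) \<beta>(1)] by linarith
  moreover have "(\<Sum>n\<in>square_norms d (y^2). f n * real n powr - \<beta>) \<ge> 1"
    by (rule square_norms_sum_ge_1[OF d(2) d'(3) y(3) f])
  ultimately have "1 \<le> K * real d powr - (1/5) + L * real d powr - (2/5)" using upper by linarith
  thus False using x0[OF d'(1)] by linarith
qed

section \<open>Imaginary quadratic fields\<close>

definition quadratic_field :: "nat \<Rightarrow> complex set"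
  where "quadratic_field d = {Complex a (b * sqrt (real d)) | a b. a \<in> \<rat> \<and> b \<in> \<rat>}"

lemma quadratic_fieldE:
  assumes "x \<in> quadratic_field d"
  obtains a b where "a \<in> \<rat>" "b \<in> \<rat>" "x = Complex a (b * sqrt (real d))"
  using assms unfolding quadratic_field_def by auto

lemma quadratic_fieldI: "a \<in> \<rat> \<Longrightarrow> b \<in> \<rat> \<Longrightarrow> Complex a (b * sqrt (real d)) \<in> quadratic_field d"
  unfolding quadratic_field_def by auto

lemma ring_complex_ring: "ring complex_ring"
  by (rule ring_from_type_algebra)

lemma complex_ring_simps [simp]:
  "carrier complex_ring = UNIV" "x \<otimes>\<^bsub>complex_ring\<^esub> y = x * y" "x \<oplus>\<^bsub>complex_ring\<^esub> y = x + y"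
  "\<zero>\<^bsub>complex_ring\<^esub> = 0" "\<one>\<^bsub>complex_ring\<^esub> = 1"
  by (simp_all add: ring_of_type_algebra_def)

lemma complex_ring_minus: "\<ominus>\<^bsub>complex_ring\<^esub> x = - x"
  using abelian_group.minus_equality[OF ring.is_abelian_group[OF ring_complex_ring], of "- x" x] by simp

lemma line_extension_complex_ring:
  "ring.line_extension complex_ring F v E = {q * v + e | q e. q \<in> F \<and> e \<in> E}"
  unfolding ring.line_extension_def[OF ring_complex_ring] set_add_def set_mult_def r_coset_def by auto

text \<open>Unfolding the inductive dimension twice yields a spanning pair. Linear independence over
  the rationals reappears later as a nonzero determinant.\<close>

lemma dimension_2_complex_ring:
  assumes "ring.dimension complex_ring 2 F E"
  obtains u v where "E = {a * u + b * v | a b. a \<in> F \<and> b \<in> F}"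
proof -
  from assms obtain v E1 where E1: "E = ring.line_extension complex_ring F v E1" "ring.dimension complex_ring 1 F E1"
    by (cases rule: ring.dimension.cases[OF ring_complex_ring]) auto
  from E1(2) obtain u E0 where E0: "E1 = ring.line_extension complex_ring F u E0" "ring.dimension complex_ring 0 F E0"
    by (cases rule: ring.dimension.cases[OF ring_complex_ring]) auto
  from E0(2) have "E0 = {0}"
    by (cases rule: ring.dimension.cases[OF ring_complex_ring]) auto
  hence "E = {a * v + b * u | a b. a \<in> F \<and> b \<in> F}"
    unfolding E1(1) E0(1) line_extension_complex_ring by auto
  thus ?thesis using that by blast
qed

lemma Rats_complexE:
  assumes "q \<in> (\<rat> :: complex set)" obtains r where "r \<in> \<rat>" "q = complex_of_real r"
proof -
  obtain a b :: int where "q = of_int a / of_int b" using assms by (auto elim!: Rats_cases')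
  hence "q = complex_of_real (of_int a / of_int b)" by simp
  thus ?thesis using that[of "of_int a / of_int b"] by auto
qed

lemma Im_of_Rats: "q \<in> \<rat> \<Longrightarrow> Im q = 0"
  by (erule Rats_complexE) simp

lemma of_real_in_Rats: "r \<in> \<rat> \<Longrightarrow> complex_of_real r \<in> \<rat>"
  by (auto elim!: Rats_cases)

lemma number_field_Rats_subset:
  assumes "subfield K complex_ring" shows "\<rat> \<subseteq> K"
proof -
  note sr = subringE[OF subfieldE(1)[OF assms]]
  have neg: "- x \<in> K" if "x \<in> K" for x
    using sr(5)[OF that] by (simp add: complex_ring_minus)
  have nat: "of_nat n \<in> K" for n
    using sr(2,3,7) by (induction n) auto
  have int: "of_int z \<in> K" for z
    using nat[of "nat z"] neg[OF nat[of "nat (- z)"]] by (cases "z \<ge> 0") auto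
  have inverse: "inverse x \<in> K" if "x \<in> K" "x \<noteq> 0" for x
  proof -
    have "x \<in> K - {\<zero>\<^bsub>complex_ring\<^esub>}" using that by simp
    note si = ring.subfield_m_inv[OF ring_complex_ring assms this]
    have "inv\<^bsub>complex_ring\<^esub> x * x = 1" using si(3) by simp
    hence "inv\<^bsub>complex_ring\<^esub> x = inverse x" using inverse_unique by (metis mult.commute)
    thus ?thesis using si(1) by simp
  qed
  show ?thesis
  proof
    fix q :: complex assume "q \<in> \<rat>"
    then obtain a b where ab: "b > 0" "q = of_int a / of_int b" by (auto elim!: Rats_cases')
    have "of_int a * inverse (of_int b) \<in> K"
      using sr(6)[OF int[of a] inverse[OF int[of b]]] ab by simp
    thus "q \<in> K" using ab by (simp add: divide_inverse)
  qed
qed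

lemma Re_zero_if_square_rational:
  assumes "z^2 \<in> \<rat>" "Im z \<noteq> 0" shows "Re z = 0"
proof -
  have "Im (z^2) = 0" using assms(1) by (rule Im_of_Rats)
  thus ?thesis using assms(2) by (simp add: power2_eq_square)
qed

text \<open>A nonreal \<open>x\<close> in the field forms a basis with 1. Completing the square in
  the quadratic equation of \<open>x\<close> gives a nonreal \<open>z\<close> with rational square,
  hence purely imaginary, and the squarefree part of the cleared -z^2 is \<open>d\<close>.\<close>

lemma imaginary_quadratic_field_eq_quadratic_field:
  assumes "imaginary_quadratic_field K"
  obtains d where "squarefree d" "K = quadratic_field d"
proof -
  have sf: "subfield K complex_ring" and dim: "ring.dimension complex_ring 2 \<rat> K" and nr: "\<not> K \<subseteq> \<real>"
    using assms by (auto simp: imaginary_quadratic_field_def number_field_def)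
  note sr = subringE[OF subfieldE(1)[OF sf]]
  have QK: "\<rat> \<subseteq> K" by (rule number_field_Rats_subset[OF sf])
  have add: "x + y \<in> K" if "x \<in> K" "y \<in> K" for x y using sr(7)[OF that] by simp
  have mult: "x * y \<in> K" if "x \<in> K" "y \<in> K" for x y using sr(6)[OF that] by simp
  obtain u v where uv: "K = {a * u + b * v | a b. a \<in> \<rat> \<and> b \<in> \<rat>}" using dimension_2_complex_ring[OF dim] by blast
  obtain x where x: "x \<in> K" "x \<notin> \<real>" using nr by blast
  hence imx: "Im x \<noteq> 0" using complex_is_Real_iff by blast
  have Kuv: "\<exists>a b. y = a * u + b * v \<and> a \<in> \<rat> \<and> b \<in> \<rat>" if "y \<in> K" for y
    using that by (simp only: uv mem_Collect_eq)
  have "1 \<in> K" by (rule subsetD[OF QK Rats_1])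
  then obtain a1 b1 where 1: "1 = a1 * u + b1 * v" "a1 \<in> \<rat>" "b1 \<in> \<rat>" using Kuv[of 1] by metis
  obtain a2 b2 where 2: "x = a2 * u + b2 * v" "a2 \<in> \<rat>" "b2 \<in> \<rat>" using Kuv[OF x(1)] by metis
  \<comment> \<open>The determinant expressing 1 and \<open>x\<close> in terms of \<open>u\<close>
    and \<open>v\<close>. It is nonzero because 1 and a nonreal number are independent over the
    rationals, and Cramer's rule then recovers \<open>u\<close> and \<open>v\<close>.\<close>
  define D where "D = a1 * b2 - a2 * b1"
  have DQ: "D \<in> \<rat>" unfolding D_def using 1 2 by simp
  have Du: "D * u = b2 - b1 * x"
  proof -
    have "b2 * 1 - b1 * x = b2 * (a1 * u + b1 * v) - b1 * (a2 * u + b2 * v)" using 1(1) 2(1) by simp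
    thus ?thesis by (simp add: D_def algebra_simps)
  qed
  have Dv: "D * v = a1 * x - a2"
  proof -
    have "a1 * x - a2 * 1 = a1 * (a2 * u + b2 * v) - a2 * (a1 * u + b1 * v)" using 1(1) 2(1) by simp
    thus ?thesis by (simp add: D_def algebra_simps)
  qed
  have lin: "p = 0 \<and> q = 0" if h: "p \<in> \<rat>" "q \<in> \<rat>" "p + q * x = 0" for p q :: complex
  proof -
    obtain p' where p': "p = complex_of_real p'" using h(1) by (rule Rats_complexE)
    obtain q' where q': "q = complex_of_real q'" using h(2) by (rule Rats_complexE)
    note pq = p' q'
    have "Im (p + q * x) = 0" using h(3) by simp
    hence "q' = 0" using imx by (simp add: pq)
    thus ?thesis using h(3) pq by simp
  qed
  have D0: "D \<noteq> 0"
  proof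
    assume "D = 0"
    hence "b2 + (- b1) * x = 0" "(- a2) + a1 * x = 0" using Du Dv by (simp_all add: algebra_simps)
    hence "b1 = 0" "a1 = 0" using lin[of b2 "- b1"] lin[of "- a2" a1] 1 2 by auto
    thus False using 1(1) by simp
  qed
  have Kx: "\<exists>p q. p \<in> \<rat> \<and> q \<in> \<rat> \<and> y = p + q * x" if y: "y \<in> K" for y
  proof -
    obtain a b where ab: "y = a * u + b * v" "a \<in> \<rat>" "b \<in> \<rat>" using Kuv[OF y] by metis
    have "D * y = a * (D * u) + b * (D * v)" unfolding ab(1) by (simp add: algebra_simps)
    also have "\<dots> = (a * b2 - b * a2) + (b * a1 - a * b1) * x" unfolding Du Dv by (simp add: algebra_simps)
    finally have "y = ((a * b2 - b * a2) + (b * a1 - a * b1) * x) / D" using D0 by (simp add: field_simps)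
    hence "y = (a * b2 - b * a2) / D + ((b * a1 - a * b1) / D) * x" by (simp add: add_divide_distrib)
    moreover have "(a * b2 - b * a2) / D \<in> \<rat>" "(b * a1 - a * b1) / D \<in> \<rat>"
      using ab 1 2 DQ by simp_all
    ultimately show ?thesis by blast
  qed
  obtain q p where pq: "q \<in> \<rat>" "p \<in> \<rat>" "x * x = q + p * x" using Kx[OF mult[OF x(1) x(1)]] by metis
  define z where "z = x - p / 2"
  have imz: "Im z \<noteq> 0" using imx Im_of_Rats[OF pq(2)] by (simp add: z_def)
  have "z^2 = x * x - p * x + p^2 / 4"
    by (simp add: z_def power2_eq_square algebra_simps)
  hence zz: "z^2 = q + p^2 / 4" unfolding pq(3) by simp
  have "z^2 \<in> \<rat>" unfolding zz using pq by simp
  hence rez: "Re z = 0" using imz by (rule Re_zero_if_square_rational)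
  obtain r where r: "r \<in> \<rat>" "z^2 = complex_of_real r" using \<open>z^2 \<in> \<rat>\<close> by (rule Rats_complexE)
  have rneg: "- r = (Im z)^2"
    using r(2) rez by (simp add: complex_eq_iff power2_eq_square)
  hence rpos: "- r > 0" using imz by simp
  have "- r \<in> \<rat>" using r(1) by simp
  then obtain m n :: int where mn: "n > 0" "coprime m n" "- r = of_int m / of_int n" by (rule Rats_cases')
  have m0: "m > 0" using mn rpos by (simp add: zero_less_divide_iff)
  \<comment> \<open>With -z^2 = m / n, multiplying \<open>z\<close> by n makes the negated square
    the integer m n, whose square part k^2 is absorbed into the rational coefficient
    \<open>c\<close>.\<close>
  define N where "N = nat (m * n)"
  define d where "d = squarefree_part N"
  define k where "k = square_part N"
  have N0: "N > 0" unfolding N_def using m0 mn by simp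
  have Nd: "N = d * k^2" unfolding d_def k_def by (rule squarefree_decompose)
  have dsf: "squarefree d" unfolding d_def by simp
  have k0: "k > 0" using Nd N0 by (auto intro!: gr0I)
  have "(of_int n * Im z)^2 = of_int (m * n)"
  proof -
    have "(of_int n * Im z)^2 = of_int n * (of_int n * - r)"
      unfolding rneg by (simp add: power2_eq_square)
    also have "of_int n * - r = of_int m" using mn(1) unfolding mn(3) by simp
    finally show ?thesis by (simp add: mult.commute)
  qed
  also have "\<dots> = real N" unfolding N_def using m0 mn by simp
  also have "\<dots> = (real k * sqrt (real d))^2" unfolding Nd by (simp add: power_mult_distrib)
  finally have "\<bar>of_int n * Im z\<bar> = \<bar>real k * sqrt (real d)\<bar>" by (metis power2_abs abs_ge_zero power2_eq_imp_eq)
  hence abs_im: "of_int n * \<bar>Im z\<bar> = real k * sqrt (real d)" using mn(1) by (simp add: abs_mult)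
  define c where "c = sgn (Im z) * real k / of_int n"
  have cQ: "c \<in> \<rat>" unfolding c_def using mn by (auto simp: sgn_if)
  have "Im z = sgn (Im z) * \<bar>Im z\<bar>" by (simp add: sgn_mult_abs)
  also have "\<bar>Im z\<bar> = real k * sqrt (real d) / of_int n" using abs_im mn(1) by (simp add: field_simps)
  finally have imz': "Im z = c * sqrt (real d)" by (simp add: c_def)
  have c0: "c \<noteq> 0" using imz imz' by auto
  have "K = quadratic_field d"
  proof (intro equalityI subsetI)
    fix y assume "y \<in> K"
    then obtain a b where ab: "a \<in> \<rat>" "b \<in> \<rat>" "y = a + b * x" using Kx by metis
    obtain a' where a': "a' \<in> \<rat>" "a = complex_of_real a'" using ab(1) by (rule Rats_complexE)
    obtain b' where b': "b' \<in> \<rat>" "b = complex_of_real b'" using ab(2) by (rule Rats_complexE)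
    obtain p' where p': "p' \<in> \<rat>" "p = complex_of_real p'" using pq(2) by (rule Rats_complexE)
    have "y = a + b * p / 2 + b * z" unfolding ab(3) by (simp add: z_def algebra_simps)
    also have "\<dots> = Complex (a' + b' * p' / 2) ((b' * c) * sqrt (real d))"
      unfolding complex_eq_iff a'(2) b'(2) p'(2) using rez imz' by simp
    finally have "y = Complex (a' + b' * p' / 2) ((b' * c) * sqrt (real d))" .
    moreover have "a' + b' * p' / 2 \<in> \<rat>" "b' * c \<in> \<rat>" using a'(1) b'(1) p'(1) cQ by simp_all
    ultimately show "y \<in> quadratic_field d" by (simp add: quadratic_fieldI)
  next
    fix y assume "y \<in> quadratic_field d"
    then obtain a b where ab: "a \<in> \<rat>" "b \<in> \<rat>" "y = Complex a (b * sqrt (real d))" by (rule quadratic_fieldE)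
    have y: "y = complex_of_real a + complex_of_real (b / c) * z"
      unfolding complex_eq_iff ab(3) using rez imz' c0 by simp
    have bc: "b / c \<in> \<rat>" and p2: "- p / 2 \<in> \<rat>" using ab(2) cQ pq(2) by simp_all
    have "z \<in> K" using add[OF x(1) subsetD[OF QK p2]] by (simp add: z_def)
    from add[OF subsetD[OF QK of_real_in_Rats[OF ab(1)]] mult[OF subsetD[OF QK of_real_in_Rats[OF bc]] this]]
    show "y \<in> K" by (simp only: y)
  qed
  thus ?thesis by (rule that[OF dsf])
qed

text \<open>Gauss's lemma: a primitive quadratic integer polynomial dividing a monic one over the rationals is monic up to sign.\<close>

lemma quadratic_algebraic_int:
  fixes x :: complex
  assumes "Im x \<noteq> 0" "2 * Re x \<in> \<rat>" "(cmod x)^2 \<in> \<rat>" "algebraic_int x"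
  shows "2 * Re x \<in> \<int> \<and> (cmod x)^2 \<in> \<int>"
proof -
  obtain p :: "int poly" where p: "poly (map_poly of_int p) x = 0" "lead_coeff p = 1"
    using assms(4) by (auto simp: algebraic_int_altdef_ipoly)
  obtain a b :: int where ab: "b > 0" "coprime a b" "2 * Re x = of_int a / of_int b"
    using assms(2) by (rule Rats_cases')
  obtain a' b' :: int where ab': "b' > 0" "coprime a' b'" "(cmod x)^2 = of_int a' / of_int b'"
    using assms(3) by (rule Rats_cases')
  \<comment> \<open>The polynomial with roots \<open>x\<close> and \<open>cnj x\<close>,
    denominators cleared.\<close>
  define g where "g = [:a' * b, - (a * b'), b * b':]"
  define f where "f = primitive_part g"
  have xx: "x^2 - complex_of_real (2 * Re x) * x + complex_of_real ((cmod x)^2) = 0"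
    by (simp add: complex_eq_iff power2_eq_square cmod_def algebra_simps)
  have eval2: "poly (map_poly of_int [:c0, c1, c2:]) x = of_int c0 + of_int c1 * x + of_int c2 * x^2" for c0 c1 c2 :: int
    by (simp add: map_poly_pCons power2_eq_square algebra_simps)
  have "poly (map_poly of_int g) x = of_int (b * b') * (x^2 - complex_of_real (2 * Re x) * x + complex_of_real ((cmod x)^2))"
    unfolding g_def eval2 ab(3) ab'(3) using ab(1) ab'(1) by (simp add: algebra_simps)
  hence gx: "poly (map_poly of_int g) x = 0" unfolding xx by simp
  have g0: "g \<noteq> 0" "degree g = 2" using ab(1) ab'(1) by (auto simp: g_def)
  have gf: "g = smult (content g) f" unfolding f_def by simp
  have c0: "content g \<noteq> 0" using g0 by simp
  have f0: "f \<noteq> 0" "degree f = 2" using gf g0 c0 by (auto simp: f_def)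
  have cf: "content f = 1" unfolding f_def using g0 by simp
  define ev where "ev h = poly (map_poly complex_of_int h) x" for h
  have ev_add: "ev (h + k) = ev h + ev k" for h k
  proof -
    have "map_poly complex_of_int (h + k) = map_poly of_int h + map_poly of_int k"
      by (rule poly_eqI) (simp add: coeff_map_poly)
    thus ?thesis by (simp add: ev_def)
  qed
  have ev_smult: "ev (smult c h) = of_int c * ev h" for c h
  proof -
    have "map_poly complex_of_int (smult c h) = smult (of_int c) (map_poly of_int h)"
      by (rule poly_eqI) (simp add: coeff_map_poly)
    thus ?thesis by (simp add: ev_def)
  qed
  have ev_pCons: "ev (pCons c h) = of_int c + x * ev h" for c h
    by (simp add: ev_def map_poly_pCons)
  have ev_mult: "ev (h * k) = ev h * ev k" for h k
  proof (induction h)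
    case 0 show ?case by (simp add: ev_def)
  next
    case (pCons c h)
    thus ?case by (simp add: ev_add ev_smult ev_pCons algebra_simps)
  qed
  have "ev g = of_int (content g) * ev f" using ev_smult[of "content g" f] gf by metis
  hence fx: "ev f = 0" using gx c0 by (simp add: ev_def)
  \<comment> \<open>The remainder has degree at most 1, integer coefficients and the nonreal root
    \<open>x\<close>, so it is 0.\<close>
  obtain e q where eq: "e \<noteq> 0" "smult e p = f * q + pseudo_mod p f" using pseudo_mod(1)[OF f0(1), of p] by blast
  define r where "r = pseudo_mod p f"
  have "degree r < 2 \<or> r = 0" using pseudo_mod(2)[OF f0(1), of p] f0(2) by (auto simp: r_def)
  hence "degree r \<le> 1" by auto
  hence r2: "r = [:coeff r 0, coeff r 1:]"
  proof (intro poly_eqI)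
    fix i
    show "coeff r i = coeff [:coeff r 0, coeff r 1:] i"
      using \<open>degree r \<le> 1\<close> by (auto simp: coeff_pCons coeff_eq_0 split: nat.splits)
  qed
  have "ev (smult e p) = ev f * ev q + ev r" using eq(2) unfolding r_def by (simp add: ev_add ev_mult)
  hence "ev r = 0" using fx p(1) unfolding ev_smult by (simp add: ev_def)
  moreover have "ev r = of_int (coeff r 0) + of_int (coeff r 1) * x"
    by (subst r2) (simp add: ev_pCons, simp add: ev_def)
  ultimately have rx: "of_int (coeff r 0) + of_int (coeff r 1) * x = 0" by simp
  hence "Im (of_int (coeff r 0) + of_int (coeff r 1) * x) = 0" by simp
  hence "coeff r 1 = 0" using assms(1) by simp
  moreover from this have "coeff r 0 = 0" using rx by simp
  ultimately have "r = 0" using r2 by simp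
  hence eq': "smult e p = f * q" using eq(2) unfolding r_def by simp
  \<comment> \<open>Contents multiply: those of \<open>p\<close> and \<open>f\<close> are 1, so the
    multiplier \<open>e\<close> is up to sign the content of \<open>q\<close> and cancels from the
    leading coefficients.\<close>
  have "content p dvd lead_coeff p" by (rule content_dvd_coeff)
  hence "is_unit (content p)" using p(2) by simp
  hence "content p = 1" by (simp only: is_unit_content_iff)
  hence "normalize e = content q" using arg_cong[OF eq', of content] cf by (simp add: content_mult)
  hence "e dvd lead_coeff q" using content_dvd_coeff[of q "degree q"] by (metis normalize_dvd_iff)
  then obtain k where k: "lead_coeff q = e * k" by blast
  have "lead_coeff (smult e p) = lead_coeff f * lead_coeff q" unfolding eq' by (rule lead_coeff_mult)
  hence "e * (lead_coeff f * k) = e * 1" using p(2) k eq(1) by simp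
  hence "lead_coeff f * k = 1" using eq(1) mult_left_cancel by blast
  hence "lead_coeff f dvd 1" by (metis dvd_triv_left)
  hence lf: "coeff f 2 = 1 \<or> coeff f 2 = -1" using f0(2) by auto
  define c where "c = content g"
  have cg: "coeff g i = c * coeff f i" for i using arg_cong[OF gf, of "\<lambda>h. coeff h i"] by (simp add: c_def)
  have "a' * b = c * coeff f 0" "- (a * b') = c * coeff f 1" "b * b' = c * coeff f 2"
    using cg[of 0] cg[of 1] cg[of 2] by (simp_all add: g_def numeral_2_eq_2)
  hence E: "a' * b = (b * b') * (coeff f 2 * coeff f 0)" "a * b' = (b * b') * (- coeff f 2 * coeff f 1)"
    using lf by auto
  have "a' = b' * (coeff f 2 * coeff f 0)" "a = b * (- coeff f 2 * coeff f 1)"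
  proof -
    have "b * a' = b * (b' * (coeff f 2 * coeff f 0))" "b' * a = b' * (b * (- coeff f 2 * coeff f 1))"
      using E by (simp_all only: mult_ac)
    thus "a' = b' * (coeff f 2 * coeff f 0)" "a = b * (- coeff f 2 * coeff f 1)"
      using ab(1) ab'(1) by (metis less_irrefl mult_left_cancel)+
  qed
  hence "(cmod x)^2 = of_int (coeff f 2 * coeff f 0)" "2 * Re x = of_int (- coeff f 2 * coeff f 1)"
    unfolding ab(3) ab'(3) using ab(1) ab'(1) by simp_all
  thus ?thesis by (metis Ints_of_int)
qed

text \<open>The square of the reduced denominator of \<open>r\<close> divides \<open>d\<close>,
  hence is 1.\<close>

lemma Rats_of_squarefree_times_square:
  assumes "squarefree (d :: nat)" "r \<in> \<rat>" "real d * r^2 \<in> \<int>"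
  shows "r \<in> \<int>"
proof -
  obtain a b :: int where ab: "b > 0" "coprime a b" "r = of_int a / of_int b"
    using assms(2) by (rule Rats_cases')
  obtain m where m: "real d * r^2 = of_int m" using assms(3) by (elim Ints_cases)
  have "real d * of_int a ^ 2 = of_int m * of_int b ^ 2"
    using m ab(1) unfolding ab(3) by (simp add: power_divide field_simps)
  hence "real_of_int (int d * a^2) = real_of_int (m * b^2)" by simp
  hence "int d * a^2 = m * b^2" by (simp only: of_int_eq_iff)
  hence "b^2 dvd int d * a^2" by (metis dvd_triv_right)
  moreover have "coprime (b^2) (a^2)" using ab(2) by (simp add: coprime_commute)
  ultimately have "b^2 dvd int d" by (simp add: coprime_dvd_mult_left_iff)
  hence "int (nat b ^ 2) dvd int d" using ab(1) by simp
  hence "nat b ^ 2 dvd d" by (simp only: int_dvd_int_iff)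
  hence "nat b dvd 1" using assms(1) unfolding squarefree_def by blast
  hence "b = 1" using ab(1) by simp
  thus ?thesis using ab(3) by simp
qed

section \<open>Arithmetic in a fixed quadratic field and its ring of integers\<close>

locale squarefree_nat =
  fixes d :: nat
  assumes squarefree: "squarefree d"
begin

abbreviation K :: "complex set" where "K \<equiv> quadratic_field d"

abbreviation OK :: "complex set" where "OK \<equiv> carrier (ring_of_integers K)"

text \<open>Half of u + v sqrt(-d). Together with the condition that 4 divides u^2 + d v^2 it
  describes the integers uniformly, without a case distinction on \<open>d\<close> modulo 4.\<close>

definition half :: "int \<Rightarrow> int \<Rightarrow> complex"
  where "half u v = Complex (of_int u / 2) (of_int v / 2 * sqrt (real d))"

lemma d_pos: "d > 0" using squarefree by (auto intro!: gr0I)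

lemma norm_Complex_sqrt: "(cmod (Complex a (b * sqrt (real d))))^2 = a^2 + real d * b^2"
  by (simp add: cmod_def power_mult_distrib)

lemma norm_half: "(cmod (half u v))^2 = of_int (u^2 + int d * v^2) / 4"
  unfolding half_def norm_Complex_sqrt by (simp add: power_divide field_simps)

lemma half_mult: "half u v * half u' v' = Complex ((of_int (u * u' - int d * v * v')) / 4) (of_int (u * v' + v * u') / 4 * sqrt (real d))"
  by (simp add: half_def complex_eq_iff field_simps)

lemma mem_O_iff: "x \<in> OK \<longleftrightarrow> x \<in> K \<and> 2 * Re x \<in> \<int> \<and> (cmod x)^2 \<in> \<int>"
proof
  assume "x \<in> OK"
  hence x: "x \<in> K" "algebraic_int x" by (auto simp: ring_of_integers_def)
  obtain a b where ab: "a \<in> \<rat>" "b \<in> \<rat>" "x = Complex a (b * sqrt (real d))" using x(1) by (rule quadratic_fieldE)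
  have rat: "2 * Re x \<in> \<rat>" "(cmod x)^2 \<in> \<rat>"
    unfolding ab(3) norm_Complex_sqrt using ab(1,2) by simp_all
  show "x \<in> K \<and> 2 * Re x \<in> \<int> \<and> (cmod x)^2 \<in> \<int>"
  proof (cases "Im x = 0")
    case False
    thus ?thesis using quadratic_algebraic_int[OF False rat x(2)] x(1) by simp
  next
    case True
    hence "b * sqrt (real d) = 0" unfolding ab(3) by simp
    hence "x = complex_of_real a" unfolding ab(3) complex_of_real_def by simp
    hence "x \<in> \<rat>" using of_real_in_Rats[OF ab(1)] by simp
    from rational_algebraic_int_is_int[OF x(2) this] obtain n where n: "x = of_int n" by (rule Ints_cases)
    hence "2 * Re x = of_int (2 * n)" "(cmod x)^2 = of_int (n^2)" by simp_all
    thus ?thesis using x(1) by (simp only: Ints_of_int simp_thms)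
  qed
next
  assume x: "x \<in> K \<and> 2 * Re x \<in> \<int> \<and> (cmod x)^2 \<in> \<int>"
  obtain t where t: "2 * Re x = of_int t" by (rule Ints_cases[OF conjunct1[OF conjunct2[OF x]]])
  obtain n where n: "(cmod x)^2 = of_int n" by (rule Ints_cases[OF conjunct2[OF conjunct2[OF x]]])
  note tn = t n
  have "algebraic_int x"
  proof (rule algebraic_int.intros)
    have "x^2 - complex_of_real (2 * Re x) * x + complex_of_real ((cmod x)^2) = 0"
      by (simp add: complex_eq_iff power2_eq_square cmod_def algebra_simps)
    thus "poly [:of_int n, - of_int t, 1:] x = 0"
      unfolding tn by (simp add: power2_eq_square algebra_simps)
    show "\<forall>i. coeff [:of_int n, - of_int t, 1:] i \<in> (\<int> :: complex set)"
      by (auto simp: coeff_pCons split: nat.splits)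
  qed simp
  thus "x \<in> OK" using conjunct1[OF x] by (simp add: ring_of_integers_def)
qed

lemma half_in_O: assumes "4 dvd u^2 + int d * v^2" shows "half u v \<in> OK"
proof -
  have "half u v \<in> K" unfolding half_def by (rule quadratic_fieldI) simp_all
  moreover have "2 * Re (half u v) = of_int u" by (simp add: half_def)
  moreover obtain m where "u^2 + int d * v^2 = 4 * m" using assms by blast
  hence "(cmod (half u v))^2 = of_int m" unfolding norm_half by simp
  ultimately show ?thesis unfolding mem_O_iff by simp
qed

text \<open>Integral trace makes twice the real part an integer \<open>u\<close>; integral norm then
  makes d (2 b)^2 an integer, and \<open>d\<close> being squarefree forces 2 b to be one.\<close>

lemma O_cases:
  assumes "x \<in> OK"
  obtains u v where "x = half u v" "4 dvd u^2 + int d * v^2"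
proof -
  have x: "x \<in> K" "2 * Re x \<in> \<int>" "(cmod x)^2 \<in> \<int>" using assms[unfolded mem_O_iff] by simp_all
  obtain a b where ab: "a \<in> \<rat>" "b \<in> \<rat>" "x = Complex a (b * sqrt (real d))" using x(1) by (rule quadratic_fieldE)
  have "2 * a \<in> \<int>" using x(2) ab(3) by simp
  then obtain u where u: "2 * a = of_int u" by (elim Ints_cases)
  obtain n where n: "a^2 + real d * b^2 = of_int n" using x(3) unfolding ab(3) norm_Complex_sqrt by (elim Ints_cases)
  have "real d * (2 * b)^2 = 4 * (a^2 + real d * b^2) - (2 * a)^2" by (simp add: power_mult_distrib algebra_simps)
  also have "\<dots> = of_int (4 * n - u^2)" unfolding n u by simp
  finally have dI: "real d * (2 * b)^2 \<in> \<int>" by (simp only: Ints_of_int)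
  have "2 * b \<in> \<rat>" using ab(2) by simp
  from Rats_of_squarefree_times_square[OF squarefree this dI] have "2 * b \<in> \<int>" .
  then obtain v where v: "2 * b = of_int v" by (elim Ints_cases)
  have "a = of_int u / 2" "b = of_int v / 2" using u v by simp_all
  hence xh: "x = half u v" unfolding ab(3) half_def by simp
  have "real_of_int (u^2 + int d * v^2) / 4 = a^2 + real d * b^2"
    using norm_half[of u v] unfolding xh[symmetric] ab(3) norm_Complex_sqrt by simp
  hence "real_of_int (u^2 + int d * v^2) = real_of_int (4 * n)" using n by simp
  hence "u^2 + int d * v^2 = 4 * n" by (simp only: of_int_eq_iff)
  thus ?thesis using that xh by simp
qed

text \<open>A square has the parity of its base. This congruence makes the cross terms in sums and
  products of halves even, whatever \<open>d\<close> is modulo 4.\<close>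

lemma parity: assumes "4 dvd u^2 + int d * v^2" shows "even (u + int d * v)"
proof -
  have "even (u^2 + int d * v^2)" using assms by (metis dvd_trans even_numeral)
  thus ?thesis by simp
qed

lemma parity_mult:
  assumes "4 dvd u^2 + int d * v^2" "4 dvd u'^2 + int d * v'^2"
  shows "even (u * u' + int d * v * v')" "even (u * v' + v * u')"
  using parity[OF assms(1)] parity[OF assms(2)] by auto

lemma O_subset_K: "x \<in> OK \<Longrightarrow> x \<in> K" by (simp add: mem_O_iff)

lemma O_add: assumes "x \<in> OK" "y \<in> OK" shows "x + y \<in> OK"
proof -
  obtain u v where x: "x = half u v" "4 dvd u^2 + int d * v^2" using assms(1) by (rule O_cases)
  obtain u' v' where y: "y = half u' v'" "4 dvd u'^2 + int d * v'^2" using assms(2) by (rule O_cases)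
  have "2 * 2 dvd 2 * (u * u' + int d * v * v')"
    by (rule mult_dvd_mono[OF dvd_refl parity_mult(1)[OF x(2) y(2)]])
  hence "4 dvd 2 * (u * u' + int d * v * v')" by (simp only: numeral_times_numeral semiring_norm)
  hence "4 dvd (u^2 + int d * v^2) + (u'^2 + int d * v'^2) + 2 * (u * u' + int d * v * v')"
    by (rule dvd_add[OF dvd_add[OF x(2) y(2)]])
  also have "(u^2 + int d * v^2) + (u'^2 + int d * v'^2) + 2 * (u * u' + int d * v * v') = (u + u')^2 + int d * (v + v')^2"
    by (simp add: power2_eq_square algebra_simps)
  finally have "half (u + u') (v + v') \<in> OK" by (rule half_in_O)
  moreover have "half (u + u') (v + v') = x + y" unfolding x y half_def by (simp add: complex_eq_iff field_simps)
  ultimately show ?thesis by simp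
qed

lemma O_mult: assumes "x \<in> OK" "y \<in> OK" shows "x * y \<in> OK"
proof -
  obtain u v where x: "x = half u v" "4 dvd u^2 + int d * v^2" using assms(1) by (rule O_cases)
  obtain u' v' where y: "y = half u' v'" "4 dvd u'^2 + int d * v'^2" using assms(2) by (rule O_cases)
  have "even (u * u' - int d * v * v')" using parity_mult(1)[OF x(2) y(2)] by auto
  then obtain U where U: "u * u' - int d * v * v' = 2 * U" by blast
  obtain V where V: "u * v' + v * u' = 2 * V" using parity_mult(2)[OF x(2) y(2)] by blast
  \<comment> \<open>The norm form is multiplicative: the product of two multiples of 4 is a multiple
    of 16, so a 4 survives the halving.\<close>
  have "4 * (U^2 + int d * V^2) = (u * u' - int d * v * v')^2 + int d * (u * v' + v * u')^2"
    unfolding U V by (simp add: power_mult_distrib)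
  also have "\<dots> = (u^2 + int d * v^2) * (u'^2 + int d * v'^2)" by (simp add: power2_eq_square algebra_simps)
  finally have e: "4 * (U^2 + int d * V^2) = (u^2 + int d * v^2) * (u'^2 + int d * v'^2)" .
  have "4 * 4 dvd 4 * (U^2 + int d * V^2)" unfolding e by (intro mult_dvd_mono x y)
  hence "4 dvd U^2 + int d * V^2" by (subst (asm) dvd_mult_cancel_left) simp
  hence "half U V \<in> OK" by (rule half_in_O)
  moreover have "half U V = x * y" unfolding x(1) y(1) half_mult U V by (simp add: half_def)
  ultimately show ?thesis by simp
qed

lemma O_of_int: "of_int n \<in> OK"
proof -
  have "4 dvd (2 * n)^2 + int d * 0^2" by (simp add: power_mult_distrib)
  hence "half (2 * n) 0 \<in> OK" by (rule half_in_O)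
  moreover have "half (2 * n) 0 = of_int n" by (simp add: half_def complex_eq_iff)
  ultimately show ?thesis by simp
qed

lemma O_0: "0 \<in> OK" and O_1: "1 \<in> OK" and O_uminus: "x \<in> OK \<Longrightarrow> - x \<in> OK"
  using O_of_int[of 0] O_of_int[of 1] O_mult[OF O_of_int[of "-1"], of x] by simp_all

lemma O_cnj: "x \<in> OK \<Longrightarrow> cnj x \<in> OK"
proof -
  assume "x \<in> OK"
  then obtain u v where x: "x = half u v" "4 dvd u^2 + int d * v^2" by (rule O_cases)
  hence "half u (- v) \<in> OK" by (intro half_in_O) simp
  moreover have "half u (- v) = cnj x" unfolding x half_def by (simp add: complex_eq_iff)
  ultimately show ?thesis by simp
qed

lemma K_mult: assumes "x \<in> K" "y \<in> K" shows "x * y \<in> K"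
proof -
  obtain a b where x: "a \<in> \<rat>" "b \<in> \<rat>" "x = Complex a (b * sqrt (real d))" using assms(1) by (rule quadratic_fieldE)
  obtain a' b' where y: "a' \<in> \<rat>" "b' \<in> \<rat>" "y = Complex a' (b' * sqrt (real d))" using assms(2) by (rule quadratic_fieldE)
  have "x * y = Complex (a * a' - real d * b * b') ((a * b' + b * a') * sqrt (real d))"
    unfolding x y by (simp add: complex_eq_iff algebra_simps)
  thus ?thesis using x y by (simp add: quadratic_fieldI)
qed

lemma K_add: assumes "x \<in> K" "y \<in> K" shows "x + y \<in> K"
proof -
  obtain a b where x: "a \<in> \<rat>" "b \<in> \<rat>" "x = Complex a (b * sqrt (real d))" using assms(1) by (rule quadratic_fieldE)
  obtain a' b' where y: "a' \<in> \<rat>" "b' \<in> \<rat>" "y = Complex a' (b' * sqrt (real d))" using assms(2) by (rule quadratic_fieldE)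
  have "x + y = Complex (a + a') ((b + b') * sqrt (real d))"
    unfolding x y by (simp add: complex_eq_iff algebra_simps)
  thus ?thesis using x y by (simp add: quadratic_fieldI)
qed

lemma K_cnj: assumes "x \<in> K" shows "cnj x \<in> K"
proof -
  obtain a b where x: "a \<in> \<rat>" "b \<in> \<rat>" "x = Complex a (b * sqrt (real d))" using assms(1) by (rule quadratic_fieldE)
  have "cnj x = Complex a ((- b) * sqrt (real d))"
    unfolding x by (simp add: complex_eq_iff algebra_simps)
  thus ?thesis using x by (simp only: quadratic_fieldI Rats_minus_iff)
qed

lemma K_of_real: "r \<in> \<rat> \<Longrightarrow> complex_of_real r \<in> K"
  using quadratic_fieldI[of r 0 d] by (simp add: complex_of_real_def)

lemma K_norm: assumes "x \<in> K" shows "(cmod x)^2 \<in> \<rat>"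
proof -
  obtain a b where x: "a \<in> \<rat>" "b \<in> \<rat>" "x = Complex a (b * sqrt (real d))" using assms(1) by (rule quadratic_fieldE)
  thus ?thesis unfolding x(3) norm_Complex_sqrt by simp
qed

lemma K_inverse: assumes "x \<in> K" shows "inverse x \<in> K"
proof (cases "x = 0")
  case False
  have "inverse x = cnj x * complex_of_real (1 / (cmod x)^2)"
    using complex_norm_square[of x] False by (simp add: field_simps)
  moreover have "1 / (cmod x)^2 \<in> \<rat>" using K_norm[OF assms] by simp
  ultimately show ?thesis using K_mult[OF K_cnj[OF assms] K_of_real] by (simp only:)
qed (use assms in simp)

lemma O_real_Ints: assumes "complex_of_real r \<in> OK" shows "r \<in> \<int>"
proof -
  obtain u v where x: "complex_of_real r = half u v" "4 dvd u^2 + int d * v^2" using assms by (rule O_cases)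
  have "v = 0" "r = of_int u / 2" using x(1) d_pos by (auto simp: half_def complex_eq_iff)
  moreover have "even u" using x(2) \<open>v = 0\<close> parity[OF x(2)] by simp
  ultimately show ?thesis by (auto elim!: evenE)
qed

end

section \<open>Fractional ideals and the Polya group\<close>

lemma additive_subgroup_complex_ring_iff:
  "additive_subgroup J complex_ring \<longleftrightarrow> 0 \<in> J \<and> (\<forall>x\<in>J. \<forall>y\<in>J. x + y \<in> J) \<and> (\<forall>x\<in>J. - x \<in> J)"
proof
  assume J: "additive_subgroup J complex_ring"
  have "- x \<in> J" if "x \<in> J" for x
    using additive_subgroup.a_inv_closed[OF J that]
    by (simp only: complex_ring_minus)
  thus "0 \<in> J \<and> (\<forall>x\<in>J. \<forall>y\<in>J. x + y \<in> J) \<and> (\<forall>x\<in>J. - x \<in> J)"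
    using additive_subgroup.zero_closed[OF J] additive_subgroup.a_closed[OF J] by simp
next
  assume J: "0 \<in> J \<and> (\<forall>x\<in>J. \<forall>y\<in>J. x + y \<in> J) \<and> (\<forall>x\<in>J. - x \<in> J)"
  have "inv\<^bsub>add_monoid complex_ring\<^esub> x = - x" for x
    unfolding a_inv_def[symmetric] by (rule complex_ring_minus)
  thus "additive_subgroup J complex_ring"
    using J by (intro additive_subgroup.intro subgroup.intro) simp_all
qed

section \<open>Products, multiples and conjugates of sets of complex numbers\<close>

abbreviation iprod :: "complex set \<Rightarrow> complex set \<Rightarrow> complex set"
  where "iprod \<equiv> ideal_prod complex_ring"

lemma iprod_mem: "x \<in> I \<Longrightarrow> y \<in> J \<Longrightarrow> x * y \<in> iprod I J"
  using ideal_prod.prod[of x I y J complex_ring] by simp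

lemma iprod_add: "x \<in> iprod I J \<Longrightarrow> y \<in> iprod I J \<Longrightarrow> x + y \<in> iprod I J"
  using ideal_prod.sum[of x complex_ring I J y] by simp

text \<open>A product of ideals is generated inductively from products by addition, so inclusion in
  an additively closed set can be tested on single products. The inclusions between products of
  ideals below go through this rule.\<close>

lemma iprod_least:
  assumes "\<And>x y. x \<in> I \<Longrightarrow> y \<in> J \<Longrightarrow> x * y \<in> S" "\<And>x y. x \<in> S \<Longrightarrow> y \<in> S \<Longrightarrow> x + y \<in> S" "z \<in> iprod I J"
  shows "z \<in> S"
  using assms(3) by (induction rule: ideal_prod.induct) (simp_all add: assms(1,2))

lemma iprod_commute: "iprod I J = iprod J I"
proof -
  have "z \<in> iprod J I" if "z \<in> iprod I J" for I J z
  proof (rule iprod_least[OF _ _ that])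
    show "x * y \<in> iprod J I" if "x \<in> I" "y \<in> J" for x y
      using iprod_mem[OF that(2,1)] by (simp only: mult.commute)
  qed (rule iprod_add)
  thus ?thesis by blast
qed

text \<open>One inclusion for all triples is enough, since commutativity turns it into the
  other.\<close>

lemma iprod_assoc: "iprod (iprod I J) L = iprod I (iprod J L)"
proof -
  have le: "z \<in> iprod I (iprod J L)" if z: "z \<in> iprod (iprod I J) L" for I J L z
  proof (rule iprod_least[OF _ _ z])
    fix x y assume x: "x \<in> iprod I J" and y: "y \<in> L"
    have "x \<in> {x. x * y \<in> iprod I (iprod J L)}"
    proof (rule iprod_least[OF _ _ x])
      fix a b assume "a \<in> I" "b \<in> J"
      hence "a * (b * y) \<in> iprod I (iprod J L)" using y by (intro iprod_mem)
      thus "a * b \<in> {x. x * y \<in> iprod I (iprod J L)}" by (simp add: mult.assoc)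
    next
      fix a b assume "a \<in> {x. x * y \<in> iprod I (iprod J L)}" "b \<in> {x. x * y \<in> iprod I (iprod J L)}"
      thus "a + b \<in> {x. x * y \<in> iprod I (iprod J L)}" using iprod_add by (simp add: distrib_right)
    qed
    thus "x * y \<in> iprod I (iprod J L)" by simp
  qed (rule iprod_add)
  show ?thesis
  proof
    show "iprod (iprod I J) L \<subseteq> iprod I (iprod J L)" using le by blast
    have "iprod (iprod L J) I \<subseteq> iprod L (iprod J I)" using le by blast
    thus "iprod I (iprod J L) \<subseteq> iprod (iprod I J) L"
      by (metis iprod_commute)
  qed
qed

text \<open>Principal ideals are multiples of the ring of integers and ideal classes consist of
  multiples of one ideal, so both reduce to this operation.\<close>

definition scaled :: "complex \<Rightarrow> complex set \<Rightarrow> complex set"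
  where "scaled x J = (\<lambda>a. x * a) ` J"

lemma scaled_1: "scaled 1 J = J" by (simp add: scaled_def)

lemma scaled_scaled: "scaled x (scaled y J) = scaled (x * y) J"
  by (simp add: scaled_def image_image mult.assoc)

lemma iprod_scaled: "iprod (scaled x I) (scaled y J) = scaled (x * y) (iprod I J)"
proof (rule equalityI; rule subsetI)
  fix z assume z: "z \<in> iprod (scaled x I) (scaled y J)"
  show "z \<in> scaled (x * y) (iprod I J)"
  proof (rule iprod_least[OF _ _ z])
    fix a b assume "a \<in> scaled x I" "b \<in> scaled y J"
    then obtain a' b' where "a = x * a'" "b = y * b'" "a' \<in> I" "b' \<in> J" by (auto simp: scaled_def)
    hence "a * b = (x * y) * (a' * b')" "a' * b' \<in> iprod I J" by (auto intro: iprod_mem)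
    thus "a * b \<in> scaled (x * y) (iprod I J)" unfolding scaled_def by blast
  next
    fix a b assume "a \<in> scaled (x * y) (iprod I J)" "b \<in> scaled (x * y) (iprod I J)"
    then obtain a' b' where ab: "a = (x * y) * a'" "b = (x * y) * b'" "a' \<in> iprod I J" "b' \<in> iprod I J"
      by (auto simp: scaled_def)
    have "a + b = (x * y) * (a' + b')" unfolding ab by (simp add: distrib_left)
    thus "a + b \<in> scaled (x * y) (iprod I J)" unfolding scaled_def using iprod_add[OF ab(3,4)] by blast
  qed
next
  fix z assume "z \<in> scaled (x * y) (iprod I J)"
  then obtain w where w: "w \<in> iprod I J" "z = (x * y) * w" by (auto simp: scaled_def)
  have "w \<in> {w. (x * y) * w \<in> iprod (scaled x I) (scaled y J)}"
  proof (rule iprod_least[OF _ _ w(1)])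
    fix a b assume "a \<in> I" "b \<in> J"
    hence "(x * a) * (y * b) \<in> iprod (scaled x I) (scaled y J)" by (intro iprod_mem) (auto simp: scaled_def)
    thus "a * b \<in> {w. (x * y) * w \<in> iprod (scaled x I) (scaled y J)}" by (simp add: mult_ac)
  next
    fix a b assume "a \<in> {w. (x * y) * w \<in> iprod (scaled x I) (scaled y J)}" "b \<in> {w. (x * y) * w \<in> iprod (scaled x I) (scaled y J)}"
    thus "a + b \<in> {w. (x * y) * w \<in> iprod (scaled x I) (scaled y J)}" using iprod_add by (simp add: distrib_left)
  qed
  thus "z \<in> iprod (scaled x I) (scaled y J)" using w(2) by simp
qed

lemma iprod_cnj: "iprod (cnj ` I) (cnj ` J) = cnj ` iprod I J"
proof -
  have le: "z \<in> cnj ` iprod I J" if z: "z \<in> iprod (cnj ` I) (cnj ` J)" for I J z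
  proof (rule iprod_least[OF _ _ z])
    fix x y assume "x \<in> cnj ` I" "y \<in> cnj ` J"
    then obtain a b where "x = cnj a" "y = cnj b" "a \<in> I" "b \<in> J" by blast
    hence "x * y = cnj (a * b)" "a * b \<in> iprod I J" by (auto intro: iprod_mem)
    thus "x * y \<in> cnj ` iprod I J" by blast
  next
    fix x y assume "x \<in> cnj ` iprod I J" "y \<in> cnj ` iprod I J"
    then obtain a b where ab: "x = cnj a" "y = cnj b" "a \<in> iprod I J" "b \<in> iprod I J" by blast
    have "x + y = cnj (a + b)" unfolding ab by simp
    thus "x + y \<in> cnj ` iprod I J" using iprod_add[OF ab(3,4)] by blast
  qed
  have cc: "cnj ` cnj ` A = A" for A by (simp add: image_image)
  show ?thesis
  proof
    show "iprod (cnj ` I) (cnj ` J) \<subseteq> cnj ` iprod I J" using le by blast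
    have "iprod (cnj ` cnj ` I) (cnj ` cnj ` J) \<subseteq> cnj ` iprod (cnj ` I) (cnj ` J)" using le by blast
    hence "iprod I J \<subseteq> cnj ` iprod (cnj ` I) (cnj ` J)" unfolding cc .
    from image_mono[OF this, of cnj] show "cnj ` iprod I J \<subseteq> iprod (cnj ` I) (cnj ` J)" unfolding cc .
  qed
qed

section \<open>Fractional ideals and ideal classes of the fixed field\<close>

context squarefree_nat
begin

abbreviation fractional :: "complex set \<Rightarrow> bool" where "fractional \<equiv> fractional_ideal K"

lemma fractional_iff: "fractional J \<longleftrightarrow> 0 \<in> J \<and> (\<forall>x\<in>J. \<forall>y\<in>J. x + y \<in> J) \<and> J \<subseteq> K \<and> J \<noteq> {0} \<and>
  (\<forall>a\<in>OK. \<forall>x\<in>J. a * x \<in> J) \<and> (\<exists>D\<in>OK. D \<noteq> 0 \<and> (\<forall>x\<in>J. D * x \<in> OK))"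
proof -
  have "- x \<in> J" if "\<forall>a\<in>OK. \<forall>x\<in>J. a * x \<in> J" "x \<in> J" for x
    using that(1)[rule_format, OF O_uminus[OF O_1] that(2)] by simp
  thus ?thesis unfolding fractional_ideal_def additive_subgroup_complex_ring_iff by blast
qed

lemma fractionalI:
  assumes "0 \<in> J" "\<And>x y. x \<in> J \<Longrightarrow> y \<in> J \<Longrightarrow> x + y \<in> J" "\<And>x. x \<in> J \<Longrightarrow> x \<in> K" "z \<in> J" "z \<noteq> 0"
    "\<And>a x. a \<in> OK \<Longrightarrow> x \<in> J \<Longrightarrow> a * x \<in> J" "D \<in> OK" "D \<noteq> 0" "\<And>x. x \<in> J \<Longrightarrow> D * x \<in> OK"
  shows "fractional J"
proof -
  have "J \<subseteq> K" "J \<noteq> {0}" using assms(3-5) by auto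
  moreover have "\<exists>D\<in>OK. D \<noteq> 0 \<and> (\<forall>x\<in>J. D * x \<in> OK)"
    by (intro bexI[OF _ assms(7)] conjI ballI assms(8,9))
  ultimately show ?thesis unfolding fractional_iff by (intro conjI ballI assms(1,2,6))
qed

lemma fractionalD:
  assumes "fractional J"
  shows "0 \<in> J" "x \<in> J \<Longrightarrow> y \<in> J \<Longrightarrow> x + y \<in> J" "x \<in> J \<Longrightarrow> x \<in> K" "a \<in> OK \<Longrightarrow> x \<in> J \<Longrightarrow> a * x \<in> J"
    "\<exists>x\<in>J. x \<noteq> 0" "\<exists>D\<in>OK. D \<noteq> 0 \<and> (\<forall>x\<in>J. D * x \<in> OK)"
  using assms[unfolded fractional_iff] by auto

lemma fractional_OK: "fractional OK"
  by (rule fractionalI[of OK 1 1]) (auto intro: O_0 O_1 O_add O_mult O_subset_K)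

lemma fractional_iprod:
  assumes I: "fractional I" and J: "fractional J" shows "fractional (iprod I J)"
proof -
  obtain i where i: "i \<in> I" "i \<noteq> 0" using fractionalD(5)[OF I] by blast
  obtain j where j: "j \<in> J" "j \<noteq> 0" using fractionalD(5)[OF J] by blast
  obtain D where D: "D \<in> OK" "D \<noteq> 0" "\<And>x. x \<in> I \<Longrightarrow> D * x \<in> OK" using fractionalD(6)[OF I] by blast
  obtain D' where D': "D' \<in> OK" "D' \<noteq> 0" "\<And>x. x \<in> J \<Longrightarrow> D' * x \<in> OK" using fractionalD(6)[OF J] by blast
  show ?thesis
  proof (rule fractionalI[of _ "i * j" "D * D'"])
    show "0 \<in> iprod I J" using iprod_mem[OF fractionalD(1)[OF I] fractionalD(1)[OF J]] by simp
    show "i * j \<in> iprod I J" "i * j \<noteq> 0" using i j iprod_mem by auto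
    show "D * D' \<in> OK" "D * D' \<noteq> 0" using D D' O_mult by auto
    show "x + y \<in> iprod I J" if "x \<in> iprod I J" "y \<in> iprod I J" for x y using that by (rule iprod_add)
    show "x \<in> K" if "x \<in> iprod I J" for x
      using that by (rule iprod_least[rotated 2]) (auto intro: K_add K_mult fractionalD(3)[OF I] fractionalD(3)[OF J])
    show "a * x \<in> iprod I J" if a: "a \<in> OK" and x: "x \<in> iprod I J" for a x
    proof -
      have "x \<in> {x. a * x \<in> iprod I J}"
      proof (rule iprod_least[OF _ _ x])
        fix u v assume "u \<in> I" "v \<in> J"
        hence "(a * u) * v \<in> iprod I J" using a fractionalD(4)[OF I] by (intro iprod_mem)
        thus "u * v \<in> {x. a * x \<in> iprod I J}" by (simp add: mult.assoc)
      next
        fix u v assume "u \<in> {x. a * x \<in> iprod I J}" "v \<in> {x. a * x \<in> iprod I J}"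
        thus "u + v \<in> {x. a * x \<in> iprod I J}" using iprod_add by (simp add: distrib_left)
      qed
      thus ?thesis by simp
    qed
    show "D * D' * x \<in> OK" if x: "x \<in> iprod I J" for x
    proof -
      have "x \<in> {x. D * D' * x \<in> OK}"
      proof (rule iprod_least[OF _ _ x])
        fix u v assume "u \<in> I" "v \<in> J"
        hence "(D * u) * (D' * v) \<in> OK" using D D' O_mult by blast
        thus "u * v \<in> {x. D * D' * x \<in> OK}" by (simp add: mult_ac)
      next
        fix u v assume "u \<in> {x. D * D' * x \<in> OK}" "v \<in> {x. D * D' * x \<in> OK}"
        thus "u + v \<in> {x. D * D' * x \<in> OK}" using O_add by (simp add: distrib_left)
      qed
      thus ?thesis by simp
    qed
  qed
qed

lemma iprod_OK: assumes "fractional J" shows "iprod OK J = J"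
proof (rule equalityI; rule subsetI)
  fix x assume "x \<in> iprod OK J"
  thus "x \<in> J" by (rule iprod_least[rotated 2]) (rule fractionalD(4)[OF assms] fractionalD(2)[OF assms]; assumption)+
next
  fix x assume "x \<in> J"
  thus "x \<in> iprod OK J" using iprod_mem[OF O_1, of x J] by simp
qed

lemma K_denominator: assumes "x \<in> K" obtains n :: int where "n > 0" "of_int n * x \<in> OK"
proof -
  obtain a b where ab: "a \<in> \<rat>" "b \<in> \<rat>" "x = Complex a (b * sqrt (real d))" using assms by (rule quadratic_fieldE)
  obtain p q :: int where pq: "q > 0" "coprime p q" "a = of_int p / of_int q" using ab(1) by (rule Rats_cases')
  obtain r s :: int where rs: "s > 0" "coprime r s" "b = of_int r / of_int s" using ab(2) by (rule Rats_cases')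
  have "4 dvd (2 * (p * s))^2 + int d * (2 * (r * q))^2" by (simp add: power_mult_distrib)
  hence "half (2 * (p * s)) (2 * (r * q)) \<in> OK" by (rule half_in_O)
  moreover have "half (2 * (p * s)) (2 * (r * q)) = of_int (q * s) * x"
    unfolding ab(3) half_def pq(3) rs(3) using pq(1) rs(1) by (simp add: complex_eq_iff field_simps)
  ultimately show ?thesis using that[of "q * s"] pq(1) rs(1) by simp
qed

lemma fractional_scaled: assumes "x \<in> K" "x \<noteq> 0" "fractional J" shows "fractional (scaled x J)"
proof -
  obtain j where j: "j \<in> J" "j \<noteq> 0" using fractionalD(5)[OF assms(3)] by blast
  obtain D where D: "D \<in> OK" "D \<noteq> 0" "\<And>x. x \<in> J \<Longrightarrow> D * x \<in> OK" using fractionalD(6)[OF assms(3)] by blast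
  obtain n :: int where n: "n > 0" "of_int n * x \<in> OK" using assms(1) by (rule K_denominator)
  show ?thesis
  proof (rule fractionalI[of _ "x * j" "of_int n * D"])
    show "0 \<in> scaled x J" using fractionalD(1)[OF assms(3)] unfolding scaled_def by (intro image_eqI[of _ _ 0]) simp_all
    show "x * j \<in> scaled x J" "x * j \<noteq> 0" using j assms(2) by (auto simp: scaled_def)
    show "of_int n * D \<in> OK" "of_int n * D \<noteq> 0" using D n O_mult[OF O_of_int] by auto
    fix u assume "u \<in> scaled x J"
    then obtain u' where u: "u = x * u'" "u' \<in> J" by (auto simp: scaled_def)
    show "u \<in> K" unfolding u using assms(1) fractionalD(3)[OF assms(3) u(2)] by (rule K_mult)
    have "(of_int n * x) * (D * u') \<in> OK" using n(2) D(3)[OF u(2)] by (rule O_mult)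
    thus "of_int n * D * u \<in> OK" unfolding u by (simp add: mult_ac)
    show "a * u \<in> scaled x J" if a: "a \<in> OK" for a
    proof -
      have "a * u = x * (a * u')" unfolding u by simp
      thus ?thesis unfolding scaled_def using fractionalD(4)[OF assms(3) a u(2)] by blast
    qed
    fix v assume "v \<in> scaled x J"
    then obtain v' where v: "v = x * v'" "v' \<in> J" by (auto simp: scaled_def)
    have "u + v = x * (u' + v')" unfolding u v by (simp add: distrib_left)
    thus "u + v \<in> scaled x J" unfolding scaled_def using fractionalD(2)[OF assms(3) u(2) v(2)] by blast
  qed
qed

lemma fractional_cnj: assumes "fractional J" shows "fractional (cnj ` J)"
proof -
  obtain j where j: "j \<in> J" "j \<noteq> 0" using fractionalD(5)[OF assms] by blast
  obtain D where D: "D \<in> OK" "D \<noteq> 0" "\<And>x. x \<in> J \<Longrightarrow> D * x \<in> OK" using fractionalD(6)[OF assms] by blast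
  show ?thesis
  proof (rule fractionalI[of _ "cnj j" "cnj D"])
    show "0 \<in> cnj ` J" using fractionalD(1)[OF assms] by (intro image_eqI[of _ _ 0]) simp_all
    show "cnj j \<in> cnj ` J" "cnj j \<noteq> 0" "cnj D \<in> OK" "cnj D \<noteq> 0" using j D O_cnj by auto
    fix u assume "u \<in> cnj ` J"
    then obtain u' where u: "u = cnj u'" "u' \<in> J" by blast
    show "u \<in> K" unfolding u using fractionalD(3)[OF assms u(2)] by (rule K_cnj)
    have "cnj (D * u') \<in> OK" using D(3)[OF u(2)] by (rule O_cnj)
    thus "cnj D * u \<in> OK" unfolding u by simp
    show "a * u \<in> cnj ` J" if a: "a \<in> OK" for a
    proof -
      have "a * u = cnj (cnj a * u')" unfolding u by simp
      thus ?thesis using fractionalD(4)[OF assms O_cnj[OF a] u(2)] by blast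
    qed
    fix v assume "v \<in> cnj ` J"
    then obtain v' where v: "v = cnj v'" "v' \<in> J" by blast
    have "u + v = cnj (u' + v')" unfolding u v by simp
    thus "u + v \<in> cnj ` J" using fractionalD(2)[OF assms u(2) v(2)] by blast
  qed
qed

abbreviation G :: "complex set monoid" where "G \<equiv> fractional_ideal_group K"

lemma G_simps: "carrier G = {J. fractional J}" "I \<otimes>\<^bsub>G\<^esub> J = iprod I J" "\<one>\<^bsub>G\<^esub> = OK"
  by (simp_all add: fractional_ideal_group_def)

lemma comm_monoid_G: "comm_monoid G"
proof (rule comm_monoidI)
  show "\<one>\<^bsub>G\<^esub> \<otimes>\<^bsub>G\<^esub> x = x" if "x \<in> carrier G" for x
    using that iprod_OK unfolding G_simps by simp
  show "x \<otimes>\<^bsub>G\<^esub> y \<in> carrier G" if "x \<in> carrier G" "y \<in> carrier G" for x y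
    using that fractional_iprod unfolding G_simps by simp
  show "\<one>\<^bsub>G\<^esub> \<in> carrier G" unfolding G_simps using fractional_OK by simp
  show "x \<otimes>\<^bsub>G\<^esub> y \<otimes>\<^bsub>G\<^esub> z = x \<otimes>\<^bsub>G\<^esub> (y \<otimes>\<^bsub>G\<^esub> z)" for x y z
    unfolding G_simps by (rule iprod_assoc)
  show "x \<otimes>\<^bsub>G\<^esub> y = y \<otimes>\<^bsub>G\<^esub> x" for x y unfolding G_simps by (rule iprod_commute)
qed

lemma principal_eq: "principal_fractional_ideals K = {scaled x OK | x. x \<in> K \<and> x \<noteq> 0}"
  unfolding principal_fractional_ideals_def scaled_def ..

lemma iprod_principal: assumes "fractional J" shows "iprod (scaled x OK) J = scaled x J"
  using iprod_scaled[of x OK 1 J] iprod_OK[OF assms] by (simp add: scaled_1)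

text \<open>Multiplying by a principal ideal is scaling, so a coset of the principal ideals is the
  set of nonzero multiples of \<open>J\<close>.\<close>

lemma ideal_class_eq: assumes "fractional J" shows "ideal_class K J = {scaled x J | x. x \<in> K \<and> x \<noteq> 0}"
  unfolding ideal_class_def r_coset_def G_simps principal_eq using iprod_principal[OF assms] by auto

lemma K_1: "1 \<in> K" by (rule O_subset_K[OF O_1])

lemma ideal_class_mult:
  assumes I: "fractional I" and J: "fractional J"
  shows "ideal_class K I <#>\<^bsub>G\<^esub> ideal_class K J = ideal_class K (iprod I J)"
proof (rule equalityI; rule subsetI)
  fix A assume "A \<in> ideal_class K I <#>\<^bsub>G\<^esub> ideal_class K J"
  then obtain x y where xy: "x \<in> K" "x \<noteq> 0" "y \<in> K" "y \<noteq> 0" "A = iprod (scaled x I) (scaled y J)"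
    unfolding set_mult_def ideal_class_eq[OF I] ideal_class_eq[OF J] G_simps by auto
  have "A = scaled (x * y) (iprod I J)" "x * y \<in> K" "x * y \<noteq> 0" using xy iprod_scaled K_mult by auto
  thus "A \<in> ideal_class K (iprod I J)" unfolding ideal_class_eq[OF fractional_iprod[OF I J]] by blast
next
  fix A assume "A \<in> ideal_class K (iprod I J)"
  then obtain x where x: "x \<in> K" "x \<noteq> 0" "A = scaled x (iprod I J)"
    unfolding ideal_class_eq[OF fractional_iprod[OF I J]] by blast
  have "A = iprod (scaled x I) (scaled 1 J)" using x(3) iprod_scaled[of x I 1 J] by simp
  moreover have "scaled x I \<in> ideal_class K I" unfolding ideal_class_eq[OF I] using x by blast
  moreover have "scaled 1 J \<in> ideal_class K J" unfolding ideal_class_eq[OF J] using K_1 by (intro CollectI exI[of _ 1]) simp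
  ultimately show "A \<in> ideal_class K I <#>\<^bsub>G\<^esub> ideal_class K J"
    unfolding set_mult_def G_simps by blast
qed

lemma class_group_simps:
  "carrier (class_group K) = {ideal_class K J | J. fractional J}"
  "A \<otimes>\<^bsub>class_group K\<^esub> B = A <#>\<^bsub>G\<^esub> B" "\<one>\<^bsub>class_group K\<^esub> = ideal_class K OK"
proof -
  show "carrier (class_group K) = {ideal_class K J | J. fractional J}"
    unfolding class_group_def FactGroup_def RCOSETS_def partial_object.simps G_simps ideal_class_def[symmetric] by auto
  show "A \<otimes>\<^bsub>class_group K\<^esub> B = A <#>\<^bsub>G\<^esub> B" by (simp add: class_group_def FactGroup_def)
  show "\<one>\<^bsub>class_group K\<^esub> = ideal_class K OK"
    unfolding class_group_def FactGroup_def ideal_class_eq[OF fractional_OK] by (simp add: principal_eq)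
qed

text \<open>The generators of the Polya group will be shown to be their own inverses, so monoid laws
  suffice for reasoning about what they generate.\<close>

lemma comm_monoid_class_group: "comm_monoid (class_group K)"
proof (rule comm_monoidI)
  show "x \<otimes>\<^bsub>class_group K\<^esub> y \<in> carrier (class_group K)"
    if "x \<in> carrier (class_group K)" "y \<in> carrier (class_group K)" for x y
    using that ideal_class_mult fractional_iprod unfolding class_group_simps by auto
  show "\<one>\<^bsub>class_group K\<^esub> \<in> carrier (class_group K)" unfolding class_group_simps using fractional_OK by blast
  show "x \<otimes>\<^bsub>class_group K\<^esub> y \<otimes>\<^bsub>class_group K\<^esub> z = x \<otimes>\<^bsub>class_group K\<^esub> (y \<otimes>\<^bsub>class_group K\<^esub> z)"
    if "x \<in> carrier (class_group K)" "y \<in> carrier (class_group K)" "z \<in> carrier (class_group K)" for x y z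
    using that unfolding class_group_simps by (auto simp: ideal_class_mult fractional_iprod iprod_assoc)
  show "x \<otimes>\<^bsub>class_group K\<^esub> y = y \<otimes>\<^bsub>class_group K\<^esub> x"
    if "x \<in> carrier (class_group K)" "y \<in> carrier (class_group K)" for x y
    using that unfolding class_group_simps by (auto simp: ideal_class_mult iprod_commute)
  show "\<one>\<^bsub>class_group K\<^esub> \<otimes>\<^bsub>class_group K\<^esub> x = x" if "x \<in> carrier (class_group K)" for x
    using that unfolding class_group_simps by (auto simp: ideal_class_mult fractional_OK iprod_OK)
qed

lemma principal_if_class_trivial:
  assumes "fractional J" "ideal_class K J = ideal_class K OK"
  obtains x where "x \<in> K" "x \<noteq> 0" "J = scaled x OK"
proof -
  have "J \<in> ideal_class K J" unfolding ideal_class_eq[OF assms(1)]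
    using K_1 scaled_1[of J] by (intro CollectI exI[of _ 1]) simp
  hence "\<exists>x. J = scaled x OK \<and> x \<in> K \<and> x \<noteq> 0"
    unfolding assms(2) ideal_class_eq[OF fractional_OK] by simp
  thus ?thesis using that by metis
qed

lemma mem_ideal_class: "fractional J \<Longrightarrow> A \<in> ideal_class K J \<longleftrightarrow> (\<exists>x. x \<in> K \<and> x \<noteq> 0 \<and> A = scaled x J)"
  using ideal_class_eq[of J] by auto

lemma class_of_principal:
  assumes "x \<in> K" "x \<noteq> 0" shows "ideal_class K (scaled x OK) = ideal_class K OK"
proof (rule equalityI; rule subsetI)
  fix A assume "A \<in> ideal_class K (scaled x OK)"
  then obtain y where y: "y \<in> K" "y \<noteq> 0" "A = scaled y (scaled x OK)"
    unfolding mem_ideal_class[OF fractional_scaled[OF assms fractional_OK]] by (elim exE conjE)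
  have "y * x \<in> K \<and> y * x \<noteq> 0 \<and> A = scaled (y * x) OK"
    using K_mult[OF y(1) assms(1)] y(2,3) assms(2) by (simp add: scaled_scaled)
  thus "A \<in> ideal_class K OK" unfolding mem_ideal_class[OF fractional_OK] by (rule exI)
next
  fix A assume "A \<in> ideal_class K OK"
  then obtain y where y: "y \<in> K" "y \<noteq> 0" "A = scaled y OK"
    unfolding mem_ideal_class[OF fractional_OK] by (elim exE conjE)
  have e: "y * inverse x * x = y" using assms(2) by simp
  have "y * inverse x \<in> K \<and> y * inverse x \<noteq> 0 \<and> A = scaled (y * inverse x) (scaled x OK)"
    using K_mult[OF y(1) K_inverse[OF assms(1)]] y(2,3) assms(2) unfolding scaled_scaled e by simp
  thus "A \<in> ideal_class K (scaled x OK)"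
    unfolding mem_ideal_class[OF fractional_scaled[OF assms fractional_OK]] by (rule exI)
qed

end

context squarefree_nat
begin

text \<open>The generator is the gcd \<open>g\<close> of the norms of the elements: \<open>\<alpha> * cnj \<beta> / g\<close> has integral trace
  and norm for all \<open>\<alpha>\<close>, \<open>\<beta>\<close> in the ideal.\<close>

lemma integral_iprod_cnj:
  assumes J: "fractional J" and JO: "J \<subseteq> OK"
  obtains g :: nat where "g > 0" "iprod J (cnj ` J) = scaled (of_nat g) OK"
proof -
  define P where "P = iprod J (cnj ` J)"
  have P: "fractional P" unfolding P_def by (rule fractional_iprod[OF J fractional_cnj[OF J]])
  have norm_mem: "\<exists>n. (cmod a)^2 = of_int n \<and> of_int n \<in> P" if a: "a \<in> J" for a
  proof -
    have "(cmod a)^2 \<in> \<int>" using subsetD[OF JO a] by (simp add: mem_O_iff)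
    then obtain n where n: "(cmod a)^2 = of_int n" by (rule Ints_cases)
    have "a * cnj a \<in> P" unfolding P_def by (rule iprod_mem[OF a imageI[OF a]])
    also have "a * cnj a = of_int n" using complex_norm_square[of a] n by simp
    finally show ?thesis using n by blast
  qed
  have P_mult: "of_int (k * m) \<in> P" if "of_int m \<in> P" for k m
    using fractionalD(4)[OF P O_of_int[of k] that] by simp
  define Q where "Q k \<longleftrightarrow> k > 0 \<and> of_nat k \<in> P" for k :: nat
  obtain a0 where a0: "a0 \<in> J" "a0 \<noteq> 0" using fractionalD(5)[OF J] by blast
  obtain n0 where n0: "(cmod a0)^2 = of_int n0" "of_int n0 \<in> P" using norm_mem[OF a0(1)] by blast
  have "n0 > 0" using n0(1) a0(2) by (metis of_int_0_less_iff zero_less_norm_iff zero_less_power)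
  hence "Q (nat n0)" unfolding Q_def using n0(2) by simp
  \<comment> \<open>The least positive integer in the product divides every integer in it, by
    division with remainder; in particular it divides norms of elements of \<open>J\<close> and
    traces of \<open>a * cnj b\<close>.\<close>
  define g where "g = (LEAST k. Q k)"
  have Qg: "Q g" unfolding g_def by (rule LeastI[of Q, OF \<open>Q (nat n0)\<close>])
  have g0: "g > 0" and gP: "of_nat g \<in> P" using Qg by (auto simp: Q_def)
  have g_dvd: "int g dvd m" if m: "of_int m \<in> P" for m
  proof (rule ccontr)
    assume "\<not> int g dvd m"
    hence pos: "m mod int g > 0" using g0 by (simp add: dvd_eq_mod_eq_0 order_neq_le_trans)
    have lt: "m mod int g < int g" using g0 by simp
    have gPi: "of_int (int g) \<in> P" using gP by simp
    have "of_int m + of_int (- (m div int g) * int g) \<in> P" by (rule fractionalD(2)[OF P m P_mult[OF gPi]])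
    also have "of_int m + of_int (- (m div int g) * int g) = (of_int (m mod int g) :: complex)"
      by (simp add: minus_div_mult_eq_mod[symmetric])
    finally have "Q (nat (m mod int g))" unfolding Q_def using pos by simp
    hence "g \<le> nat (m mod int g)" unfolding g_def by (rule Least_le)
    thus False using lt pos by linarith
  qed
  have in_O: "a * cnj b / of_nat g \<in> OK" if a: "a \<in> J" and b: "b \<in> J" for a b
  proof -
    have abO: "a * cnj b \<in> OK" using subsetD[OF JO a] subsetD[OF JO b] by (intro O_mult O_cnj)
    obtain n where n: "(cmod a)^2 = of_int n" "of_int n \<in> P" using norm_mem[OF a] by blast
    obtain m where m: "(cmod b)^2 = of_int m" "of_int m \<in> P" using norm_mem[OF b] by blast
    have "2 * Re (a * cnj b) \<in> \<int>" using abO unfolding mem_O_iff by blast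
    then obtain t where t: "2 * Re (a * cnj b) = of_int t" by (rule Ints_cases)
    have "a * cnj b + b * cnj a \<in> P" unfolding P_def
      by (intro iprod_add iprod_mem imageI a b)
    also have "a * cnj b + b * cnj a = of_real (2 * Re (a * cnj b))" by (simp add: complex_eq_iff)
    also have "\<dots> = of_int t" unfolding t by simp
    finally have "of_int t \<in> P" .
    then obtain t' where t': "t = int g * t'" using g_dvd by blast
    obtain n' where n': "n = int g * n'" using g_dvd[OF n(2)] by blast
    obtain m' where m': "m = int g * m'" using g_dvd[OF m(2)] by blast
    have eq: "a * cnj b / of_nat g = (a * cnj b) * complex_of_real (1 / real g)" by simp
    have "a * cnj b / of_nat g \<in> K"
      unfolding eq by (rule K_mult[OF O_subset_K[OF abO] K_of_real]) simp
    moreover have "2 * Re (a * cnj b / of_nat g) = (2 * Re (a * cnj b)) / real g"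
      unfolding eq by (simp add: field_simps)
    hence "2 * Re (a * cnj b / of_nat g) = of_int t'" unfolding t t' using g0 by simp
    \<comment> \<open>One \<open>g\<close> is cancelled against each of the two norms.\<close>
    moreover have "(cmod (a * cnj b / of_nat g))^2 = (cmod a)^2 * (cmod b)^2 / (real g)^2"
      by (simp add: norm_mult norm_divide power_mult_distrib power_divide)
    hence "(cmod (a * cnj b / of_nat g))^2 = of_int (n' * m')"
      unfolding n(1) m(1) n' m' using g0 by (simp add: power2_eq_square)
    ultimately show ?thesis unfolding mem_O_iff by simp
  qed
  have "P = scaled (of_nat g) OK"
  proof (rule equalityI; rule subsetI)
    fix z assume z: "z \<in> P"
    have "z \<in> {z. z / of_nat g \<in> OK}"
    proof (rule iprod_least[OF _ _ z[unfolded P_def]])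
      fix x y assume "x \<in> J" "y \<in> cnj ` J"
      thus "x * y \<in> {z. z / of_nat g \<in> OK}" using in_O by auto
    next
      fix x y assume "x \<in> {z. z / of_nat g \<in> OK}" "y \<in> {z. z / of_nat g \<in> OK}"
      thus "x + y \<in> {z. z / of_nat g \<in> OK}" using O_add by (simp add: add_divide_distrib)
    qed
    hence "z / of_nat g \<in> OK" by simp
    moreover have "z = of_nat g * (z / of_nat g)" using g0 by simp
    ultimately show "z \<in> scaled (of_nat g) OK" unfolding scaled_def by (rule image_eqI[rotated])
  next
    fix z assume "z \<in> scaled (of_nat g) OK"
    then obtain a where "a \<in> OK" "z = a * of_nat g" by (auto simp: scaled_def)
    thus "z \<in> P" using fractionalD(4)[OF P _ gP] by simp
  qed
  thus ?thesis using that[OF g0] unfolding P_def by blast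
qed

lemma scaled_cnj: "cnj ` scaled x J = scaled (cnj x) (cnj ` J)"
  by (simp add: scaled_def image_image)

text \<open>A denominator \<open>D\<close> makes the ideal integral, and the product with the
  conjugate is then scaled by \<open>D * cnj D\<close>, which is divided out again.\<close>

lemma iprod_cnj_principal:
  assumes J: "fractional J"
  obtains z where "z \<in> K" "z \<noteq> 0" "iprod J (cnj ` J) = scaled z OK"
proof -
  obtain D where D: "D \<in> OK" "D \<noteq> 0" "\<And>x. x \<in> J \<Longrightarrow> D * x \<in> OK" using fractionalD(6)[OF J] by blast
  have DK: "D \<in> K" by (rule O_subset_K[OF D(1)])
  have f: "fractional (scaled D J)" by (rule fractional_scaled[OF DK D(2) J])
  have "scaled D J \<subseteq> OK" using D(3) by (auto simp: scaled_def)
  from integral_iprod_cnj[OF f this] obtain g where g: "g > 0" "iprod (scaled D J) (cnj ` scaled D J) = scaled (of_nat g) OK"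
    by metis
  define e where "e = D * cnj D"
  have e: "e \<in> K" "e \<noteq> 0" unfolding e_def using DK D(2) by (auto intro: K_mult K_cnj)
  have "scaled e (iprod J (cnj ` J)) = scaled (of_nat g) OK"
    using g(2) unfolding scaled_cnj iprod_scaled e_def .
  hence "scaled (inverse e) (scaled e (iprod J (cnj ` J))) = scaled (inverse e) (scaled (of_nat g) OK)" by simp
  hence "iprod J (cnj ` J) = scaled (inverse e * of_nat g) OK"
    unfolding scaled_scaled using e(2) by (simp add: scaled_1)
  moreover have "inverse e * of_nat g \<in> K"
    using K_mult[OF K_inverse[OF e(1)] O_subset_K[OF O_of_int[of "int g"]]] by simp
  moreover have "inverse e * of_nat g \<noteq> 0" using e(2) g(1) by simp
  ultimately show ?thesis using that by blast
qed

lemma cnj_OK: "cnj ` OK = OK"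
proof (rule equalityI; rule subsetI)
  show "x \<in> cnj ` OK" if "x \<in> OK" for x
    using O_cnj[OF that] by (intro image_eqI[of _ _ "cnj x"]) simp_all
qed (auto intro: O_cnj)

section \<open>Prime ideals, their norms and conjugation\<close>

abbreviation R :: "complex ring" where "R \<equiv> ring_of_integers K"

lemma R_simps: "x \<otimes>\<^bsub>R\<^esub> y = x * y" "x \<oplus>\<^bsub>R\<^esub> y = x + y" "\<zero>\<^bsub>R\<^esub> = 0" "\<one>\<^bsub>R\<^esub> = 1"
  by (simp_all add: ring_of_integers_def ring_of_type_algebra_def)

lemma abelian_group_R: "abelian_group R"
proof (rule abelian_groupI)
  show "\<exists>y\<in>OK. y \<oplus>\<^bsub>R\<^esub> x = \<zero>\<^bsub>R\<^esub>" if "x \<in> OK" for x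
    using O_uminus[OF that] by (intro bexI[of _ "- x"]) (simp_all add: R_simps)
qed (simp_all add: R_simps O_add O_0)

lemma cring_R: "cring R"
proof (rule cringI[OF abelian_group_R])
  show "comm_monoid R" by (rule comm_monoidI) (simp_all add: R_simps O_mult O_1)
qed (simp add: R_simps distrib_right)

lemma R_minus: assumes "x \<in> OK" shows "\<ominus>\<^bsub>R\<^esub> x = - x"
  using abelian_group.minus_equality[OF abelian_group_R, of "- x" x] assms O_uminus[OF assms]
  by (simp add: R_simps)

lemma primeideal_R_D:
  assumes "primeideal P R"
  shows "P \<subseteq> OK" "0 \<in> P" "x \<in> P \<Longrightarrow> y \<in> P \<Longrightarrow> x + y \<in> P" "x \<in> P \<Longrightarrow> - x \<in> P"
    "a \<in> OK \<Longrightarrow> x \<in> P \<Longrightarrow> a * x \<in> P" "OK \<noteq> P"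
    "a \<in> OK \<Longrightarrow> b \<in> OK \<Longrightarrow> a * b \<in> P \<Longrightarrow> a \<in> P \<or> b \<in> P"
proof -
  have id: "ideal P R" using assms by (rule primeideal.axioms(1))
  have ad: "additive_subgroup P R" using id by (rule ideal.axioms(1))
  show sub: "P \<subseteq> OK" by (rule additive_subgroup.a_subset[OF ad])
  show "0 \<in> P" using additive_subgroup.zero_closed[OF ad] by (simp add: R_simps)
  show "x + y \<in> P" if "x \<in> P" "y \<in> P" using additive_subgroup.a_closed[OF ad that] by (simp add: R_simps)
  show "a * x \<in> P" if "a \<in> OK" "x \<in> P" for a x using ideal.I_l_closed[OF id that(2,1)] by (simp add: R_simps)
  from this[OF O_uminus[OF O_1]] show "- x \<in> P" if "x \<in> P" using that by simp
  show "OK \<noteq> P" by (rule primeideal.I_notcarr[OF assms])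
  show "a \<in> P \<or> b \<in> P" if "a \<in> OK" "b \<in> OK" "a * b \<in> P"
    using primeideal.I_prime[OF assms that(1,2)] that(3) by (simp add: R_simps)
qed

lemma primeideal_cnj: assumes "primeideal P R" shows "primeideal (cnj ` P) R"
proof -
  note D = primeideal_R_D[OF assms]
  have cc: "x \<in> cnj ` P \<longleftrightarrow> cnj x \<in> P" for x by (metis complex_cnj_cnj image_iff)
  have sub: "cnj ` P \<subseteq> OK" using D(1) O_cnj by blast
  show ?thesis
  proof (rule primeidealI2[OF _ cring_R])
    show "additive_subgroup (cnj ` P) R"
    proof (intro additive_subgroup.intro subgroup.intro)
      show "inv\<^bsub>add_monoid R\<^esub> x \<in> cnj ` P" if "x \<in> cnj ` P" for x
        using that D(4)[of "cnj x"] R_minus[of x] sub unfolding a_inv_def[symmetric] cc by (auto simp: cc)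
      show "x \<otimes>\<^bsub>add_monoid R\<^esub> y \<in> cnj ` P" if "x \<in> cnj ` P" "y \<in> cnj ` P" for x y
        using that D(3)[of "cnj x" "cnj y"] unfolding cc by (simp add: R_simps)
    qed (use sub in \<open>simp_all add: cc R_simps D(2)\<close>)
    show "x \<otimes>\<^bsub>R\<^esub> a \<in> cnj ` P" "a \<otimes>\<^bsub>R\<^esub> x \<in> cnj ` P" if "a \<in> cnj ` P" "x \<in> OK" for a x
      using that D(5)[OF O_cnj[OF that(2)], of "cnj a"] unfolding cc by (simp_all add: R_simps mult.commute)
    show "OK \<noteq> cnj ` P"
    proof
      assume "OK = cnj ` P"
      hence "1 \<in> cnj ` P" using O_1 by simp
      hence "1 \<in> P" unfolding cc by simp
      hence "OK \<subseteq> P" using D(5)[of _ 1] by auto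
      thus False using D(1,6) by blast
    qed
    show "a \<in> cnj ` P \<or> b \<in> cnj ` P" if "a \<in> OK" "b \<in> OK" "a \<otimes>\<^bsub>R\<^esub> b \<in> cnj ` P" for a b
      using that(3) D(7)[OF O_cnj[OF that(1)] O_cnj[OF that(2)]] unfolding cc by (simp add: R_simps)
  qed
qed

lemma absolute_norm_eq: "absolute_norm K P = card ((\<lambda>a. (\<lambda>p. p + a) ` P) ` OK)"
proof -
  have "carrier (R Quot P) = (\<lambda>a. (\<lambda>p. p + a) ` P) ` OK"
    unfolding FactRing_def A_RCOSETS_def RCOSETS_def r_coset_def by (auto simp: R_simps)
  thus ?thesis unfolding absolute_norm_def Coset.order_def by simp
qed

text \<open>Conjugation preserves the ring of integers and maps cosets of \<open>P\<close>
  bijectively to cosets of its conjugate.\<close>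

lemma absolute_norm_cnj: "absolute_norm K (cnj ` P) = absolute_norm K P"
proof -
  have "(\<lambda>a. (\<lambda>p. p + a) ` (cnj ` P)) ` (cnj ` OK) = (\<lambda>A. cnj ` A) ` ((\<lambda>a. (\<lambda>p. p + a) ` P) ` OK)"
    by (simp add: image_image)
  moreover have "inj_on (\<lambda>A. cnj ` A) S" for S
    by (rule inj_on_inverseI[of _ "\<lambda>A. cnj ` A"]) (simp add: image_image)
  ultimately show ?thesis unfolding absolute_norm_eq cnj_OK by (simp add: card_image)
qed

lemma absolute_norm_zero: "absolute_norm K {0} = 0"
proof -
  have "inj (of_int :: int \<Rightarrow> complex)" by (rule injI) simp
  hence "infinite (range (of_int :: int \<Rightarrow> complex))" using finite_imageD infinite_UNIV_int by blast
  hence "infinite OK" using O_of_int by (meson finite_subset image_subsetI)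
  moreover have "inj_on (\<lambda>a. {a}) OK" by (rule inj_onI) simp
  ultimately have "infinite ((\<lambda>a. {a}) ` OK)" using finite_imageD by blast
  thus ?thesis unfolding absolute_norm_eq by simp
qed

definition primes_of_norm :: "nat \<Rightarrow> complex set set"
  where "primes_of_norm q = {P. primeideal P R \<and> absolute_norm K P = q}"

lemma primes_of_norm_fractional:
  assumes "q > 0" "P \<in> primes_of_norm q" shows "fractional P"
proof -
  have P: "primeideal P R" "absolute_norm K P = q" using assms(2) by (auto simp: primes_of_norm_def)
  note D = primeideal_R_D[OF P(1)]
  have "P \<noteq> {0}" using absolute_norm_zero P(2) assms(1) by auto
  then obtain z where z: "z \<in> P" "z \<noteq> 0" using D(2) by blast
  show ?thesis
    by (rule fractionalI[of P z 1]) (use z D(1,2,3,5) O_1 O_subset_K in auto)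
qed

lemma primes_of_norm_cnj: "(\<lambda>A. cnj ` A) ` primes_of_norm q = primes_of_norm q"
proof -
  have cl: "cnj ` P \<in> primes_of_norm q" if "P \<in> primes_of_norm q" for P
    using that primeideal_cnj absolute_norm_cnj by (simp add: primes_of_norm_def)
  show ?thesis
  proof (rule equalityI; rule subsetI)
    show "P \<in> (\<lambda>A. cnj ` A) ` primes_of_norm q" if "P \<in> primes_of_norm q" for P
      by (rule image_eqI[OF _ cl[OF that]]) (simp add: image_image)
  qed (auto intro: cl)
qed

lemma cnj_finprod:
  assumes "finite S" "\<And>P. P \<in> S \<Longrightarrow> fractional P"
  shows "cnj ` finprod G (\<lambda>P. P) S = finprod G (\<lambda>P. cnj ` P) S"
proof -
  interpret G: comm_monoid G by (rule comm_monoid_G)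
  show ?thesis using assms
  proof (induction S rule: finite_induct)
    case empty show ?case by (simp add: G_simps cnj_OK)
  next
    case (insert P S)
    have "finprod G (\<lambda>P. P) (insert P S) = iprod P (finprod G (\<lambda>P. P) S)"
      using G.finprod_insert[of S P "\<lambda>P. P"] insert by (simp add: G_simps)
    moreover have "finprod G (\<lambda>P. cnj ` P) (insert P S) = iprod (cnj ` P) (finprod G (\<lambda>P. cnj ` P) S)"
      using G.finprod_insert[of S P "\<lambda>P. cnj ` P"] insert fractional_cnj by (simp add: G_simps)
    moreover have "cnj ` finprod G (\<lambda>P. P) S = finprod G (\<lambda>P. cnj ` P) S" using insert by simp
    ultimately show ?case by (simp add: iprod_cnj[symmetric])
  qed
qed

text \<open>Conjugation permutes the primes of a given norm and respects products, so the product of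
  these primes is stable.\<close>

lemma norm_ideal_fractional_cnj:
  assumes "q > 0"
  shows "fractional (norm_ideal K q)" "cnj ` norm_ideal K q = norm_ideal K q"
proof -
  interpret G: comm_monoid G by (rule comm_monoid_G)
  have eq: "norm_ideal K q = finprod G (\<lambda>P. P) (primes_of_norm q)"
    unfolding norm_ideal_def primes_of_norm_def ..
  have fr: "fractional P" if "P \<in> primes_of_norm q" for P by (rule primes_of_norm_fractional[OF assms that])
  have "finprod G (\<lambda>P. P) (primes_of_norm q) \<in> carrier G"
    by (rule G.finprod_closed) (use fr in \<open>simp add: G_simps\<close>)
  thus "fractional (norm_ideal K q)" unfolding eq G_simps by simp
  show "cnj ` norm_ideal K q = norm_ideal K q"
  proof (cases "finite (primes_of_norm q)")
    case True
    have re: "finprod G (\<lambda>P. P) ((\<lambda>A. cnj ` A) ` primes_of_norm q) = finprod G (\<lambda>P. cnj ` P) (primes_of_norm q)"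
    proof (rule G.finprod_reindex)
      show "(\<lambda>P. P) \<in> (`) cnj ` primes_of_norm q \<rightarrow> carrier G"
        unfolding primes_of_norm_cnj using fr by (simp add: G_simps)
      show "inj_on ((`) cnj) (primes_of_norm q)"
        by (rule inj_on_inverseI[of _ "\<lambda>A. cnj ` A"]) (simp add: image_image)
    qed
    have "cnj ` norm_ideal K q = finprod G (\<lambda>P. cnj ` P) (primes_of_norm q)"
      unfolding eq by (rule cnj_finprod[OF True fr])
    also have "\<dots> = norm_ideal K q" unfolding re[symmetric] primes_of_norm_cnj eq ..
    finally show ?thesis .
  next
    \<comment> \<open>\<open>finprod\<close> over an infinite set is the unit by convention, here
      the ring of integers, which is stable under conjugation too.\<close>
    case False
    have "finprod G (\<lambda>P. P) (primes_of_norm q) = OK" using G.finprod_infinite[OF False] by (simp add: G_simps)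
    thus ?thesis unfolding eq by (simp add: cnj_OK)
  qed
qed

text \<open>For a conjugation-stable ideal the square is its product with the conjugate, hence
  principal. So each generator is its own inverse, and commutativity passes this on to
  products.\<close>

lemma polya_group_square:
  assumes "c \<in> polya_group K"
  shows "c \<in> carrier (class_group K) \<and> c \<otimes>\<^bsub>class_group K\<^esub> c = \<one>\<^bsub>class_group K\<^esub>"
proof -
  interpret C: comm_monoid "class_group K" by (rule comm_monoid_class_group)
  have gen: "c \<in> carrier (class_group K) \<and> c \<otimes>\<^bsub>class_group K\<^esub> c = \<one>\<^bsub>class_group K\<^esub>"
    if c: "c \<in> {ideal_class K (norm_ideal K q) | q. q > 0}" for c
  proof -
    obtain q where q: "q > 0" "c = ideal_class K (norm_ideal K q)" using c by auto
    note J = norm_ideal_fractional_cnj[OF q(1)]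
    obtain z where z: "z \<in> K" "z \<noteq> 0" "iprod (norm_ideal K q) (norm_ideal K q) = scaled z OK"
      using iprod_cnj_principal[OF J(1)] unfolding J(2) by metis
    have "c \<otimes>\<^bsub>class_group K\<^esub> c = ideal_class K (scaled z OK)"
      unfolding q(2) class_group_simps ideal_class_mult[OF J(1) J(1)] z(3) ..
    also have "\<dots> = \<one>\<^bsub>class_group K\<^esub>" unfolding class_group_simps by (rule class_of_principal[OF z(1,2)])
    finally show ?thesis using J(1) unfolding q(2) class_group_simps(1) by auto
  qed
  show ?thesis using assms unfolding polya_group_def
  proof (induction rule: generate.induct)
    case (inv h)
    have "inv\<^bsub>class_group K\<^esub> h = h" using gen[OF inv] by (intro C.inv_char) simp_all
    thus ?case using gen[OF inv] by simp
  next
    case (eng a b)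
    have "(a \<otimes>\<^bsub>class_group K\<^esub> b) \<otimes>\<^bsub>class_group K\<^esub> (a \<otimes>\<^bsub>class_group K\<^esub> b) =
      (a \<otimes>\<^bsub>class_group K\<^esub> a) \<otimes>\<^bsub>class_group K\<^esub> (b \<otimes>\<^bsub>class_group K\<^esub> b)"
      using eng.IH by (simp add: C.m_ac)
    thus ?case using eng.IH by simp
  qed (use gen in simp_all)
qed

lemma square_principal:
  assumes "carrier (class_group K) = polya_group K" "fractional J"
  obtains x where "x \<in> K" "x \<noteq> 0" "iprod J J = scaled x OK"
proof -
  have "ideal_class K J \<in> carrier (class_group K)" unfolding class_group_simps using assms(2) by blast
  hence "ideal_class K J \<otimes>\<^bsub>class_group K\<^esub> ideal_class K J = \<one>\<^bsub>class_group K\<^esub>"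
    using polya_group_square unfolding assms(1) by blast
  hence "ideal_class K (iprod J J) = ideal_class K OK"
    unfolding class_group_simps ideal_class_mult[OF assms(2) assms(2)] .
  with fractional_iprod[OF assms(2) assms(2)] show ?thesis using that by (rule principal_if_class_trivial)
qed

end

section \<open>From the equality of the two groups to represented squares\<close>

context squarefree_nat
begin

text \<open>The ideal \<open>J\<close> generated by \<open>n\<close> and \<beta> = b + sqrt(-d) has
  product \<open>n\<close> with its conjugate. If its square is generated by \<alpha>, comparing
  norms gives |\<alpha>|^2 = n^2, which in half-integral coordinates is the desired
  equation.\<close>

lemma squares_represented_if_class_group_eq_polya_group:
  assumes eq: "carrier (class_group K) = polya_group K"
  shows "squares_represented d"
  unfolding squares_represented_def
proof (intro allI impI)
  fix n :: nat assume n1: "n > 1" and cop: "coprime n (2 * d)" and ex: "\<exists>b. int n dvd b^2 + int d"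
  from ex obtain b where b: "int n dvd b^2 + int d" by (elim exE)
  then obtain c where c: "b^2 + int d = int n * c" by (elim dvdE)
  have "coprime n 2" "coprime n d" using cop by (simp_all only: coprime_mult_right_iff)
  hence "coprime (int n) (int 2)" and cd: "coprime (int n) (int d)" by (simp_all only: coprime_int_iff)
  hence codd: "coprime (int n) 2" by simp
  have cb: "coprime (int n) b"
  proof (rule coprimeI)
    fix g assume g: "g dvd int n" "g dvd b"
    have "g dvd b^2 + int d" using g(1) b dvd_trans by blast
    hence "g dvd int d" using g(2) by (simp add: power2_eq_square dvd_add_right_iff)
    thus "is_unit g" using g(1) coprime_common_divisor[OF cd] by simp
  qed
  have c2b: "coprime (int n) (2 * b)" using codd cb by (simp add: coprime_mult_right_iff)
  define \<nu> :: complex where "\<nu> = of_nat n"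
  define \<beta> where "\<beta> = half (2 * b) 2"
  have \<beta>O: "\<beta> \<in> OK" unfolding \<beta>_def by (rule half_in_O) (simp add: power_mult_distrib)
  have \<nu>O: "\<nu> \<in> OK" unfolding \<nu>_def using O_of_int[of "int n"] by simp
  have \<nu>0: "\<nu> \<noteq> 0" and \<nu>K: "\<nu> \<in> K" using n1 O_subset_K[OF \<nu>O] by (auto simp: \<nu>_def)
  have c\<nu>: "cnj \<nu> = \<nu>" by (simp add: \<nu>_def)
  have \<beta>\<beta>: "\<beta> * cnj \<beta> = \<nu> * of_int c"
  proof -
    have "(cmod \<beta>)^2 = real_of_int (b^2 + int d)" unfolding \<beta>_def norm_half by (simp add: power_mult_distrib)
    hence "\<beta> * cnj \<beta> = complex_of_real (real_of_int (int n * c))" unfolding c complex_norm_square[symmetric] by simp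
    thus ?thesis by (simp add: \<nu>_def)
  qed
  have \<beta>tr: "\<beta> + cnj \<beta> = of_int (2 * b)" by (simp add: \<beta>_def half_def complex_eq_iff)
  define J where "J = {\<nu> * x + \<beta> * y | x y. x \<in> OK \<and> y \<in> OK}"
  have JI: "\<nu> * x + \<beta> * y \<in> J" if "x \<in> OK" "y \<in> OK" for x y unfolding J_def using that by blast
  have JE: "\<exists>x y. x \<in> OK \<and> y \<in> OK \<and> z = \<nu> * x + \<beta> * y" if "z \<in> J" for z using that unfolding J_def by auto
  have JO: "z \<in> OK" if "z \<in> J" for z
    using JE[OF that] O_add O_mult[OF \<nu>O] O_mult[OF \<beta>O] by auto
  have \<nu>J: "\<nu> \<in> J" using JI[OF O_1 O_0] by simp
  have \<beta>J: "\<beta> \<in> J" using JI[OF O_0 O_1] by simp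
  have J: "fractional J"
  proof (rule fractionalI[OF _ _ _ \<nu>J \<nu>0 _ O_1])
    show "0 \<in> J" using JI[OF O_0 O_0] by simp
    show "x \<in> K" if "x \<in> J" for x using JO[OF that] by (rule O_subset_K)
    fix z assume z: "z \<in> J"
    then obtain x y where xy: "x \<in> OK" "y \<in> OK" "z = \<nu> * x + \<beta> * y" using JE[OF z] by auto
    show "1 * z \<in> OK" using JO[OF z] by simp
    show "a * z \<in> J" if a: "a \<in> OK" for a
    proof -
      have "a * z = \<nu> * (a * x) + \<beta> * (a * y)" unfolding xy by (simp add: algebra_simps)
      thus ?thesis using JI[OF O_mult[OF a xy(1)] O_mult[OF a xy(2)]] by simp
    qed
    fix z' assume z': "z' \<in> J"
    then obtain x' y' where xy': "x' \<in> OK" "y' \<in> OK" "z' = \<nu> * x' + \<beta> * y'" using JE[OF z'] by auto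
    have "z + z' = \<nu> * (x + x') + \<beta> * (y + y')" unfolding xy xy' by (simp add: algebra_simps)
    thus "z + z' \<in> J" using JI[OF O_add[OF xy(1) xy'(1)] O_add[OF xy(2) xy'(2)]] by simp
  qed simp
  have nuf: "fractional (scaled \<nu> OK)" by (rule fractional_scaled[OF \<nu>K \<nu>0 fractional_OK])
  have N: "iprod J (cnj ` J) = scaled \<nu> OK"
  proof (rule equalityI; rule subsetI)
    fix z assume z: "z \<in> iprod J (cnj ` J)"
    show "z \<in> scaled \<nu> OK"
    proof (rule iprod_least[OF _ _ z])
      fix r s assume r: "r \<in> J" and "s \<in> cnj ` J"
      then obtain s' where s': "s' \<in> J" "s = cnj s'" by blast
      obtain x y where xy: "x \<in> OK" "y \<in> OK" "r = \<nu> * x + \<beta> * y" using JE[OF r] by auto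
      obtain x' y' where xy': "x' \<in> OK" "y' \<in> OK" "s' = \<nu> * x' + \<beta> * y'" using JE[OF s'(1)] by auto
      define e where "e = \<nu> * x * cnj x' + x * cnj \<beta> * cnj y' + \<beta> * y * cnj x' + of_int c * y * cnj y'"
      have "r * s = \<nu> * (\<nu> * x * cnj x' + x * cnj \<beta> * cnj y' + \<beta> * y * cnj x') + (\<beta> * cnj \<beta>) * (y * cnj y')"
        unfolding xy xy' s' by (simp add: c\<nu> algebra_simps)
      also have "\<dots> = \<nu> * e" unfolding \<beta>\<beta> e_def by (simp add: algebra_simps)
      finally have "r * s = \<nu> * e" .
      moreover have "e \<in> OK" unfolding e_def
        using xy(1,2) xy'(1,2) \<nu>O \<beta>O by (intro O_add O_mult O_cnj O_of_int)
      ultimately show "r * s \<in> scaled \<nu> OK" unfolding scaled_def by (rule image_eqI)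
    qed (rule fractionalD(2)[OF nuf])
  next
    fix z assume "z \<in> scaled \<nu> OK"
    then obtain a where a: "a \<in> OK" "z = a * \<nu>" by (auto simp: scaled_def)
    have P: "fractional (iprod J (cnj ` J))" by (rule fractional_iprod[OF J fractional_cnj[OF J]])
    \<comment> \<open>The product contains n^2 and n times the trace 2 b of \<beta>; as n is prime
      to 2 b, it contains n.\<close>
    obtain s t where "s * int n + t * (2 * b) = gcd (int n) (2 * b)" using bezout_int[of "int n" "2 * b"] by (elim exE)
    hence st: "s * int n + t * (2 * b) = 1" using coprime_imp_gcd_eq_1[OF c2b] by simp
    have m1: "\<nu> * cnj \<nu> \<in> iprod J (cnj ` J)" by (rule iprod_mem[OF \<nu>J imageI[OF \<nu>J]])
    have m2: "\<nu> * cnj \<beta> \<in> iprod J (cnj ` J)" by (rule iprod_mem[OF \<nu>J imageI[OF \<beta>J]])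
    have m3: "\<beta> * cnj \<nu> \<in> iprod J (cnj ` J)" by (rule iprod_mem[OF \<beta>J imageI[OF \<nu>J]])
    have "of_int s * (\<nu> * cnj \<nu>) + of_int t * (\<nu> * cnj \<beta> + \<beta> * cnj \<nu>) \<in> iprod J (cnj ` J)"
      by (intro fractionalD(2)[OF P] fractionalD(4)[OF P] O_of_int m1 m2 m3)
    also have "of_int s * (\<nu> * cnj \<nu>) + of_int t * (\<nu> * cnj \<beta> + \<beta> * cnj \<nu>) = \<nu> * (of_int s * \<nu> + of_int t * (\<beta> + cnj \<beta>))"
      by (simp add: c\<nu> algebra_simps)
    also have "of_int s * \<nu> + of_int t * (\<beta> + cnj \<beta>) = of_int (s * int n + t * (2 * b))"
      unfolding \<beta>tr \<nu>_def by simp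
    finally have "\<nu> \<in> iprod J (cnj ` J)" unfolding st by simp
    thus "z \<in> iprod J (cnj ` J)" unfolding a(2) using a(1) by (intro fractionalD(4)[OF P])
  qed
  obtain \<alpha> where \<alpha>: "\<alpha> \<in> K" "\<alpha> \<noteq> 0" "iprod J J = scaled \<alpha> OK" by (rule square_principal[OF eq J])
  have OO: "iprod OK OK = OK" by (rule iprod_OK[OF fractional_OK])
  define r where "r = (cmod \<alpha>)^2"
  have r0: "r > 0" using \<alpha>(2) by (simp add: r_def)
  \<comment> \<open>Regrouping shows that |\<alpha>|^2 and n^2 generate the same ideal. Both ratios
    are rational integers, and being positive they equal 1.\<close>
  have "iprod (iprod J J) (iprod (cnj ` J) (cnj ` J)) = iprod (iprod J (cnj ` J)) (iprod J (cnj ` J))"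
  proof -
    have "iprod J (iprod (cnj ` J) (cnj ` J)) = iprod (cnj ` J) (iprod J (cnj ` J))"
      unfolding iprod_assoc[symmetric] by (subst iprod_commute[of J]) (rule refl)
    thus ?thesis by (simp only: iprod_assoc)
  qed
  moreover have "iprod (iprod J J) (iprod (cnj ` J) (cnj ` J)) = scaled (\<alpha> * cnj \<alpha>) OK"
    unfolding iprod_cnj \<alpha>(3) scaled_cnj cnj_OK iprod_scaled OO ..
  moreover have "iprod (iprod J (cnj ` J)) (iprod J (cnj ` J)) = scaled (\<nu> * \<nu>) OK"
    unfolding N iprod_scaled OO ..
  ultimately have sc: "scaled (\<alpha> * cnj \<alpha>) OK = scaled (\<nu> * \<nu>) OK" by simp
  have \<alpha>r: "\<alpha> * cnj \<alpha> = complex_of_real r" unfolding r_def by (rule complex_norm_square[symmetric])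
  have \<nu>\<nu>: "\<nu> * \<nu> = complex_of_real (real n ^ 2)" by (simp add: \<nu>_def power2_eq_square)
  have mem: "x \<in> scaled x OK" for x unfolding scaled_def using O_1 by (intro image_eqI[of _ _ 1]) simp_all
  have quot: "p / q \<in> \<int>" if pq: "complex_of_real p \<in> scaled (complex_of_real q) OK" "q > 0" for p q
  proof -
    obtain a where a: "a \<in> OK" "complex_of_real p = complex_of_real q * a" using pq(1) unfolding scaled_def by (elim imageE) simp
    hence "a = complex_of_real (p / q)" using pq(2) by simp
    thus ?thesis using a(1) O_real_Ints by simp
  qed
  have np: "real n ^ 2 > 0" using n1 by simp
  have "r / real n ^ 2 \<in> \<int>" using mem[of "complex_of_real r"] sc np unfolding \<alpha>r \<nu>\<nu> by (intro quot) simp_all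
  then obtain i where i: "r / real n ^ 2 = of_int i" by (rule Ints_cases)
  have "real n ^ 2 / r \<in> \<int>" using mem[of "complex_of_real (real n ^ 2)"] sc r0 unfolding \<alpha>r \<nu>\<nu> by (intro quot) simp_all
  then obtain j where j: "real n ^ 2 / r = of_int j" by (rule Ints_cases)
  have "of_int i * of_int j = (1 :: real)" unfolding i[symmetric] j[symmetric] using r0 np by simp
  hence "real_of_int (i * j) = real_of_int 1" by simp
  hence ij: "i * j = 1" by (simp only: of_int_eq_iff)
  have "real_of_int i > 0" unfolding i[symmetric] using r0 np by simp
  hence "i > 0" by simp
  hence "i = 1" using ij by (simp add: zmult_eq_1_iff)
  hence rn: "r = real n ^ 2" using i np by simp
  have JJO: "z \<in> OK" if "z \<in> iprod J J" for z
    using that by (rule iprod_least[rotated 2]) (auto intro: O_mult O_add JO)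
  have "\<alpha> \<in> OK" by (rule JJO) (simp only: \<alpha>(3) mem)
  then obtain u v where uv: "\<alpha> = half u v" "4 dvd u^2 + int d * v^2" by (rule O_cases)
  have "real_of_int (u^2 + int d * v^2) / 4 = real n ^ 2" using rn unfolding r_def uv(1) norm_half .
  hence "real_of_int (u^2 + int d * v^2) = real_of_int (4 * (int n)^2)" by simp
  hence main: "4 * (int n)^2 = u^2 + int d * v^2" by (simp only: of_int_eq_iff)
  have "v \<noteq> 0"
  proof
    \<comment> \<open>Then \<alpha> is n up to sign and divides \<beta>^2. Comparing imaginary parts
      gives 8 b = u v' with u^2 = 4 n^2, so n divides 4 b, although n > 1 is odd and prime to
      b.\<close>
    assume v: "v = 0"
    have "\<beta> * \<beta> \<in> scaled \<alpha> OK" unfolding \<alpha>(3)[symmetric] by (rule iprod_mem[OF \<beta>J \<beta>J])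
    then obtain a where a: "a \<in> OK" "\<beta> * \<beta> = \<alpha> * a" by (auto simp: scaled_def)
    obtain u' v' where uv': "a = half u' v'" "4 dvd u'^2 + int d * v'^2" using a(1) by (rule O_cases)
    have "Im (half (2 * b) 2 * half (2 * b) 2) = Im (half u 0 * half u' v')"
      using a(2) unfolding \<beta>_def uv(1) uv'(1) v by simp
    hence "(8 * real_of_int b) * sqrt (real d) = (of_int u * of_int v') * sqrt (real d)"
      unfolding half_mult by simp
    hence "real_of_int (8 * b) = real_of_int (u * v')" using d_pos by simp
    hence "8 * b = u * v'" by (simp only: of_int_eq_iff)
    hence "(8 * b)^2 = u^2 * v'^2" by (simp add: power_mult_distrib)
    also have "u^2 = 4 * (int n)^2" using main v by simp
    finally have "4 * (4 * b)^2 = 4 * (int n * v')^2" by (simp add: power_mult_distrib)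
    hence "(int n * v')^2 = (4 * b)^2" by simp
    hence "(int n)^2 dvd (4 * b)^2" by (metis dvd_triv_left power_mult_distrib)
    hence "int n dvd 4 * b" by (simp only: pow_divides_pow_iff[OF pos2])
    moreover have "coprime (int n) (2 * (2 * b))" using codd c2b by (simp only: coprime_mult_right_iff)
    hence "coprime (int n) (4 * b)" by (simp add: mult.assoc[symmetric])
    ultimately have "is_unit (int n)" using coprime_common_divisor[of "int n" "4 * b" "int n"] by simp
    thus False using n1 by simp
  qed
  thus "\<exists>u v. v \<noteq> 0 \<and> 4 * (int n)^2 = u^2 + int d * v^2" using main by blast
qed

end

theorem theorem3p7:
  shows "finite {K. imaginary_quadratic_field K \<and> carrier (class_group K) = polya_group K}"
proof (rule finite_subset)
  show "{K. imaginary_quadratic_field K \<and> carrier (class_group K) = polya_group K} \<subseteq>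
    quadratic_field ` {d. squarefree d \<and> squares_represented d}"
  proof
    fix K assume "K \<in> {K. imaginary_quadratic_field K \<and> carrier (class_group K) = polya_group K}"
    hence K: "imaginary_quadratic_field K" "carrier (class_group K) = polya_group K" by simp_all
    obtain d where d: "squarefree d" "K = quadratic_field d"
      using K(1) by (rule imaginary_quadratic_field_eq_quadratic_field)
    interpret squarefree_nat d by unfold_locales (rule d(1))
    have "squares_represented d"
      by (rule squares_represented_if_class_group_eq_polya_group) (use K(2) d(2) in simp)
    thus "K \<in> quadratic_field ` {d. squarefree d \<and> squares_represented d}" using d by simp
  qed
  show "finite (quadratic_field ` {d. squarefree d \<and> squares_represented d})"
    by (rule finite_imageI[OF finite_squares_represented])
qed

end
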